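(* There exists a Galois extension $K/\mathbb{Q}$ (with $K\subseteq\overline{\mathbb{Q}}$, possibly of infinite degree) such that infinitely many prime numbers are totally split in $K$ but $K$ does not have the Northcott property.
   Context: $\overline{\mathbb{Q}}$ is a fixed algebraic closure of $\mathbb{Q}$, and $h:\overline{\mathbb{Q}}\rightarrow\mathbb{R}$ denotes the absolute logarithmic Weil height: for $\alpha$ in a number field $F$, $h(\alpha)=\frac{1}{[F:\mathbb{Q}]}\sum_{v}[F_v:\mathbb{Q}_v]\log\max\{1,|\alpha|_v\}$, where $v$ runs over all places of $F$ and $|\cdot|_v$ is normalized to extend the standard absolute value on $\mathbb{Q}$ (real or $p$-adic); this is independent of the choice of $F$. For a field $K\subseteq\overline{\mathbb{Q}}$ and $T>0$ let $K_T:=\{\alpha\in K^\times : h(\alpha)<T\}$. The field $K$ has the Northcott property (N) if $K_T$ is finite for every $T>0$. A prime number $p$ is totally split in a (possibly infinite) Galois extension $K/\mathbb{Q}$ if it is totally split in every finite subextension of $K/\mathbb{Q}$; equivalently, every field embedding of $K$ into an algebraic closure of $\mathbb{Q}_p$ has image contained in $\mathbb{Q}_p$. *)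

theory Defs
  imports
    "HOL-Analysis.Infinite_Sum"
    "HOL-Algebra.Algebraic_Closure_Type"
    "HOL-Algebra.Embedded_Algebras"
    "HOL-Algebra.Generated_Fields"
    "HOL-Algebra.Ideal_Product"
    "HOL-Algebra.QuotRing"
    "HOL-Computational_Algebra.Computational_Algebra"
begin

text \<open>
  The fixed algebraic closure of the rationals is the set of algebraic complex numbers, so all
  fields occurring below are subfields of the complex numbers.
\<close>

definition Qbar :: "complex set"
  where "Qbar = {z. algebraic z}"

abbreviation complex_field :: "complex ring"
  where "complex_field \<equiv> ring_of_type_algebra"

definition degree_over_Q :: "complex set \<Rightarrow> nat"
  where "degree_over_Q F = ring.dim complex_field \<rat> F"

definition number_field :: "complex set \<Rightarrow> bool"
  where "number_field F \<longleftrightarrow>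
    subfield F complex_field \<and> ring.finite_dimension complex_field \<rat> F"

text \<open>
  Galois means algebraic, normal and separable. Every algebraic extension of the rationals is
  separable, so only the first two conditions appear.
\<close>

definition galois_over_Q :: "complex set \<Rightarrow> bool"
  where "galois_over_Q K \<longleftrightarrow>
    subfield K complex_field \<and> K \<subseteq> Qbar \<and>
    (\<forall>f :: rat poly. Factorial_Ring.irreducible f \<longrightarrow>
       (\<exists>x\<in>K. poly (map_poly of_rat f) x = 0) \<longrightarrow>
       (\<forall>z. poly (map_poly of_rat f) z = 0 \<longrightarrow> z \<in> K))"


subsection \<open>Places\<close>

definition padic_abs :: "nat \<Rightarrow> rat \<Rightarrow> real"
  where "padic_abs p q =
    (if q = 0 then 0
     else case quotient_of q of (a, b) \<Rightarrow>
       real p powi (int (multiplicity (int p) b) - int (multiplicity (int p) a)))"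

definition standard_abs_Q :: "(rat \<Rightarrow> real) set"
  where "standard_abs_Q =
    insert (\<lambda>q. \<bar>of_rat q\<bar>) {padic_abs p | p. Factorial_Ring.prime p}"

definition absolute_value_on :: "complex set \<Rightarrow> (complex \<Rightarrow> real) \<Rightarrow> bool"
  where "absolute_value_on F v \<longleftrightarrow>
    (\<forall>x\<in>F. 0 \<le> v x) \<and>
    (\<forall>x\<in>F. v x = 0 \<longleftrightarrow> x = 0) \<and>
    (\<forall>x\<in>F. \<forall>y\<in>F. v (x * y) = v x * v y) \<and>
    (\<forall>x\<in>F. \<forall>y\<in>F. v (x + y) \<le> v x + v y)"

text \<open>
  A place, i.e. an equivalence class of nontrivial absolute values of \<open>F\<close>, is represented by its
  normalized member, the unique one that extends a standard absolute value of the rationals.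
  Membership in \<^term>\<open>extensional F\<close> fixes the values outside \<open>F\<close>, so that distinct functions
  are distinct places.
\<close>

definition places :: "complex set \<Rightarrow> (complex \<Rightarrow> real) set"
  where "places F =
    {v \<in> extensional F. absolute_value_on F v \<and>
       (\<exists>w\<in>standard_abs_Q. \<forall>q. v (of_rat q) = w q)}"


subsection \<open>Completions and local degrees\<close>

definition cauchy_seqs :: "complex set \<Rightarrow> (complex \<Rightarrow> real) \<Rightarrow> (nat \<Rightarrow> complex) set"
  where "cauchy_seqs F v =
    {s. (\<forall>n. s n \<in> F) \<and> (\<forall>e>0. \<exists>N. \<forall>m\<ge>N. \<forall>n\<ge>N. v (s m - s n) < e)}"

definition null_seqs :: "complex set \<Rightarrow> (complex \<Rightarrow> real) \<Rightarrow> (nat \<Rightarrow> complex) set"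
  where "null_seqs F v =
    {s. (\<forall>n. s n \<in> F) \<and> (\<lambda>n. v (s n)) \<longlonglongrightarrow> 0}"

definition cauchy_ring :: "complex set \<Rightarrow> (complex \<Rightarrow> real) \<Rightarrow> (nat \<Rightarrow> complex) ring"
  where "cauchy_ring F v =
    \<lparr> carrier = cauchy_seqs F v, monoid.mult = (\<lambda>s t n. s n * t n), one = (\<lambda>n. 1),
      ring.zero = (\<lambda>n. 0), add = (\<lambda>s t n. s n + t n) \<rparr>"

definition completion :: "complex set \<Rightarrow> (complex \<Rightarrow> real) \<Rightarrow> (nat \<Rightarrow> complex) set ring"
  where "completion F v = cauchy_ring F v Quot null_seqs F v"

text \<open>
  The classes of rational Cauchy sequences form a subfield of the completion of \<open>F\<close> at \<open>v\<close>, namely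
  the completion of the rationals at the place below \<open>v\<close>.
\<close>

definition completion_Q :: "complex set \<Rightarrow> (complex \<Rightarrow> real) \<Rightarrow> (nat \<Rightarrow> complex) set set"
  where "completion_Q F v =
    {null_seqs F v +>\<^bsub>cauchy_ring F v\<^esub> s | s. s \<in> cauchy_seqs \<rat> v}"

definition local_degree :: "complex set \<Rightarrow> (complex \<Rightarrow> real) \<Rightarrow> nat"
  where "local_degree F v =
    ring.dim (completion F v) (completion_Q F v) (carrier (completion F v))"


subsection \<open>The absolute logarithmic Weil height\<close>

text \<open>
  Only finitely many summands are nonzero when \<open>F\<close> is a number field and \<open>x\<close> lies in \<open>F\<close>.
\<close>

definition height_in :: "complex set \<Rightarrow> complex \<Rightarrow> real"
  where "height_in F x =
    1 / real (degree_over_Q F) *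
    (\<Sum>\<^sub>\<infinity>v\<in>places F. real (local_degree F v) * ln (max 1 (v x)))"

text \<open>
  For algebraic \<open>x\<close> the value \<open>height_in F x\<close> is the same for all number fields \<open>F\<close> containing
  \<open>x\<close>; we take the smallest one.
\<close>

definition weil_height :: "complex \<Rightarrow> real"
  where "weil_height x = height_in (generate_field complex_field {x}) x"

definition northcott :: "complex set \<Rightarrow> bool"
  where "northcott K \<longleftrightarrow>
    (\<forall>T>0. finite {x \<in> K - {0}. weil_height x < T})"


subsection \<open>Totally split primes\<close>

definition ring_of_integers :: "complex set \<Rightarrow> complex ring"
  where "ring_of_integers F = complex_field \<lparr> carrier := {x \<in> F. algebraic_int x} \<rparr>"

definition totally_split_in_number_field :: "nat \<Rightarrow> complex set \<Rightarrow> bool"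
  where "totally_split_in_number_field p F \<longleftrightarrow>
    (\<exists>P. finite P \<and> card P = degree_over_Q F \<and>
       (\<forall>I\<in>P. primeideal I (ring_of_integers F)) \<and>
       PIdl\<^bsub>ring_of_integers F\<^esub> (of_nat p) =
         (\<Otimes>\<^bsub>ideals_set (ring_of_integers F)\<^esub>I\<in>P. I))"

definition totally_split :: "nat \<Rightarrow> complex set \<Rightarrow> bool"
  where "totally_split p K \<longleftrightarrow>
    (\<forall>F. number_field F \<and> F \<subseteq> K \<longrightarrow> totally_split_in_number_field p F)"

end

theory Submission
  imports Defs "Jordan_Normal_Form.Char_Poly"
begin

definition evZ :: "int poly \<Rightarrow> complex \<Rightarrow> complex"
  where "evZ p x = poly (map_poly of_int p) x"
definition evQ :: "rat poly \<Rightarrow> complex \<Rightarrow> complex"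
  where "evQ p x = poly (map_poly of_rat p) x"

lemma evZ_ring [simp]:
  "evZ 0 x = 0" "evZ 1 x = 1" "evZ (p + q) x = evZ p x + evZ q x" "evZ (- p) x = - evZ p x"
  "evZ (p - q) x = evZ p x - evZ q x" "evZ (p * q) x = evZ p x * evZ q x"
  "evZ (pCons a p) x = of_int a + x * evZ p x" "evZ (smult a p) x = of_int a * evZ p x"
  by (simp_all add: evZ_def of_int_poly_hom.hom_add of_int_poly_hom.hom_mult of_int_poly_hom.hom_minus
        of_int_poly_hom.hom_uminus of_int_hom.map_poly_pCons_hom of_int_hom.map_poly_hom_smult)

lemma evZ_simps [simp]:
  "evZ (p ^ n) x = evZ p x ^ n" "evZ (monom a n) x = of_int a * x ^ n"
  "evZ (sum P S) x = (\<Sum>i\<in>S. evZ (P i) x)" "evZ (prod P S) x = (\<Prod>i\<in>S. evZ (P i) x)"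
  "evZ (pcompose p q) x = evZ p (evZ q x)" "evZ (of_nat k) x = of_nat k" "evZ (of_int j) x = of_int j"
proof -
  show "evZ (p ^ n) x = evZ p x ^ n" by (induction n) auto
  show "evZ (monom a n) x = of_int a * x ^ n" by (induction n) (auto simp: monom_0 monom_Suc)
  show "evZ (sum P S) x = (\<Sum>i\<in>S. evZ (P i) x)" by (induction S rule: infinite_finite_induct) auto
  show "evZ (prod P S) x = (\<Prod>i\<in>S. evZ (P i) x)" by (induction S rule: infinite_finite_induct) auto
  show "evZ (pcompose p q) x = evZ p (evZ q x)" by (induction p) (auto simp: pcompose_pCons)
  show "evZ (of_nat k) x = of_nat k" by (simp add: of_nat_poly)
  show "evZ (of_int j) x = of_int j" by (simp add: of_int_poly)
qed

lemma evQ_ring [simp]: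
  "evQ 0 x = 0" "evQ 1 x = 1" "evQ (p + q) x = evQ p x + evQ q x" "evQ (- p) x = - evQ p x"
  "evQ (p - q) x = evQ p x - evQ q x" "evQ (p * q) x = evQ p x * evQ q x"
  "evQ (pCons a p) x = of_rat a + x * evQ p x" "evQ (smult a p) x = of_rat a * evQ p x"
proof -
  show "evQ 0 x = 0" "evQ 1 x = 1" by (simp_all add: evQ_def)
  show add: "evQ (p + q) x = evQ p x + evQ q x" for p q
    by (simp add: evQ_def map_poly_add of_rat_add)
  show minus: "evQ (- p) x = - evQ p x" for p
    using add[of p "-p"] by (simp add: evQ_def add_eq_0_iff)
  show "evQ (p - q) x = evQ p x - evQ q x" using add[of p "-q"] minus[of q] by simp
  show pC: "evQ (pCons a p) x = of_rat a + x * evQ p x" for a p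
    by (simp add: evQ_def of_rat_hom.map_poly_pCons_hom)
  show sm: "evQ (smult a p) x = of_rat a * evQ p x" for a p
    by (induction p) (simp_all add: pC algebra_simps of_rat_mult, simp add: evQ_def)
  show "evQ (p * q) x = evQ p x * evQ q x"
    by (induction p) (simp_all add: add sm pC algebra_simps, simp add: evQ_def)
qed

lemma evQ_simps [simp]:
  "evQ (p ^ n) x = evQ p x ^ n" "evQ (monom a n) x = of_rat a * x ^ n"
  "evQ (sum P S) x = (\<Sum>i\<in>S. evQ (P i) x)" "evQ (prod P S) x = (\<Prod>i\<in>S. evQ (P i) x)"
  "evQ (pcompose p q) x = evQ p (evQ q x)"
proof -
  show "evQ (p ^ n) x = evQ p x ^ n" by (induction n) auto
  show "evQ (monom a n) x = of_rat a * x ^ n" by (induction n) (auto simp: monom_0 monom_Suc)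
  show "evQ (sum P S) x = (\<Sum>i\<in>S. evQ (P i) x)" by (induction S rule: infinite_finite_induct) auto
  show "evQ (prod P S) x = (\<Prod>i\<in>S. evQ (P i) x)" by (induction S rule: infinite_finite_induct) auto
  show "evQ (pcompose p q) x = evQ p (evQ q x)" by (induction p) (auto simp: pcompose_pCons)
qed

lemma evQ_of_int [simp]: "evQ (map_poly of_int p) x = evZ p x"
  by (simp add: evQ_def evZ_def map_poly_map_poly o_def)
lemma algebraic_int_iff_evZ: "algebraic_int x \<longleftrightarrow> (\<exists>p. lead_coeff p = 1 \<and> evZ p x = 0)"
  by (auto simp: algebraic_int_altdef_ipoly evZ_def)

text \<open>Z-span\<close>
lemma algebraic_int_of_matrix:
  fixes v :: "nat \<Rightarrow> complex" and A :: "nat \<Rightarrow> nat \<Rightarrow> int"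
  assumes eq: "\<And>i. i < n \<Longrightarrow> x * v i = (\<Sum>j<n. of_int (A i j) * v j)" and nz: "i0 < n" "v i0 \<noteq> 0"
  shows "algebraic_int x"
proof -
  define M where "M = mat n n (\<lambda>(i,j). A i j)"
  define MC where "MC = map_mat (of_int :: int \<Rightarrow> complex) M"
  have M: "M \<in> carrier_mat n n" by (simp add: M_def)
  have MC: "MC \<in> carrier_mat n n" by (simp add: M_def MC_def)
  have "eigenvector MC (Matrix.vec n v) x"
    unfolding eigenvector_def
  proof (intro conjI)
    show "Matrix.vec n v \<in> carrier_vec (dim_row MC)" using MC by simp
    show "Matrix.vec n v \<noteq> 0\<^sub>v (dim_row MC)"
      using nz MC by (metis carrier_matD(1) index_vec index_zero_vec(1))
    show "MC *\<^sub>v Matrix.vec n v = x \<cdot>\<^sub>v Matrix.vec n v"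
    proof (rule eq_vecI)
      fix i assume "i < dim_vec (x \<cdot>\<^sub>v Matrix.vec n v)"
      hence i: "i < n" by simp
      have "(MC *\<^sub>v Matrix.vec n v) $ i = (\<Sum>j<n. of_int (A i j) * v j)"
        using i by (simp add: MC_def M_def scalar_prod_def lessThan_atLeast0)
      thus "(MC *\<^sub>v Matrix.vec n v) $ i = (x \<cdot>\<^sub>v Matrix.vec n v) $ i" using eq[OF i] i by simp
    qed (use MC in simp)
  qed
  hence "eigenvalue MC x" by (auto simp: eigenvalue_def)
  hence "poly (char_poly MC) x = 0" using eigenvalue_root_char_poly[OF MC] by simp
  hence "poly (map_poly of_int (char_poly M)) x = 0"
    unfolding MC_def using of_int_hom.char_poly_hom[OF M] by metis
  moreover have "lead_coeff (char_poly M) = 1" using degree_monic_char_poly[OF M] by simp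
  ultimately show ?thesis by (auto simp: algebraic_int_altdef_ipoly)
qed

definition Zspan :: "complex set \<Rightarrow> complex set"
  where "Zspan G = {\<Sum>g\<in>G. of_int (c g) * g | c. True}"

lemma Zspan_base: "finite G \<Longrightarrow> g \<in> G \<Longrightarrow> g \<in> Zspan G"
  unfolding Zspan_def by (rule CollectI, rule exI[of _ "\<lambda>h. if h = g then 1 else 0"]) (auto simp: if_distrib if_distribR cong: if_cong)
lemma Zspan_0: "0 \<in> Zspan G"
  unfolding Zspan_def by (rule CollectI, rule exI[of _ "\<lambda>h. 0"]) auto
lemma Zspan_add: "x \<in> Zspan G \<Longrightarrow> y \<in> Zspan G \<Longrightarrow> x + y \<in> Zspan G"
proof -
  assume "x \<in> Zspan G" "y \<in> Zspan G"
  then obtain c d where "x = (\<Sum>g\<in>G. of_int (c g) * g)" "y = (\<Sum>g\<in>G. of_int (d g) * g)" unfolding Zspan_def by blast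
  hence "x + y = (\<Sum>g\<in>G. of_int (c g + d g) * g)" by (simp add: sum.distrib algebra_simps)
  thus ?thesis unfolding Zspan_def by (intro CollectI exI[of _ "\<lambda>g. c g + d g"]) simp
qed
lemma Zspan_smult: "x \<in> Zspan G \<Longrightarrow> of_int k * x \<in> Zspan G"
proof -
  assume "x \<in> Zspan G"
  then obtain c where "x = (\<Sum>g\<in>G. of_int (c g) * g)" unfolding Zspan_def by blast
  hence "of_int k * x = (\<Sum>g\<in>G. of_int (k * c g) * g)" by (simp add: sum_distrib_left algebra_simps)
  thus ?thesis unfolding Zspan_def by (intro CollectI exI[of _ "\<lambda>g. k * c g"]) simp
qed
lemma Zspan_sum: "(\<And>i. i \<in> I \<Longrightarrow> f i \<in> Zspan G) \<Longrightarrow> sum f I \<in> Zspan G"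
  by (induction I rule: infinite_finite_induct) (auto simp: Zspan_0 Zspan_add)

lemma algebraic_int_of_Zspan:
  assumes "finite G" "1 \<in> G" "\<And>g. g \<in> G \<Longrightarrow> x * g \<in> Zspan G"
  shows "algebraic_int x"
proof -
  have "\<forall>g. \<exists>c. g \<in> G \<longrightarrow> x * g = (\<Sum>h\<in>G. of_int (c h) * h)" using assms(3) unfolding Zspan_def by blast
  then obtain c where c: "\<And>g. g \<in> G \<Longrightarrow> x * g = (\<Sum>h\<in>G. of_int (c g h) * h)" by metis
  obtain v where v: "bij_betw v {..<card G} G" using ex_bij_betw_nat_finite[OF assms(1)] by (auto simp: lessThan_atLeast0)
  then obtain i0 where i0: "i0 < card G" "v i0 = 1" using assms(2) by (metis bij_betw_iff_bijections lessThan_iff)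
  show ?thesis
  proof (rule algebraic_int_of_matrix[where v = v and A = "\<lambda>i j. c (v i) (v j)" and n = "card G"])
    fix i assume "i < card G"
    hence "v i \<in> G" using v by (auto simp: bij_betw_def)
    thus "x * v i = (\<Sum>j<card G. of_int (c (v i) (v j)) * v j)"
      using c sum.reindex_bij_betw[OF v, of "\<lambda>h. of_int (c (v i) h) * h"] by simp
  qed (use i0 in auto)
qed

lemma algebraic_int_power_reduce:
  assumes "algebraic_int (x::complex)"
  obtains n c where "n > 0" "x ^ n = (\<Sum>i<n. of_int (c i) * x ^ i)"
proof -
  obtain p where p: "lead_coeff p = 1" "evZ p x = 0" using assms algebraic_int_iff_evZ by blast
  have *: "evZ p x = (\<Sum>i\<le>degree p. of_int (coeff p i) * x ^ i)"
    by (simp add: evZ_def poly_altdef)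
  have "degree p > 0"
  proof (rule ccontr)
    assume "\<not> degree p > 0"
    then obtain a where "p = [:a:]" by (auto elim: degree_eq_zeroE)
    thus False using p by (auto split: if_splits)
  qed
  moreover have "x ^ degree p = (\<Sum>i<degree p. of_int (- coeff p i) * x ^ i)"
    using p * by (simp add: sum_negf lessThan_Suc_atMost[symmetric] eq_neg_iff_add_eq_0 add.commute)
  ultimately show ?thesis by (rule that)
qed

lemma
  assumes "algebraic_int (x::complex)" "algebraic_int y"
  shows algebraic_int_add: "algebraic_int (x + y)" and algebraic_int_mult: "algebraic_int (x * y)"
proof -
  obtain n c where n: "n > 0" "x ^ n = (\<Sum>i<n. of_int (c i) * x ^ i)" using algebraic_int_power_reduce[OF assms(1)] .
  obtain m d where m: "m > 0" "y ^ m = (\<Sum>i<m. of_int (d i) * y ^ i)" using algebraic_int_power_reduce[OF assms(2)] .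
  define G where "G = (\<lambda>(a,b). x ^ a * y ^ b) ` ({..<n} \<times> {..<m})"
  have fin: "finite G" by (simp add: G_def)
  have one: "1 \<in> G" unfolding G_def using n m by (intro image_eqI[of _ _ "(0,0)"]) auto
  have mon: "x ^ a * y ^ b \<in> Zspan G" for a b
  proof (induction "a + b" arbitrary: a b rule: less_induct)
    case less
    consider "a < n" "b < m" | "a \<ge> n" | "b \<ge> m" by linarith
    thus ?case
    proof cases
      case 1 thus ?thesis by (intro Zspan_base fin) (auto simp: G_def)
    next
      case 2
      have "x ^ a * y ^ b = x ^ n * x ^ (a - n) * y ^ b" using 2 by (simp add: power_add[symmetric])
      also have "\<dots> = (\<Sum>i<n. of_int (c i) * (x ^ (i + (a - n)) * y ^ b))"
        unfolding n(2) sum_distrib_right by (simp add: power_add mult_ac)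
      also have "\<dots> \<in> Zspan G" using 2 by (intro Zspan_sum Zspan_smult less) auto
      finally show ?thesis .
    next
      case 3
      have "x ^ a * y ^ b = y ^ m * y ^ (b - m) * x ^ a" using 3 by (simp add: power_add[symmetric])
      also have "\<dots> = (\<Sum>i<m. of_int (d i) * (x ^ a * y ^ (i + (b - m))))"
        unfolding m(2) sum_distrib_right by (simp add: power_add mult_ac)
      also have "\<dots> \<in> Zspan G" using 3 by (intro Zspan_sum Zspan_smult less) auto
      finally show ?thesis .
    qed
  qed
  show "algebraic_int (x + y)"
  proof (rule algebraic_int_of_Zspan[OF fin one])
    fix g assume "g \<in> G"
    then obtain a b where "g = x ^ a * y ^ b" by (auto simp: G_def)
    hence "(x + y) * g = x ^ Suc a * y ^ b + x ^ a * y ^ Suc b" by (simp add: algebra_simps)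
    thus "(x + y) * g \<in> Zspan G" using mon Zspan_add by metis
  qed
  show "algebraic_int (x * y)"
  proof (rule algebraic_int_of_Zspan[OF fin one])
    fix g assume "g \<in> G"
    then obtain a b where "g = x ^ a * y ^ b" by (auto simp: G_def)
    hence "(x * y) * g = x ^ Suc a * y ^ Suc b" by (simp add: algebra_simps)
    thus "(x * y) * g \<in> Zspan G" using mon by metis
  qed
qed

lemma algebraic_int_diff: "algebraic_int (x::complex) \<Longrightarrow> algebraic_int y \<Longrightarrow> algebraic_int (x - y)"
  using algebraic_int_add[of x "-y"] by simp
lemma algebraic_int_power: "algebraic_int (x::complex) \<Longrightarrow> algebraic_int (x ^ n)"
  by (induction n) (auto intro: algebraic_int_mult)
lemma algebraic_int_sum: "(\<And>i. i \<in> I \<Longrightarrow> algebraic_int (f i :: complex)) \<Longrightarrow> algebraic_int (sum f I)"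
  by (induction I rule: infinite_finite_induct) (auto intro: algebraic_int_add)
lemma algebraic_int_evZ: "algebraic_int x \<Longrightarrow> algebraic_int (evZ p x)"
  by (induction p) (auto intro: algebraic_int_add algebraic_int_mult)
lemmas algebraic_int_closure = algebraic_int_add algebraic_int_mult algebraic_int_diff algebraic_int_power algebraic_int_evZ algebraic_int_minus

lemma lead_coeff_monom_add:
  assumes "degree r < n"
  shows "lead_coeff (monom 1 n + r) = (1::'a::comm_ring_1)" and "degree (monom (1::'a) n + r) = n"
proof -
  have "degree (monom (1::'a) n) = n" by (simp add: degree_monom_eq)
  thus *: "degree (monom (1::'a) n + r) = n" using degree_add_eq_left[of r "monom 1 n"] assms by simp
  show "lead_coeff (monom 1 n + r) = (1::'a)" unfolding * using assms by (simp add: coeff_eq_0)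
qed

lemma algebraic_imp_scaled_int:
  assumes "algebraic (z::complex)"
  obtains M :: nat where "M > 0" "algebraic_int (of_nat M * z)"
proof -
  obtain p where p: "\<And>i. coeff p i \<in> \<int>" "p \<noteq> 0" "poly p z = 0" using algebraicE[OF assms] by metis
  define a where "a = lead_coeff p"
  define n where "n = degree p"
  have a: "a \<in> \<int>" "a \<noteq> 0" using p by (auto simp: a_def)
  have n: "n > 0"
  proof (rule ccontr)
    assume "\<not> n > 0"
    then obtain b where "p = [:b:]" unfolding n_def by (auto elim: degree_eq_zeroE)
    thus False using p by auto
  qed
  define c where "c = (\<lambda>i. coeff p i * a ^ (n - 1 - i))"
  have c: "c i \<in> \<int>" for i using p a by (auto simp: c_def)
  define q where "q = monom 1 n + (\<Sum>i<n. monom (c i) i)"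
  have deg: "degree (\<Sum>i<n. monom (c i) i) < n"
    using n by (intro degree_sum_less) (auto intro: le_less_trans[OF degree_monom_le])
  have "lead_coeff q = 1" unfolding q_def using lead_coeff_monom_add(1)[OF deg] .
  moreover have "coeff q i \<in> \<int>" for i using c by (auto simp: q_def coeff_sum intro!: Ints_add Ints_sum)
  moreover have "poly q (a * z) = 0"
  proof -
    have "poly q (a * z) = a ^ n * z ^ n + (\<Sum>i<n. coeff p i * a ^ (n - 1 - i) * a ^ i * z ^ i)"
      by (simp add: q_def poly_monom poly_sum c_def power_mult_distrib mult_ac)
    also have "(\<Sum>i<n. coeff p i * a ^ (n - 1 - i) * a ^ i * z ^ i) = (\<Sum>i<n. a ^ (n - 1) * (coeff p i * z ^ i))"
    proof (intro sum.cong refl)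
      fix i assume "i \<in> {..<n}"
      hence "a ^ (n - 1) = a ^ (n - 1 - i) * a ^ i" by (simp add: power_add[symmetric])
      thus "coeff p i * a ^ (n - 1 - i) * a ^ i * z ^ i = a ^ (n - 1) * (coeff p i * z ^ i)" by (simp only: mult_ac)
    qed
    also have "\<dots> = a ^ (n-1) * (\<Sum>i<n. coeff p i * z ^ i)" by (simp add: sum_distrib_left)
    also have "a ^ n * z ^ n = a ^ (n-1) * (a * z ^ n)" using n by (cases n) auto
    also have "a ^ (n-1) * (a * z ^ n) + a ^ (n-1) * (\<Sum>i<n. coeff p i * z ^ i) = a ^ (n-1) * poly p z"
      by (simp add: poly_altdef n_def[symmetric] a_def lessThan_Suc_atMost[symmetric] algebra_simps)
    finally show ?thesis using p by simp
  qed
  ultimately have az: "algebraic_int (a * z)" by (intro algebraic_int.intros[of q]) auto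
  obtain k :: int where k: "a = of_int k" using a by (auto elim: Ints_cases)
  have "algebraic_int (of_nat (nat \<bar>k\<bar>) * z)"
  proof (cases "k \<ge> 0")
    case False
    hence "of_nat (nat \<bar>k\<bar>) * z = - (a * z)" by (simp add: k)
    thus ?thesis using az by simp
  qed (use az k in simp)
  thus ?thesis using that[of "nat \<bar>k\<bar>"] a k by simp
qed

lemma algebraic_of_scaled_int:
  assumes "algebraic_int (of_nat M * z :: complex)" "M > 0"
  shows "algebraic z"
proof -
  obtain p where p: "lead_coeff p = 1" "evZ p (of_nat M * z) = 0" using assms(1) algebraic_int_iff_evZ by blast
  define q where "q = pcompose p [:0, int M:]"
  have "evZ q z = 0" using p by (simp add: q_def mult.commute)
  moreover have "q \<noteq> 0"
  proof
    assume "q = 0"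
    moreover have "degree [:0, int M:] > 0" using assms(2) by simp
    ultimately have "p = 0" unfolding q_def by (rule pcompose_eq_0)
    thus False using p by simp
  qed
  ultimately show ?thesis
    by (intro algebraicI[of "map_poly of_int q"]) (auto simp: evZ_def)
qed

lemma
  assumes "algebraic (x::complex)" "algebraic y"
  shows algebraic_add: "algebraic (x + y)" and algebraic_mult: "algebraic (x * y)"
proof -
  obtain M where M: "M > 0" "algebraic_int (of_nat M * x)" using algebraic_imp_scaled_int[OF assms(1)] .
  obtain N where N: "N > 0" "algebraic_int (of_nat N * y)" using algebraic_imp_scaled_int[OF assms(2)] .
  have "algebraic_int (of_nat N * (of_nat M * x) + of_nat M * (of_nat N * y))"
    by (intro algebraic_int_closure M N algebraic_int_of_nat)
  hence "algebraic_int (of_nat (M * N) * (x + y))" by (simp add: algebra_simps)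
  thus "algebraic (x + y)" using M N by (intro algebraic_of_scaled_int[of "M*N"]) auto
  have "algebraic_int ((of_nat M * x) * (of_nat N * y))" by (intro algebraic_int_closure M N)
  hence "algebraic_int (of_nat (M * N) * (x * y))" by (simp add: algebra_simps)
  thus "algebraic (x * y)" using M N by (intro algebraic_of_scaled_int[of "M*N"]) auto
qed

lemma rat_bezout:
  fixes f g :: "rat poly"
  assumes "Factorial_Ring.irreducible f" "\<not> f dvd g"
  obtains a b where "a * f + b * g = 1"
proof -
  have "coprime f g"
    using assms(2) prime_elem_imp_coprime[OF irreducible_imp_prime_elem[OF assms(1)]] by blast
  hence "fst (bezout_coefficients f g) * f + snd (bezout_coefficients f g) * g = 1"
    by (simp add: bezout_coefficients_fst_snd)
  thus ?thesis by (rule that)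
qed

lemma irreducible_root_dvd:
  assumes "Factorial_Ring.irreducible f" "evQ f z = 0" "evQ g z = 0"
  shows "f dvd g"
proof (rule ccontr)
  assume "\<not> f dvd g"
  then obtain a b where "a * f + b * g = 1" using rat_bezout assms(1) by blast
  hence "evQ (a * f + b * g) z = 1" by simp
  thus False using assms by simp
qed

lemma irreducible_root_iff:
  assumes "Factorial_Ring.irreducible f" "evQ f z = 0"
  shows "evQ g z = 0 \<longleftrightarrow> f dvd g"
  using irreducible_root_dvd[OF assms] assms(2) by (auto simp: dvd_def)

lemma conjugate_root:
  assumes "Factorial_Ring.irreducible f" "evQ f x = 0" "evQ f y = 0" "evQ g x = 0"
  shows "evQ g y = 0"
  using assms irreducible_root_iff by blast

lemma conjugate_algebraic_int:
  assumes "Factorial_Ring.irreducible f" "evQ f x = 0" "evQ f y = 0" "algebraic_int (evQ g x)"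
  shows "algebraic_int (evQ g y)"
proof -
  obtain p where p: "lead_coeff p = 1" "evZ p (evQ g x) = 0" using assms(4) algebraic_int_iff_evZ by blast
  have "evQ (pcompose (map_poly of_int p) g) x = 0" using p by simp
  hence "evQ (pcompose (map_poly of_int p) g) y = 0" using conjugate_root assms by blast
  thus ?thesis using p algebraic_int_iff_evZ by auto
qed

lemma algebraic_iff_evQ: "algebraic z \<longleftrightarrow> (\<exists>q. q \<noteq> 0 \<and> evQ q z = 0)"
proof
  assume "algebraic z"
  then obtain p where p: "\<And>i. coeff p i \<in> \<rat>" "p \<noteq> 0" "poly p z = 0" unfolding algebraic_altdef by blast
  have "\<forall>i. \<exists>c. coeff p i = of_rat c" using p(1) by (auto elim: Rats_cases)
  then obtain c where c: "\<And>i. coeff p i = of_rat (c i)" by metis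
  have fin: "\<forall>\<^sub>\<infinity>i. c i = 0" using MOST_coeff_eq_0[of p] c by (simp add: of_rat_eq_0_iff)
  define q where "q = Abs_poly c"
  have q: "map_poly of_rat q = p" by (intro poly_eqI) (simp add: coeff_map_poly q_def Abs_poly_inverse fin c)
  hence "q \<noteq> 0" "evQ q z = 0" using p by (auto simp: evQ_def)
  thus "\<exists>q. q \<noteq> 0 \<and> evQ q z = 0" by blast
next
  assume "\<exists>q. q \<noteq> 0 \<and> evQ q z = 0"
  then obtain q where "q \<noteq> 0" "evQ q z = 0" by blast
  thus "algebraic z"
    by (intro algebraicI'[of "map_poly of_rat q"]) (auto simp: evQ_def coeff_map_poly)
qed

lemma minimal_polynomial_exists:
  assumes "algebraic z"
  obtains f :: "rat poly" where "lead_coeff f = 1" "Factorial_Ring.irreducible f" "evQ f z = 0"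
proof -
  define P where "P = (\<lambda>q. q \<noteq> 0 \<and> evQ q z = 0)"
  have "\<exists>q. P q" using assms algebraic_iff_evQ P_def by simp
  then obtain q where q: "P q" "\<And>r. P r \<Longrightarrow> degree q \<le> degree r"
    using ex_has_least_nat[of P _ degree] by blast
  define f where "f = smult (inverse (lead_coeff q)) q"
  have q0: "q \<noteq> 0" using q P_def by simp
  have f: "lead_coeff f = 1" "f \<noteq> 0" "evQ f z = 0" using q0 q(1) by (auto simp: f_def P_def)
  have degf: "degree f = degree q" using q0 by (simp add: f_def)
  have min: "degree f \<le> degree r" if "r \<noteq> 0" "evQ r z = 0" for r using q(2)[of r] that degf by (simp add: P_def)
  have "Factorial_Ring.irreducible f"
  proof (rule Factorial_Ring.irreducibleI)
    show "f \<noteq> 0" by fact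
    show "\<not> f dvd 1"
    proof
      assume "f dvd 1"
      then obtain g where "1 = f * g" by (auto simp: dvd_def)
      hence "evQ 1 z = evQ f z * evQ g z" by (metis evQ_ring(6))
      thus False using f by simp
    qed
    fix a b assume ab: "f = a * b"
    hence nz: "a \<noteq> 0" "b \<noteq> 0" using f by auto
    have deg: "degree f = degree a + degree b" using ab nz by (simp add: degree_mult_eq)
    have "evQ a z = 0 \<or> evQ b z = 0" using f ab by auto
    thus "a dvd 1 \<or> b dvd 1"
    proof
      assume "evQ a z = 0"
      hence "degree b = 0" using min[of a] nz deg by simp
      thus ?thesis using nz by (simp add: is_unit_iff_degree)
    next
      assume "evQ b z = 0"
      hence "degree a = 0" using min[of b] nz deg by simp
      thus ?thesis using nz by (simp add: is_unit_iff_degree)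
    qed
  qed
  from that[OF f(1) this f(3)] show ?thesis .
qed

lemma irreducible_degree_pos:
  assumes "Factorial_Ring.irreducible (f :: rat poly)" shows "degree f > 0"
proof -
  have "f \<noteq> 0" "\<not> f dvd 1" using assms unfolding Factorial_Ring.irreducible_def by blast+
  thus ?thesis using is_unit_iff_degree[of f] by simp
qed

lemma evQ_pderiv: "evQ (pderiv f) z = poly (pderiv (map_poly of_rat f)) z"
  by (simp add: evQ_def of_rat_hom.map_poly_pderiv)

lemma irreducible_imp_simple_roots:
  assumes "Factorial_Ring.irreducible f" "evQ f z = 0"
  shows "evQ (pderiv f) z \<noteq> 0"
proof
  assume "evQ (pderiv f) z = 0"
  hence "f dvd pderiv f" using irreducible_root_dvd assms by blast
  moreover have "degree f > 0" using assms irreducible_degree_pos by blast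
  moreover from this have "pderiv f \<noteq> 0" by (simp add: pderiv_eq_0_iff)
  ultimately have "degree f \<le> degree f - 1" using dvd_imp_degree_le[of f "pderiv f"] by (simp add: degree_pderiv)
  thus False using \<open>degree f > 0\<close> by simp
qed

lemma card_roots_irreducible:
  assumes "Factorial_Ring.irreducible f"
  shows "finite {z. evQ f z = 0}" "card {z. evQ f z = 0} = degree f"
    and "map_poly of_rat f = smult (of_rat (lead_coeff f)) (\<Prod>z\<in>{z. evQ f z = 0}. [:-z, 1:])"
proof -
  let ?p = "map_poly of_rat f :: complex poly"
  have f0: "f \<noteq> 0" using assms unfolding Factorial_Ring.irreducible_def by blast
  have p0: "?p \<noteq> 0" using f0 by simp
  show fin: "finite {z. evQ f z = 0}" unfolding evQ_def using p0 by (rule poly_roots_finite)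
  have sq: "rsquarefree ?p" unfolding rsquarefree_roots
    using irreducible_imp_simple_roots[OF assms] by (auto simp: evQ_def of_rat_hom.map_poly_pderiv)
  show eq: "?p = smult (of_rat (lead_coeff f)) (\<Prod>z\<in>{z. evQ f z = 0}. [:-z, 1:])"
    using complex_poly_decompose_rsquarefree[OF sq] by (simp add: evQ_def)
  have "degree f = degree ?p" by simp
  also have "\<dots> = (\<Sum>z\<in>{z. evQ f z = 0}. 1)"
    by (subst eq) (use f0 in \<open>simp add: degree_prod_eq_sum_degree\<close>)
  finally show "card {z. evQ f z = 0} = degree f" by simp
qed

lemma algebraic_int_coeff_prod:
  assumes "finite S" "\<And>z. z \<in> S \<Longrightarrow> algebraic_int z"
  shows "algebraic_int (coeff (\<Prod>z\<in>S. [:-z, 1::complex:]) i)"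
  using assms
proof (induction S arbitrary: i rule: finite_induct)
  case (insert a S)
  have "coeff (\<Prod>z\<in>insert a S. [:-z, 1:]) i = - a * coeff (\<Prod>z\<in>S. [:-z, 1:]) i + coeff (pCons 0 (\<Prod>z\<in>S. [:-z, 1:])) i"
    using insert by simp
  moreover have "algebraic_int (coeff (pCons 0 (\<Prod>z\<in>S. [:-z, 1:])) i)"
    using insert by (cases i) auto
  ultimately show ?case using insert by (auto intro!: algebraic_int_closure)
qed (auto simp: coeff_pCons one_pCons split: nat.splits)

lemma rat_poly_integral:
  assumes "\<And>i. algebraic_int (of_rat (coeff f i) :: complex)"
  obtains h :: "int poly" where "f = map_poly of_int h"
proof -
  have "of_rat (coeff f i) \<in> (\<int> :: complex set)" for i
    using rational_algebraic_int_is_int[OF assms] by simp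
  hence "\<exists>k. coeff f i = of_int k" for i by (metis Ints_cases of_rat_eq_iff of_rat_of_int_eq)
  then obtain c where c: "\<And>i. coeff f i = of_int (c i)" by metis
  have "\<forall>\<^sub>\<infinity>i. c i = 0" using MOST_coeff_eq_0[of f] c by simp
  hence "map_poly of_int (Abs_poly c) = f" by (intro poly_eqI) (simp add: coeff_map_poly Abs_poly_inverse c)
  thus ?thesis using that[of "Abs_poly c"] by simp
qed

lemma minimal_polynomial_integral:
  assumes "Factorial_Ring.irreducible f" "lead_coeff f = 1" "evQ f z = 0" "algebraic_int z"
  obtains h :: "int poly" where "f = map_poly of_int h" "lead_coeff h = 1"
proof -
  have roots: "algebraic_int w" if "evQ f w = 0" for w
    using conjugate_algebraic_int[OF assms(1,3) that, of "[:0,1:]"] assms(4) by simp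
  have "algebraic_int (of_rat (coeff f i) :: complex)" for i
  proof -
    have "of_rat (coeff f i) = coeff (\<Prod>z\<in>{z. evQ f z = 0}. [:-z, 1::complex:]) i"
      using arg_cong[OF card_roots_irreducible(3)[OF assms(1)], of "\<lambda>p. coeff p i"] assms(2) by (simp add: coeff_map_poly)
    thus ?thesis using algebraic_int_coeff_prod[OF card_roots_irreducible(1)[OF assms(1)]] roots by simp
  qed
  then obtain h where h: "f = map_poly of_int h" using rat_poly_integral by blast
  moreover have "lead_coeff h = 1" using assms(2) unfolding h by simp
  ultimately show ?thesis by (rule that)
qed

subsection \<open>complex_field\<close>

lemma complex_field_simps [simp]:
  "carrier complex_field = UNIV" "x \<otimes>\<^bsub>complex_field\<^esub> y = x * y" "x \<oplus>\<^bsub>complex_field\<^esub> y = x + y"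
  "\<one>\<^bsub>complex_field\<^esub> = 1" "\<zero>\<^bsub>complex_field\<^esub> = 0"
  by (simp_all add: ring_of_type_algebra_def)

interpretation CF: cring complex_field by (rule cring_from_type_algebra)

lemma CF_a_inv [simp]: "\<ominus>\<^bsub>complex_field\<^esub> x = - x"
  using CF.add.inv_equality[of "-x" x] by (simp add: a_inv_def)
lemma CF_minus [simp]: "x \<ominus>\<^bsub>complex_field\<^esub> y = x - y"
  by (simp add: a_minus_def)
lemma CF_inv [simp]: "x \<noteq> 0 \<Longrightarrow> inv\<^bsub>complex_field\<^esub> x = inverse x"
  using CF.comm_inv_char[of x "inverse x"] by simp

lemma subfield_complexI:
  assumes "1 \<in> F" "\<And>x y. x \<in> F \<Longrightarrow> y \<in> F \<Longrightarrow> x + y \<in> F" "\<And>x y. x \<in> F \<Longrightarrow> y \<in> F \<Longrightarrow> x * y \<in> F"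
    "\<And>x. x \<in> F \<Longrightarrow> - x \<in> F" "\<And>x. x \<in> F \<Longrightarrow> x \<noteq> 0 \<Longrightarrow> inverse x \<in> F"
  shows "subfield F complex_field"
proof (rule field.subfieldI'[OF field_from_type_algebra])
  show "subring F complex_field" by (rule CF.subringI) (use assms in auto)
qed (use assms in auto)

lemma subfield_complexD:
  assumes "subfield F complex_field"
  shows "0 \<in> F" "1 \<in> F" "x \<in> F \<Longrightarrow> y \<in> F \<Longrightarrow> x + y \<in> F" "x \<in> F \<Longrightarrow> y \<in> F \<Longrightarrow> x * y \<in> F"
    "x \<in> F \<Longrightarrow> - x \<in> F" "x \<in> F \<Longrightarrow> y \<in> F \<Longrightarrow> x - y \<in> F" "x \<in> F \<Longrightarrow> inverse x \<in> F" "of_int k \<in> F" "of_rat q \<in> F"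
    "x \<in> F \<Longrightarrow> x ^ n \<in> F"
proof -
  note sr = subfieldE(1)[OF assms]
  show 0: "0 \<in> F" and 1: "1 \<in> F" using subringE(2,3)[OF sr] by simp_all
  show a: "x + y \<in> F" if "x \<in> F" "y \<in> F" for x y using subringE(7)[OF sr that] by simp
  show m: "x * y \<in> F" if "x \<in> F" "y \<in> F" for x y using subringE(6)[OF sr that] by simp
  show n: "- x \<in> F" if "x \<in> F" for x using subringE(5)[OF sr that] by simp
  show "x - y \<in> F" if "x \<in> F" "y \<in> F" using a[OF that(1) n[OF that(2)]] by simp
  show i: "inverse x \<in> F" if "x \<in> F" for x
    using CF.subfield_m_inv(1)[OF assms, of x] that 0 by (cases "x = 0") auto
  have nat: "of_nat k \<in> F" for k by (induction k) (use 0 1 a in auto)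
  show int: "of_int k \<in> F" for k
    by (cases k rule: int_cases2) (use nat n in auto)
  show "of_rat q \<in> F"
  proof (cases q)
    case (Fract c d)
    thus ?thesis using m[OF int[of c] i[OF int[of d]]] by (simp add: of_rat_rat divide_inverse)
  qed
  show "x ^ n \<in> F" if "x \<in> F" by (induction n) (use 1 m that in auto)
qed

lemma subfield_Rats: "subfield \<rat> complex_field"
  by (rule subfield_complexI) auto

lemma subfield_evQ: "subfield F complex_field \<Longrightarrow> x \<in> F \<Longrightarrow> evQ g x \<in> F"
  by (induction g) (auto simp: subfield_complexD)

lemma CF_combine: "length Ks = length Us \<Longrightarrow> CF.combine Ks Us = (\<Sum>i<length Us. Ks ! i * Us ! i)"
  by (induction Ks Us rule: list_induct2) (simp_all add: sum.lessThan_Suc_shift del: sum.lessThan_Suc)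

subsection \<open>Simple extensions\<close>

definition Qadj :: "complex \<Rightarrow> complex set" where "Qadj \<theta> = range (\<lambda>g. evQ g \<theta>)"

lemma Qadj_evQ [simp]: "evQ g \<theta> \<in> Qadj \<theta>" by (simp add: Qadj_def)
lemma Qadj_gen [simp]: "\<theta> \<in> Qadj \<theta>" using Qadj_evQ[of "[:0,1:]" \<theta>] by simp

lemma Qadj_subfield:
  assumes "algebraic \<theta>" shows "subfield (Qadj \<theta>) complex_field"
proof (rule subfield_complexI)
  show "1 \<in> Qadj \<theta>" using Qadj_evQ[of 1 \<theta>] by simp
  fix x assume "x \<in> Qadj \<theta>"
  then obtain g where g: "x = evQ g \<theta>" by (auto simp: Qadj_def)
  show "- x \<in> Qadj \<theta>" using Qadj_evQ[of "-g" \<theta>] g by simp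
  show "inverse x \<in> Qadj \<theta>" if "x \<noteq> 0"
  proof -
    obtain f where f: "Factorial_Ring.irreducible f" "evQ f \<theta> = 0" using minimal_polynomial_exists[OF assms] by blast
    have "\<not> f dvd g" using that g irreducible_root_iff[OF f] by simp
    then obtain a b where ab: "a * f + b * g = 1" using rat_bezout f(1) by blast
    have "evQ (a * f + b * g) \<theta> = 1" unfolding ab by simp
    hence "evQ b \<theta> * x = 1" using f g by simp
    hence "inverse x = evQ b \<theta>" using that by (simp add: field_simps)
    thus ?thesis by simp
  qed
  fix y assume "y \<in> Qadj \<theta>"
  then obtain h where h: "y = evQ h \<theta>" by (auto simp: Qadj_def)
  show "x + y \<in> Qadj \<theta>" using Qadj_evQ[of "g+h" \<theta>] g h by simp
  show "x * y \<in> Qadj \<theta>" using Qadj_evQ[of "g*h" \<theta>] g h by simp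
qed

lemma Qadj_min: "subfield F complex_field \<Longrightarrow> \<theta> \<in> F \<Longrightarrow> Qadj \<theta> \<subseteq> F"
  by (auto simp: Qadj_def subfield_evQ)

lemma generate_field_eq_Qadj:
  assumes "algebraic \<theta>" shows "generate_field complex_field {\<theta>} = Qadj \<theta>"
proof
  show "generate_field complex_field {\<theta>} \<subseteq> Qadj \<theta>"
    by (rule field.generate_field_min_subfield1[OF field_from_type_algebra]) (use Qadj_subfield[OF assms] in auto)
  show "Qadj \<theta> \<subseteq> generate_field complex_field {\<theta>}"
    by (rule Qadj_min) (auto intro: field.generate_field_is_subfield[OF field_from_type_algebra] generate_field.incl)
qed

lemma Qadj_reduced:
  assumes "evQ f \<theta> = 0" "degree f > 0" "x \<in> Qadj \<theta>"
  obtains g where "degree g < degree f" "x = evQ g \<theta>"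
proof -
  obtain g where g: "x = evQ g \<theta>" using assms(3) by (auto simp: Qadj_def)
  have "evQ g \<theta> = evQ (f * (g div f) + g mod f) \<theta>" by (simp del: evQ_ring)
  also have "\<dots> = evQ (g mod f) \<theta>" by (simp only: evQ_ring assms(1)) simp
  finally have "x = evQ (g mod f) \<theta>" using g by simp
  moreover have "degree (g mod f) < degree f"
    using degree_mod_less[of f g] assms(2) by (cases "f = 0"; cases "g mod f = 0") auto
  ultimately show ?thesis using that by metis
qed

lemma evQ_altdef: "degree g < n \<Longrightarrow> evQ g z = (\<Sum>i<n. of_rat (coeff g i) * z ^ i)"
proof -
  assume "degree g < n"
  hence "(\<Sum>i\<le>degree g. of_rat (coeff g i) * z ^ i) = (\<Sum>i<n. of_rat (coeff g i) * z ^ i)"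
    by (intro sum.mono_neutral_left) (auto simp: coeff_eq_0)
  thus ?thesis by (simp add: evQ_def poly_altdef)
qed

lemma Rats_list_poly:
  assumes "set Ks \<subseteq> (\<rat> :: complex set)"
  obtains g :: "rat poly" where "\<And>i. i < length Ks \<Longrightarrow> Ks ! i = of_rat (coeff g i)" "\<And>i. i \<ge> length Ks \<Longrightarrow> coeff g i = 0"
proof -
  have "\<forall>i. \<exists>c. i < length Ks \<longrightarrow> Ks ! i = of_rat c" using assms by (metis Rats_cases nth_mem subsetD)
  then obtain c where c: "\<And>i. i < length Ks \<Longrightarrow> Ks ! i = of_rat (c i)" by metis
  define g where "g = Poly (map c [0..<length Ks])"
  show ?thesis by (rule that[of g]) (auto simp: g_def nth_default_def c)
qed

lemma combine_powers:
  assumes "set Ks \<subseteq> \<rat>" "length Ks = n" "n > 0"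
  obtains g where "CF.combine Ks (map (\<lambda>i. \<theta> ^ i) [0..<n]) = evQ g \<theta>" "degree g < n" "\<And>i. i < n \<Longrightarrow> Ks ! i = of_rat (coeff g i)"
proof -
  obtain g where g: "\<And>i. i < length Ks \<Longrightarrow> Ks ! i = of_rat (coeff g i)" "\<And>i. i \<ge> length Ks \<Longrightarrow> coeff g i = 0"
    using Rats_list_poly[OF assms(1)] by blast
  have dg: "degree g < n"
    using g(2) assms(2,3) by (metis degree_0 leading_coeff_0_iff not_le)
  have "CF.combine Ks (map (\<lambda>i. \<theta> ^ i) [0..<n]) = (\<Sum>i<n. of_rat (coeff g i) * \<theta> ^ i)"
    using assms(2) g(1) by (subst CF_combine) (auto intro!: sum.cong)
  hence "CF.combine Ks (map (\<lambda>i. \<theta> ^ i) [0..<n]) = evQ g \<theta>" using evQ_altdef[OF dg] by simp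
  thus ?thesis using that[of g] dg g(1) assms(2) by simp
qed

lemma powers_independent:
  assumes "\<And>g. degree g < n \<Longrightarrow> evQ g \<theta> = 0 \<Longrightarrow> g = 0" "n > 0"
  shows "CF.independent \<rat> (map (\<lambda>i. \<theta> ^ i) [0..<n])"
proof -
  define Us where "Us = map (\<lambda>i. \<theta> ^ i) [0..<n]"
  have len: "length Us = n" by (simp add: Us_def)
  have "CF.independent \<rat> Us"
  proof (rule CF.trivial_combine_imp_independent[OF subfield_Rats])
    fix Ks assume Ks: "set Ks \<subseteq> \<rat>" "CF.combine Ks Us = \<zero>\<^bsub>complex_field\<^esub>"
    have "\<exists>Ks'. set Ks' \<subseteq> \<rat> \<and> length Ks' = n \<and> CF.combine Ks' Us = 0 \<and> set (take n Ks) \<subseteq> set Ks'"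
    proof (cases "length Ks \<ge> n")
      case True
      hence "CF.combine (take n Ks) Us = CF.combine Ks Us" using CF.combine_take[of Us Ks] len by (simp del: CF.combine.simps)
      thus ?thesis using Ks True by (intro exI[of _ "take n Ks"]) (auto dest: in_set_takeD)
    next
      case False
      have "CF.combine (Ks @ replicate (n - length Ks) \<zero>\<^bsub>complex_field\<^esub>) Us = CF.combine Ks Us"
        by (rule CF.combine_append_replicate) auto
      thus ?thesis using Ks False by (intro exI[of _ "Ks @ replicate (n - length Ks) 0"]) auto
    qed
    then obtain Ks' where K: "set Ks' \<subseteq> \<rat>" "length Ks' = n" "CF.combine Ks' Us = 0" "set (take n Ks) \<subseteq> set Ks'" by blast
    obtain g where g: "CF.combine Ks' Us = evQ g \<theta>" "degree g < n" "\<And>i. i < n \<Longrightarrow> Ks' ! i = of_rat (coeff g i)"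
      using combine_powers[OF K(1,2) assms(2), of \<theta>] unfolding Us_def by blast
    have "g = 0" using assms(1)[OF g(2)] g(1) K(3) by simp
    hence "set Ks' \<subseteq> {0}" using g(3) K(2) by (auto simp: in_set_conv_nth)
    thus "set (take (length Us) Ks) \<subseteq> {\<zero>\<^bsub>complex_field\<^esub>}" using K(4) len by auto
  qed auto
  thus ?thesis by (simp add: Us_def)
qed

lemma Qadj_basis:
  assumes "Factorial_Ring.irreducible f" "evQ f \<theta> = 0"
  shows "CF.independent \<rat> (map (\<lambda>i. \<theta> ^ i) [0..<degree f])" "CF.Span \<rat> (map (\<lambda>i. \<theta> ^ i) [0..<degree f]) = Qadj \<theta>"
proof -
  define n where "n = degree f"
  have n: "n > 0" using irreducible_degree_pos assms n_def by simp
  define Us where "Us = map (\<lambda>i. \<theta> ^ i) [0..<n]"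
  have len: "length Us = n" by (simp add: Us_def)
  show "CF.independent \<rat> (map (\<lambda>i. \<theta> ^ i) [0..<degree f])"
  proof (rule powers_independent)
    fix g assume g: "degree g < degree f" "evQ g \<theta> = 0"
    have "f dvd g" using irreducible_root_dvd[OF assms g(2)] .
    thus "g = 0" using g(1) dvd_imp_degree_le[of f g] by (meson not_le)
  qed (use n n_def in simp)
  have "CF.Span \<rat> Us = {CF.combine Ks Us | Ks. length Ks = length Us \<and> set Ks \<subseteq> \<rat>}"
    by (rule CF.Span_eq_combine_set_length_version[OF subfield_Rats]) auto
  also have "\<dots> = Qadj \<theta>"
  proof safe
    fix Ks :: "complex list" assume "length Ks = length Us" "set Ks \<subseteq> \<rat>"
    thus "CF.combine Ks Us \<in> Qadj \<theta>" using combine_powers[of Ks n \<theta>] len n unfolding Us_def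
      by (metis Qadj_evQ)
  next
    fix x assume "x \<in> Qadj \<theta>"
    then obtain g where g: "degree g < n" "x = evQ g \<theta>" using Qadj_reduced[OF assms(2)] n n_def by metis
    define Ks where "Ks = map (\<lambda>i. of_rat (coeff g i) :: complex) [0..<n]"
    have "x = CF.combine Ks Us"
      unfolding g(2) evQ_altdef[OF g(1)] by (subst CF_combine) (auto simp: Ks_def Us_def intro!: sum.cong)
    moreover have "length Ks = length Us" "set Ks \<subseteq> \<rat>" by (auto simp: Ks_def len)
    ultimately show "\<exists>Ks. x = CF.combine Ks Us \<and> length Ks = length Us \<and> set Ks \<subseteq> \<rat>" by blast
  qed
  finally show "CF.Span \<rat> (map (\<lambda>i. \<theta> ^ i) [0..<degree f]) = Qadj \<theta>" by (simp add: Us_def n_def)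
qed

lemma dimension_Qadj:
  assumes "Factorial_Ring.irreducible f" "evQ f \<theta> = 0"
  shows "CF.dimension (degree f) \<rat> (Qadj \<theta>)"
  using CF.dimensionI[OF subfield_Rats Qadj_basis[OF assms]] by simp

lemma degree_over_Q_Qadj:
  assumes "Factorial_Ring.irreducible f" "evQ f \<theta> = 0"
  shows "degree_over_Q (Qadj \<theta>) = degree f"
  using CF.dimI[OF subfield_Rats dimension_Qadj[OF assms]] by (simp add: degree_over_Q_def over_def)

definition coeffs_in :: "complex set \<Rightarrow> complex poly \<Rightarrow> bool" where "coeffs_in L p \<longleftrightarrow> (\<forall>i. coeff p i \<in> L)"

lemma subfield_sum: "subfield L complex_field \<Longrightarrow> (\<And>i. i \<in> I \<Longrightarrow> f i \<in> L) \<Longrightarrow> sum f I \<in> L"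
  by (induction I rule: infinite_finite_induct) (auto simp: subfield_complexD)

lemma coeffs_in_closure:
  assumes "subfield L complex_field"
  shows "coeffs_in L p \<Longrightarrow> coeffs_in L q \<Longrightarrow> coeffs_in L (p + q)"
    "coeffs_in L p \<Longrightarrow> coeffs_in L q \<Longrightarrow> coeffs_in L (p - q)"
    "coeffs_in L p \<Longrightarrow> coeffs_in L q \<Longrightarrow> coeffs_in L (p * q)"
    "c \<in> L \<Longrightarrow> coeffs_in L (monom c n)" "coeffs_in L 0" "c \<in> L \<Longrightarrow> coeffs_in L p \<Longrightarrow> coeffs_in L (pCons c p)"
    "c \<in> L \<Longrightarrow> coeffs_in L p \<Longrightarrow> coeffs_in L (smult c p)"
    "coeffs_in L (map_poly of_rat f)"
  using assms by (auto simp: coeffs_in_def subfield_complexD coeff_mult coeff_pCons coeff_map_poly intro!: subfield_sum split: nat.splits)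

lemma monic_division_over_subfield:
  assumes L: "subfield L complex_field" and d: "coeffs_in L d" "lead_coeff d = 1"
  shows "coeffs_in L p \<Longrightarrow> \<exists>q r. coeffs_in L r \<and> p = q * d + r \<and> (r = 0 \<or> degree r < degree d)"
proof -
  have "p = 0 \<or> degree p < n \<Longrightarrow> coeffs_in L p \<Longrightarrow> \<exists>q r. coeffs_in L r \<and> p = q * d + r \<and> (r = 0 \<or> degree r < degree d)" for n p
  proof (induction n arbitrary: p)
    case 0
    thus ?case by (intro exI[of _ 0]) auto
  next
    case (Suc n)
    show ?case
    proof (cases "p = 0 \<or> degree p < n \<or> degree p < degree d")
      case True
      thus ?thesis using Suc by (metis add_0 mult_zero_left)
    next
      case False
      hence deg: "degree p = n" "degree d \<le> n" using Suc by auto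
      define t where "t = monom (lead_coeff p) (n - degree d)"
      define p' where "p' = p - t * d"
      have "coeff p' i = 0" if "i \<ge> n" for i
      proof (cases "i = n")
        case True
        have "coeff (t * d) n = lead_coeff p * coeff d (degree d)"
          using deg by (simp add: t_def coeff_monom_mult)
        thus ?thesis using True d(2) deg by (simp add: p'_def)
      next
        case False
        hence i: "i > n" using that by simp
        hence "coeff d (i - (n - degree d)) = 0" using deg by (intro coeff_eq_0) auto
        thus ?thesis using i deg by (simp add: p'_def t_def coeff_monom_mult coeff_eq_0)
      qed
      hence "p' = 0 \<or> degree p' < n" by (metis leading_coeff_0_iff not_le)
      moreover have "coeffs_in L p'" unfolding p'_def t_def using Suc.prems(2) d(1)
        by (intro coeffs_in_closure[OF L]) (auto simp: coeffs_in_def)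
      ultimately obtain q r where "coeffs_in L r" "p' = q * d + r" "r = 0 \<or> degree r < degree d"
        using Suc.IH by blast
      hence "coeffs_in L r \<and> p = (q + t) * d + r \<and> (r = 0 \<or> degree r < degree d)"
        by (simp add: p'_def algebra_simps)
      thus ?thesis by blast
    qed
  qed
  from this[of p "Suc (degree p)"] show "coeffs_in L p \<Longrightarrow> ?thesis" by simp
qed

lemma minimal_over_subfield_dvd:
  assumes L: "subfield L complex_field" and g: "coeffs_in L g" "g \<noteq> 0" "poly g z = 0"
  obtains d where "coeffs_in L d" "lead_coeff d = 1" "poly d z = 0"
    "\<And>p. coeffs_in L p \<Longrightarrow> poly p z = 0 \<Longrightarrow> d dvd p"
proof -
  define P where "P = (\<lambda>q. coeffs_in L q \<and> q \<noteq> 0 \<and> poly q z = 0)"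
  have "P g" using g P_def by simp
  then obtain q where q: "P q" "\<And>r. P r \<Longrightarrow> degree q \<le> degree r"
    using ex_has_least_nat[of P g degree] by blast
  have q0: "q \<noteq> 0" "coeffs_in L q" "poly q z = 0" using q(1) P_def by auto
  define d where "d = smult (inverse (lead_coeff q)) q"
  have lc: "inverse (lead_coeff q) \<in> L"
    using q0(2) by (auto simp: coeffs_in_def intro: subfield_complexD(7)[OF L])
  have d: "coeffs_in L d" "lead_coeff d = 1" "poly d z = 0" "degree d = degree q"
    using q0 lc by (auto simp: d_def coeffs_in_closure[OF L])
  have "d dvd p" if p: "coeffs_in L p" "poly p z = 0" for p
  proof -
    obtain a r where ar: "coeffs_in L r" "p = a * d + r" "r = 0 \<or> degree r < degree d"
      using monic_division_over_subfield[OF L d(1,2) p(1)] by blast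
    have "poly r z = 0" using ar(2) p(2) d(3) by simp
    hence "r = 0" using q(2)[of r] ar d(4) by (cases "r = 0") (auto simp: P_def)
    thus ?thesis using ar(2) by simp
  qed
  thus ?thesis using that d by blast
qed

lemma ex_nat_not_in_finite: "finite (B :: complex set) \<Longrightarrow> \<exists>c::nat. of_nat c \<notin> B"
proof (rule ccontr)
  assume fin: "finite B" and "\<nexists>c. of_nat c \<notin> B"
  hence "range (of_nat :: nat \<Rightarrow> complex) \<subseteq> B" by auto
  hence "finite (range (of_nat :: nat \<Rightarrow> complex))" using fin finite_subset by blast
  thus False using finite_imageD[of "of_nat :: nat \<Rightarrow> complex" UNIV] by (simp add: inj_of_nat)
qed

lemma coeffs_in_pcompose:
  assumes "subfield L complex_field" "coeffs_in L q"
  shows "coeffs_in L (pcompose (map_poly of_rat f) q)"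
proof (induction f)
  case (pCons a f)
  have "pcompose (map_poly of_rat (pCons a f)) q = [:of_rat a:] + q * pcompose (map_poly of_rat f) q"
    by (simp add: of_rat_hom.map_poly_pCons_hom pcompose_pCons)
  thus ?case using pCons assms by (auto intro!: coeffs_in_closure simp: subfield_complexD)
qed (use assms in \<open>auto intro: coeffs_in_closure\<close>)

lemma primitive_element_two:
  assumes "algebraic \<alpha>" "algebraic \<beta>"
  obtains c :: nat where "\<alpha> \<in> Qadj (\<alpha> + of_nat c * \<beta>)" "\<beta> \<in> Qadj (\<alpha> + of_nat c * \<beta>)"
proof -
  obtain f where f: "Factorial_Ring.irreducible f" "evQ f \<alpha> = 0" using minimal_polynomial_exists[OF assms(1)] by blast
  obtain g where g: "Factorial_Ring.irreducible g" "evQ g \<beta> = 0" using minimal_polynomial_exists[OF assms(2)] by blast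
  define B where "B = (\<lambda>(a, b). (a - \<alpha>) / (\<beta> - b)) ` ({z. evQ f z = 0} \<times> {z. evQ g z = 0})"
  have "finite B" unfolding B_def using card_roots_irreducible(1) f g by blast
  then obtain c :: nat where c: "of_nat c \<notin> B" using ex_nat_not_in_finite by blast
  define \<theta> where "\<theta> = \<alpha> + of_nat c * \<beta>"
  have "algebraic (of_nat c :: complex)" using algebraic_int_imp_algebraic algebraic_int_of_nat by blast
  hence "algebraic \<theta>" unfolding \<theta>_def using assms by (intro algebraic_add algebraic_mult)
  hence L: "subfield (Qadj \<theta>) complex_field" by (rule Qadj_subfield)
  define G where "G = (map_poly of_rat g :: complex poly)"
  define H where "H = pcompose (map_poly of_rat f) [:\<theta>, - of_nat c:]"
  have G: "coeffs_in (Qadj \<theta>) G" "poly G \<beta> = 0" "G \<noteq> 0"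
    using g coeffs_in_closure(8)[OF L] unfolding G_def Factorial_Ring.irreducible_def by (auto simp: evQ_def)
  have nat: "- of_nat c \<in> Qadj \<theta>" using subfield_complexD(8)[OF L, of "- int c"] by simp
  have H: "coeffs_in (Qadj \<theta>) H" unfolding H_def
    by (intro coeffs_in_pcompose[OF L] coeffs_in_closure[OF L] nat Qadj_gen)
  have Hpoly: "poly H w = evQ f (\<theta> - of_nat c * w)" for w by (simp add: H_def poly_pcompose evQ_def mult.commute)
  have H\<beta>: "poly H \<beta> = 0" using f by (simp add: Hpoly \<theta>_def)
  obtain d where d: "coeffs_in (Qadj \<theta>) d" "lead_coeff d = 1" "poly d \<beta> = 0"
    "\<And>p. coeffs_in (Qadj \<theta>) p \<Longrightarrow> poly p \<beta> = 0 \<Longrightarrow> d dvd p"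
    using minimal_over_subfield_dvd[OF L G(1,3,2)] by blast
  have roots: "w = \<beta>" if "poly d w = 0" for w
  proof (rule ccontr)
    assume ne: "w \<noteq> \<beta>"
    have "poly G w = 0" using d(4)[OF G(1,2)] that by (metis dvd_trans poly_eq_0_iff_dvd)
    hence w: "evQ g w = 0" by (simp add: G_def evQ_def)
    have "poly H w = 0" using d(4)[OF H H\<beta>] that by (metis dvd_trans poly_eq_0_iff_dvd)
    hence a: "evQ f (\<theta> - of_nat c * w) = 0" by (simp add: Hpoly)
    have "of_nat c = ((\<theta> - of_nat c * w) - \<alpha>) / (\<beta> - w)" using ne by (simp add: \<theta>_def field_simps)
    hence "of_nat c \<in> B" unfolding B_def using w a by (intro image_eqI[of _ _ "(\<theta> - of_nat c * w, w)"]) auto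
    thus False using c by simp
  qed
  have "[:-\<beta>, 1:] dvd d" using d(3) by (simp add: poly_eq_0_iff_dvd)
  then obtain e where e: "d = [:-\<beta>, 1:] * e" by (auto simp: dvd_def)
  have "degree e = 0"
  proof (rule ccontr)
    assume "degree e \<noteq> 0"
    then obtain w where w: "poly e w = 0" using fundamental_theorem_of_algebra constant_degree by metis
    hence "w = \<beta>" using roots e by simp
    hence "[:-\<beta>, 1:] dvd e" using w by (simp add: poly_eq_0_iff_dvd)
    then obtain e' where "e = [:-\<beta>, 1:] * e'" by (auto simp: dvd_def)
    moreover obtain k where "G = d * k" using d(4)[OF G(1,2)] by (auto simp: dvd_def)
    ultimately have "G = [:-\<beta>, 1:] * ([:-\<beta>, 1:] * (e' * k))" using e by (simp only: mult.assoc)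
    hence "poly (pderiv G) \<beta> = 0" by (simp only: pderiv_mult poly_add poly_mult) simp
    thus False using irreducible_imp_simple_roots[OF g] by (simp add: evQ_pderiv G_def)
  qed
  then obtain a where "e = [:a:]" by (auto elim: degree_eq_zeroE)
  hence "d = [:-\<beta>, 1:]" using e d(2) by (cases "a = 0") auto
  hence "- \<beta> \<in> Qadj \<theta>" using d(1) unfolding coeffs_in_def by (metis coeff_pCons_0)
  hence \<beta>: "\<beta> \<in> Qadj \<theta>" using subfield_complexD(5)[OF L, of "- \<beta>"] by simp
  have "\<theta> + - of_nat c * \<beta> \<in> Qadj \<theta>" using subfield_complexD(3,4)[OF L] nat \<beta> Qadj_gen by blast
  hence "\<alpha> \<in> Qadj \<theta>" by (simp add: \<theta>_def)
  thus ?thesis using that \<beta> unfolding \<theta>_def by blast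
qed

lemma primitive_element_finite:
  assumes "finite S" "\<And>x. x \<in> S \<Longrightarrow> algebraic x"
  obtains \<theta> where "algebraic \<theta>" "S \<subseteq> Qadj \<theta>"
proof -
  have "\<exists>\<theta>. algebraic \<theta> \<and> S \<subseteq> Qadj \<theta>" using assms
  proof (induction S rule: finite_induct)
    case empty
    show ?case using algebraic_0 by blast
  next
    case (insert x S)
    then obtain \<theta> where t: "algebraic \<theta>" "S \<subseteq> Qadj \<theta>" by auto
    obtain c :: nat where c: "\<theta> \<in> Qadj (\<theta> + of_nat c * x)" "x \<in> Qadj (\<theta> + of_nat c * x)"
      using primitive_element_two[OF t(1), of x] insert by blast
    have a: "algebraic (\<theta> + of_nat c * x)"
      using t(1) insert.prems algebraic_int_imp_algebraic[OF algebraic_int_of_nat[of c]]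
      by (intro algebraic_add algebraic_mult) auto
    hence "Qadj \<theta> \<subseteq> Qadj (\<theta> + of_nat c * x)" using c by (intro Qadj_min Qadj_subfield)
    thus ?case using a t c by blast
  qed
  thus ?thesis using that by blast
qed

lemma number_field_degree_bound:
  assumes "CF.dimension n \<rat> F" "subfield F complex_field" "x \<in> F"
  shows "algebraic x" and "Factorial_Ring.irreducible f \<Longrightarrow> evQ f x = 0 \<Longrightarrow> degree f \<le> n"
proof -
  have "\<not> CF.independent \<rat> (map (\<lambda>i. x ^ i) [0..<Suc n])"
  proof
    assume "CF.independent \<rat> (map (\<lambda>i. x ^ i) [0..<Suc n])"
    hence "length (map (\<lambda>i. x ^ i) [0..<Suc n]) \<le> n"
      by (rule CF.independent_length_le_dimension[OF subfield_Rats assms(1)]) (use assms in \<open>auto simp: subfield_complexD\<close>)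
    thus False by simp
  qed
  then obtain g where g: "degree g < Suc n" "evQ g x = 0" "g \<noteq> 0"
    using powers_independent[of "Suc n" x] by blast
  thus "algebraic x" using algebraic_iff_evQ by blast
  assume "Factorial_Ring.irreducible f" "evQ f x = 0"
  hence "f dvd g" using g irreducible_root_dvd by blast
  thus "degree f \<le> n" using dvd_imp_degree_le[of f g] g by simp
qed

lemma number_field_primitive_element:
  assumes "number_field F"
  obtains \<theta> where "algebraic_int \<theta>" "F = Qadj \<theta>"
proof -
  have sub: "subfield F complex_field" using assms by (simp add: number_field_def)
  obtain n where n: "CF.dimension n \<rat> F" using assms by (auto simp: number_field_def CF.finite_dimension_def)
  define D where "D = {degree f | f x. x \<in> F \<and> Factorial_Ring.irreducible f \<and> evQ f x = 0}"
  have fin: "finite D" by (rule finite_subset[of _ "{..n}"]) (auto simp: D_def number_field_degree_bound(2)[OF n sub])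
  obtain f1 where "Factorial_Ring.irreducible f1" "evQ f1 1 = 0"
    using minimal_polynomial_exists number_field_degree_bound(1)[OF n sub subfield_complexD(2)[OF sub]] by metis
  hence ne: "D \<noteq> {}" using subfield_complexD(2)[OF sub] unfolding D_def by blast
  obtain m where m: "m \<in> D" "m = Max D" using Max_in[OF fin ne] by blast
  from m(1) obtain f \<theta> where t: "\<theta> \<in> F" "Factorial_Ring.irreducible f" "evQ f \<theta> = 0" and "degree f = m"
    unfolding D_def by blast
  hence t4: "degree f = Max D" using m(2) by simp
  have alg: "algebraic x" if "x \<in> F" for x using number_field_degree_bound(1)[OF n sub that] .
  have "F \<subseteq> Qadj \<theta>"
  proof
    fix x assume x: "x \<in> F"
    obtain c :: nat where c: "\<theta> \<in> Qadj (\<theta> + of_nat c * x)" "x \<in> Qadj (\<theta> + of_nat c * x)"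
      using primitive_element_two alg t x by metis
    define \<gamma> where "\<gamma> = \<theta> + of_nat c * x"
    have \<gamma>: "\<gamma> \<in> F" unfolding \<gamma>_def using subfield_complexD(3,4,8)[OF sub] t x
      by (metis of_int_of_nat_eq)
    obtain h where h: "Factorial_Ring.irreducible h" "evQ h \<gamma> = 0" using minimal_polynomial_exists alg \<gamma> by metis
    have "degree h \<in> D" unfolding D_def using h \<gamma> by blast
    hence hf: "degree h \<le> degree f" using Max_ge[OF fin] t4 by simp
    define Us where "Us = map (\<lambda>i. \<theta> ^ i) [0..<degree f]"
    have sub': "Qadj \<theta> \<subseteq> Qadj \<gamma>" using c alg \<gamma> unfolding \<gamma>_def by (intro Qadj_min Qadj_subfield)
    have "set Us \<subseteq> Qadj \<gamma>" using subfield_complexD(10)[OF Qadj_subfield[OF alg[OF \<gamma>]]] c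
      by (auto simp: Us_def \<gamma>_def)
    moreover have Us: "CF.independent \<rat> Us" "CF.Span \<rat> Us = Qadj \<theta>" using Qadj_basis[OF t(2,3)] by (auto simp: Us_def)
    ultimately obtain Vs where Vs: "length (Vs @ Us) = degree h" "CF.independent \<rat> (Vs @ Us)" "CF.Span \<rat> (Vs @ Us) = Qadj \<gamma>"
      using CF.complete_base[OF subfield_Rats dimension_Qadj[OF h] Us(1)] by metis
    have "length Vs + degree f = degree h" using Vs(1) by (simp add: Us_def)
    hence "length Vs = 0" using hf by linarith
    hence "Vs = []" by simp
    hence "Qadj \<gamma> = Qadj \<theta>" using Vs(3) Us(2) by simp
    thus "x \<in> Qadj \<theta>" using c(2) by (simp add: \<gamma>_def)
  qed
  moreover have "Qadj \<theta> \<subseteq> F" using Qadj_min[OF sub t(1)] .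
  ultimately have F: "F = Qadj \<theta>" by blast
  obtain M :: nat where M: "M > 0" "algebraic_int (of_nat M * \<theta>)" using algebraic_imp_scaled_int[OF alg[OF t(1)]] .
  have sM: "subfield (Qadj (of_nat M * \<theta>)) complex_field" using M by (intro Qadj_subfield algebraic_int_imp_algebraic)
  have "Qadj (of_nat M * \<theta>) \<subseteq> F"
    using Qadj_min[OF sub] subfield_complexD(4,8)[OF sub] t(1) by (metis of_int_of_nat_eq)
  moreover have "\<theta> \<in> Qadj (of_nat M * \<theta>)"
  proof -
    have "of_rat (1 / of_nat M) * (of_nat M * \<theta>) \<in> Qadj (of_nat M * \<theta>)"
      using subfield_complexD(4,9)[OF sM] Qadj_gen by blast
    thus ?thesis using M(1) by (simp add: of_rat_divide)
  qed
  hence "Qadj \<theta> \<subseteq> Qadj (of_nat M * \<theta>)" using Qadj_min[OF sM] by blast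
  ultimately show ?thesis using that[of "of_nat M * \<theta>"] M F by blast
qed

definition frob_quot :: "nat \<Rightarrow> complex \<Rightarrow> complex" where "frob_quot p x = (x ^ p - x) / of_nat p"

definition padic_ints :: "nat \<Rightarrow> complex set" where "padic_ints p = {x. \<forall>k. algebraic_int ((frob_quot p ^^ k) x)}"

lemma padic_ints_algebraic_int: "x \<in> padic_ints p \<Longrightarrow> algebraic_int x"
  unfolding padic_ints_def by (metis (mono_tags, lifting) funpow_0 mem_Collect_eq)

lemma padic_ints_frob_quot: "x \<in> padic_ints p \<Longrightarrow> frob_quot p x \<in> padic_ints p"
proof -
  assume x: "x \<in> padic_ints p"
  have "algebraic_int ((frob_quot p ^^ k) (frob_quot p x))" for k
  proof -
    have "algebraic_int ((frob_quot p ^^ Suc k) x)" using x unfolding padic_ints_def by blast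
    thus ?thesis by (simp only: funpow_Suc_right o_apply)
  qed
  thus ?thesis by (simp add: padic_ints_def)
qed

lemma padic_ints_coinduct:
  assumes "x \<in> U" "\<And>y. y \<in> U \<Longrightarrow> algebraic_int y" "\<And>y. y \<in> U \<Longrightarrow> frob_quot p y \<in> U"
  shows "x \<in> padic_ints p"
proof -
  have "(frob_quot p ^^ k) x \<in> U" for k by (induction k) (use assms in auto)
  thus ?thesis using assms(2) by (auto simp: padic_ints_def)
qed

inductive_set ring_gen :: "complex set \<Rightarrow> complex set" for G where
  base: "g \<in> G \<Longrightarrow> g \<in> ring_gen G"
| one: "1 \<in> ring_gen G"
| neg_one: "-1 \<in> ring_gen G"
| add: "x \<in> ring_gen G \<Longrightarrow> y \<in> ring_gen G \<Longrightarrow> x + y \<in> ring_gen G"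
| mult: "x \<in> ring_gen G \<Longrightarrow> y \<in> ring_gen G \<Longrightarrow> x * y \<in> ring_gen G"

lemma ring_gen_minus: "x \<in> ring_gen G \<Longrightarrow> - x \<in> ring_gen G"
  using ring_gen.mult[OF ring_gen.neg_one, of x G] by simp
lemma ring_gen_diff: "x \<in> ring_gen G \<Longrightarrow> y \<in> ring_gen G \<Longrightarrow> x - y \<in> ring_gen G"
  using ring_gen.add[OF _ ring_gen_minus, of x G y] by simp
lemma ring_gen_0: "0 \<in> ring_gen G"
  using ring_gen.add[OF ring_gen.one ring_gen.neg_one] by simp
lemma ring_gen_of_nat: "of_nat k \<in> ring_gen G"
  by (induction k) (auto intro: ring_gen_0 ring_gen.one ring_gen.add)
lemma ring_gen_of_int: "of_int k \<in> ring_gen G"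
  by (cases k rule: int_cases2) (auto intro: ring_gen_of_nat ring_gen_minus)
lemma ring_gen_power: "x \<in> ring_gen G \<Longrightarrow> x ^ n \<in> ring_gen G"
  by (induction n) (auto intro: ring_gen.one ring_gen.mult)
lemma ring_gen_sum: "(\<And>i. i \<in> I \<Longrightarrow> f i \<in> ring_gen G) \<Longrightarrow> sum f I \<in> ring_gen G"
  by (induction I rule: infinite_finite_induct) (auto intro: ring_gen_0 ring_gen.add)
lemma ring_gen_evZ: "x \<in> ring_gen G \<Longrightarrow> evZ q x \<in> ring_gen G"
  by (induction q) (auto intro: ring_gen_0 ring_gen.add ring_gen.mult ring_gen_of_int)
lemmas ring_gen_closure = ring_gen.add ring_gen.mult ring_gen.one ring_gen_minus ring_gen_diff ring_gen_0 ring_gen_of_nat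
  ring_gen_of_int ring_gen_power ring_gen_evZ

lemma ring_gen_algebraic_int: "(\<And>g. g \<in> G \<Longrightarrow> algebraic_int g) \<Longrightarrow> x \<in> ring_gen G \<Longrightarrow> algebraic_int x"
proof -
  assume G: "\<And>g. g \<in> G \<Longrightarrow> algebraic_int g" and "x \<in> ring_gen G"
  from this(2) show ?thesis by induction (auto intro: G algebraic_int_closure)
qed

lemma frob_quot_mult:
  "p > 0 \<Longrightarrow> frob_quot p (x * y) = x ^ p * frob_quot p y + y * frob_quot p x"
  by (simp add: frob_quot_def field_simps power_mult_distrib)

lemma frob_quot_add:
  assumes "Factorial_Ring.prime p"
  obtains c :: "nat \<Rightarrow> nat" where
    "\<And>x y. frob_quot p (x + y) = frob_quot p x + frob_quot p y + (\<Sum>i\<in>{1..<p}. of_nat (c i) * (x ^ i * y ^ (p - i)))"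
proof -
  have p0: "p > 1" using assms prime_gt_1_nat by blast
  define c where "c = (\<lambda>i. (p choose i) div p)"
  have c: "p * c i = p choose i" if "i \<in> {1..<p}" for i
    using that dvd_choose_prime[of i p] assms p0 by (simp add: c_def)
  have "frob_quot p (x + y) = frob_quot p x + frob_quot p y + (\<Sum>i\<in>{1..<p}. of_nat (c i) * (x ^ i * y ^ (p - i)))" for x y
  proof -
    have "(x + y) ^ p = (\<Sum>i\<le>p. of_nat (p choose i) * x ^ i * y ^ (p - i))" by (rule binomial_ring)
    also have "{..p} = insert 0 (insert p {1..<p})" using p0 by auto
    also have "(\<Sum>i\<in>insert 0 (insert p {1..<p}). of_nat (p choose i) * x ^ i * y ^ (p - i)) =
       y ^ p + x ^ p + (\<Sum>i\<in>{1..<p}. of_nat (p choose i) * x ^ i * y ^ (p - i))"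
      using p0 by simp
    also have "(\<Sum>i\<in>{1..<p}. of_nat (p choose i) * x ^ i * y ^ (p - i)) =
       (\<Sum>i\<in>{1..<p}. of_nat p * (of_nat (c i) * (x ^ i * y ^ (p - i))))"
      by (intro sum.cong refl) (simp add: c[symmetric])
    also have "\<dots> = of_nat p * (\<Sum>i\<in>{1..<p}. of_nat (c i) * (x ^ i * y ^ (p - i)))"
      by (simp add: sum_distrib_left)
    finally show ?thesis using p0 by (simp add: frob_quot_def field_simps)
  qed
  thus ?thesis by (rule that)
qed

lemma frob_quot_ring_gen:
  assumes p: "Factorial_Ring.prime p" and G: "\<And>g. g \<in> G \<Longrightarrow> frob_quot p g \<in> ring_gen G" and x: "x \<in> ring_gen G"
  shows "frob_quot p x \<in> ring_gen G"
  using x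
proof induction
  case one
  have "frob_quot p 1 = 0" by (simp add: frob_quot_def)
  thus ?case by (simp add: ring_gen_0)
next
  case neg_one
  have "p = 2 \<or> odd p" using p prime_odd_nat[of p] prime_ge_2_nat[of p] by auto
  hence "frob_quot p (-1) = 0 \<or> frob_quot p (-1) = 1" by (auto simp: frob_quot_def)
  thus ?case by (metis ring_gen_0 ring_gen.one)
next
  case (add x y)
  obtain c where "frob_quot p (x + y) = frob_quot p x + frob_quot p y + (\<Sum>i\<in>{1..<p}. of_nat (c i) * (x ^ i * y ^ (p - i)))"
    using frob_quot_add[OF p] by metis
  also have "\<dots> \<in> ring_gen G" by (intro ring_gen_closure ring_gen_sum add)
  finally show ?case .
next
  case (mult x y)
  have "frob_quot p (x * y) = x ^ p * frob_quot p y + y * frob_quot p x"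
    using frob_quot_mult p prime_gt_0_nat by blast
  also have "\<dots> \<in> ring_gen G" by (intro ring_gen_closure mult)
  finally show ?case .
qed (rule G)

lemma ring_gen_subset_padic_ints:
  assumes "Factorial_Ring.prime p" "\<And>g. g \<in> G \<Longrightarrow> algebraic_int g" "\<And>g. g \<in> G \<Longrightarrow> frob_quot p g \<in> ring_gen G"
  shows "ring_gen G \<subseteq> padic_ints p"
  using padic_ints_coinduct[of _ "ring_gen G" p] frob_quot_ring_gen[OF assms(1,3)] ring_gen_algebraic_int[OF assms(2)] by blast

lemma ring_gen_padic_ints: "Factorial_Ring.prime p \<Longrightarrow> ring_gen (padic_ints p) = padic_ints p"
  using ring_gen_subset_padic_ints[of p "padic_ints p"]
  by (auto intro: ring_gen.base padic_ints_algebraic_int padic_ints_frob_quot)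

lemma padic_ints_closure:
  assumes "Factorial_Ring.prime p"
  shows "x \<in> padic_ints p \<Longrightarrow> y \<in> padic_ints p \<Longrightarrow> x + y \<in> padic_ints p"
    "x \<in> padic_ints p \<Longrightarrow> y \<in> padic_ints p \<Longrightarrow> x * y \<in> padic_ints p"
    "x \<in> padic_ints p \<Longrightarrow> y \<in> padic_ints p \<Longrightarrow> x - y \<in> padic_ints p"
    "x \<in> padic_ints p \<Longrightarrow> - x \<in> padic_ints p" "of_nat k \<in> padic_ints p" "of_int j \<in> padic_ints p"
    "1 \<in> padic_ints p" "x \<in> padic_ints p \<Longrightarrow> x ^ n \<in> padic_ints p" "x \<in> padic_ints p \<Longrightarrow> evZ q x \<in> padic_ints p"
proof -
  note R = ring_gen_closure[where G = "padic_ints p", unfolded ring_gen_padic_ints[OF assms]]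
  show "x \<in> padic_ints p \<Longrightarrow> y \<in> padic_ints p \<Longrightarrow> x + y \<in> padic_ints p" by (fact R(1))
  show "x \<in> padic_ints p \<Longrightarrow> y \<in> padic_ints p \<Longrightarrow> x * y \<in> padic_ints p" by (fact R(2))
  show "x \<in> padic_ints p \<Longrightarrow> y \<in> padic_ints p \<Longrightarrow> x - y \<in> padic_ints p" by (fact R(5))
  show "x \<in> padic_ints p \<Longrightarrow> - x \<in> padic_ints p" by (fact R(4))
  show "of_nat k \<in> padic_ints p" by (fact R(7))
  show "of_int j \<in> padic_ints p" by (fact R(8))
  show "1 \<in> padic_ints p" by (fact R(3))
  show "x \<in> padic_ints p \<Longrightarrow> x ^ n \<in> padic_ints p" by (fact R(9))
  show "x \<in> padic_ints p \<Longrightarrow> evZ q x \<in> padic_ints p" by (fact R(10))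
qed

lemma padic_ints_saturated_coprime:
  assumes p: "Factorial_Ring.prime p" and x: "algebraic_int x" and m: "coprime m p" "of_nat m * x \<in> padic_ints p"
  shows "x \<in> padic_ints p"
proof (rule padic_ints_coinduct[where U = "{x. algebraic_int x \<and> (\<exists>m. coprime m p \<and> of_nat m * x \<in> padic_ints p)}"])
  show "x \<in> {x. algebraic_int x \<and> (\<exists>m. coprime m p \<and> of_nat m * x \<in> padic_ints p)}" using x m by blast
  fix y assume "y \<in> {x. algebraic_int x \<and> (\<exists>m. coprime m p \<and> of_nat m * x \<in> padic_ints p)}"
  then obtain m where y: "algebraic_int y" and m: "coprime m p" "of_nat m * y \<in> padic_ints p" by blast
  show "algebraic_int y" by fact
  have p0: "p > 0" using p prime_gt_0_nat by blast
  have "frob_quot p (of_int (int m)) \<in> ring_gen {}" using frob_quot_ring_gen[OF p, of "{}"] ring_gen_of_int by blast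
  hence "algebraic_int (frob_quot p (of_nat m))" using ring_gen_algebraic_int[of "{}"] by simp
  moreover have "frob_quot p (of_nat m) \<in> \<rat>" by (auto simp: frob_quot_def)
  ultimately have "frob_quot p (of_nat m) \<in> \<int>" using rational_algebraic_int_is_int by blast
  then obtain t where t: "frob_quot p (of_nat m) = of_int t" by (auto elim: Ints_cases)
  hence tm: "(of_nat m :: complex) ^ p = of_nat m + of_nat p * of_int t"
    using p0 by (simp add: frob_quot_def field_simps)
  have eq: "frob_quot p (of_nat m * y) = of_nat m * frob_quot p y + of_int t * y ^ p"
    using p0 by (simp add: frob_quot_def power_mult_distrib tm field_simps)
  have R: "frob_quot p (of_nat m * y) \<in> padic_ints p" using padic_ints_frob_quot m by blast
  have "of_nat m * frob_quot p y = frob_quot p (of_nat m * y) - of_int t * y ^ p" using eq by simp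
  hence 1: "algebraic_int (of_nat m * frob_quot p y)"
    using padic_ints_algebraic_int[OF R] y by (auto intro: algebraic_int_closure)
  have 2: "algebraic_int (of_nat p * frob_quot p y)"
    using p0 y by (auto simp: frob_quot_def intro: algebraic_int_closure)
  obtain a b where ab: "a * int m + b * int p = 1" using m(1) bezout_int[of "int m" "int p"] by (auto simp: coprime_iff_gcd_eq_1)
  hence "(of_int (a * int m + b * int p) :: complex) = 1" by simp
  hence "frob_quot p y = of_int (a * int m + b * int p) * frob_quot p y" by simp
  also have "\<dots> = of_int a * (of_nat m * frob_quot p y) + of_int b * (of_nat p * frob_quot p y)" by (simp add: algebra_simps)
  also have "algebraic_int \<dots>"
    by (rule algebraic_int_add[OF algebraic_int_mult[OF algebraic_int_of_int 1] algebraic_int_mult[OF algebraic_int_of_int 2]])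
  finally have alg: "algebraic_int (frob_quot p y)" .
  have "of_nat (m ^ p * m) * frob_quot p y = of_nat (m ^ p) * frob_quot p (of_nat m * y) - of_int t * (of_nat m * y) ^ p"
    unfolding eq by (simp add: algebra_simps power_mult_distrib)
  also have "\<dots> \<in> padic_ints p" using R m(2) by - (assumption | rule padic_ints_closure[OF p])+
  finally show "frob_quot p y \<in> {x. algebraic_int x \<and> (\<exists>m. coprime m p \<and> of_nat m * x \<in> padic_ints p)}"
    using alg m(1) by (auto intro!: exI[of _ "m ^ p * m"])
qed

lemma padic_ints_unit_multiplier:
  assumes p: "Factorial_Ring.prime p"
  shows "algebraic_int x \<Longrightarrow> of_nat p ^ a * x \<in> padic_ints p \<Longrightarrow>
    \<exists>w. algebraic_int w \<and> x * (1 + of_nat p * w) \<in> padic_ints p"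
proof (induction a arbitrary: x)
  case 0
  thus ?case by (intro exI[of _ 0]) auto
next
  case (Suc a)
  have p1: "p > 1" using p prime_gt_1_nat by blast
  define y where "y = of_nat p ^ Suc a * x"
  define v where "v = of_nat p ^ a * x * y ^ (p - 2)"
  have y: "y \<in> padic_ints p" using Suc.prems by (simp add: y_def)
  have ya: "algebraic_int y" using padic_ints_algebraic_int[OF y] .
  have va: "algebraic_int v" unfolding v_def using Suc.prems(1) ya
    by (intro algebraic_int_closure algebraic_int_of_nat)
  have pv: "y ^ (p - 1) = of_nat p * v"
  proof -
    have "p - 1 = Suc (p - 2)" using p1 by simp
    hence "y ^ (p - 1) = y * y ^ (p - 2)" by (simp only: power_Suc)
    thus ?thesis by (simp add: v_def y_def)
  qed
  define x1 where "x1 = x * (1 - of_nat p * v)"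
  have "of_nat p ^ a * x1 = - frob_quot p y"
  proof -
    have "y ^ p = y * y ^ (p - 1)" using p1 by (cases p) auto
    hence "frob_quot p y = (y * y ^ (p - 1) - y) / of_nat p" unfolding frob_quot_def by (rule arg_cong)
    also have "\<dots> = y * (of_nat p * v - 1) / of_nat p" unfolding pv by (simp add: algebra_simps)
    also have "\<dots> = of_nat p ^ a * x * (of_nat p * v - 1)" using p1 by (simp add: y_def)
    finally show ?thesis by (simp add: x1_def algebra_simps)
  qed
  hence "of_nat p ^ a * x1 \<in> padic_ints p" using padic_ints_closure(4)[OF p padic_ints_frob_quot[OF y]] by simp
  moreover have "algebraic_int x1" unfolding x1_def using va Suc.prems(1)
    by (intro algebraic_int_closure algebraic_int_of_nat algebraic_int_1)
  ultimately obtain w where w: "algebraic_int w" "x1 * (1 + of_nat p * w) \<in> padic_ints p" using Suc.IH by blast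
  have "x1 * (1 + of_nat p * w) = x * (1 + of_nat p * (w - v - of_nat p * (v * w)))"
    by (simp add: x1_def algebra_simps)
  moreover have "algebraic_int (w - v - of_nat p * (v * w))" using va w(1) by (intro algebraic_int_closure algebraic_int_of_nat)
  ultimately show ?case using w(2) by metis
qed

lemma padic_ints_saturated_prime_power:
  assumes p: "Factorial_Ring.prime p" and x: "algebraic_int x" "of_nat p ^ a * x \<in> padic_ints p"
  shows "x \<in> padic_ints p"
proof (rule padic_ints_coinduct[where U = "{x. algebraic_int x \<and> (\<exists>a. of_nat p ^ a * x \<in> padic_ints p)}"])
  show "x \<in> {x. algebraic_int x \<and> (\<exists>a. of_nat p ^ a * x \<in> padic_ints p)}" using x by blast
  fix y assume "y \<in> {x. algebraic_int x \<and> (\<exists>a. of_nat p ^ a * x \<in> padic_ints p)}"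
  then obtain a where y: "algebraic_int y" and a: "of_nat p ^ a * y \<in> padic_ints p" by blast
  show "algebraic_int y" by fact
  have p1: "p > 1" using p prime_gt_1_nat by blast
  obtain w where w: "algebraic_int w" "y * (1 + of_nat p * w) \<in> padic_ints p"
    using padic_ints_unit_multiplier[OF p y a] by blast
  define s where "s = y * w"
  have s: "algebraic_int s" unfolding s_def using y w by (intro algebraic_int_closure)
  have z: "y + of_nat p * s \<in> padic_ints p" using w(2) by (simp add: s_def algebra_simps)
  have 1: "algebraic_int (frob_quot p (y + of_nat p * s))"
    using padic_ints_algebraic_int padic_ints_frob_quot z by blast
  have "((P * s) ^ Suc n - P * s) / P = P ^ n * s ^ Suc n - s" if "P \<noteq> 0" for P :: complex and n
    using that by (simp add: power_mult_distrib field_simps)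
  from this[of "of_nat p" "p - 1"] have "frob_quot p (of_nat p * s) = of_nat p ^ (p - 1) * s ^ p - s"
    using p1 by (simp add: frob_quot_def del: power_Suc of_nat_Suc)
  hence 2: "algebraic_int (frob_quot p (of_nat p * s))" using s by (auto intro!: algebraic_int_closure)
  obtain c where c: "\<And>x y. frob_quot p (x + y) = frob_quot p x + frob_quot p y + (\<Sum>i\<in>{1..<p}. of_nat (c i) * (x ^ i * y ^ (p - i)))"
    using frob_quot_add[OF p] by blast
  define C where "C = (\<Sum>i\<in>{1..<p}. of_nat (c i) * (y ^ i * (of_nat p * s) ^ (p - i)))"
  have C: "algebraic_int C" unfolding C_def using y s
    by (intro algebraic_int_sum algebraic_int_closure algebraic_int_of_nat)
  have "frob_quot p y = frob_quot p (y + of_nat p * s) - frob_quot p (of_nat p * s) - C"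
    using c[of y "of_nat p * s"] by (simp add: C_def)
  hence alg: "algebraic_int (frob_quot p y)" using 1 2 C by (auto intro!: algebraic_int_closure)
  have "of_nat p ^ (a * p + 1) * frob_quot p y = (of_nat p ^ a * y) ^ p - of_nat (p ^ (a * (p - 1))) * (of_nat p ^ a * y)"
  proof -
    have "a * p = a * (p - 1) + a" using p1 by (cases p) auto
    hence "(of_nat p :: complex) ^ (a * p) = of_nat p ^ (a * (p - 1)) * of_nat p ^ a"
      by (simp only: power_add)
    thus ?thesis using p1 by (simp add: frob_quot_def power_mult_distrib power_mult algebra_simps)
  qed
  also have "\<dots> \<in> padic_ints p" using a by - (assumption | rule padic_ints_closure[OF p])+
  finally show "frob_quot p y \<in> {x. algebraic_int x \<and> (\<exists>a. of_nat p ^ a * x \<in> padic_ints p)}"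
    using alg by blast
qed

lemma padic_ints_saturated:
  assumes p: "Factorial_Ring.prime p" and x: "algebraic_int x" and M: "M > 0" "of_nat M * x \<in> padic_ints p"
  shows "x \<in> padic_ints p"
proof -
  obtain m where m: "M = p ^ multiplicity p M * m" "\<not> p dvd m"
    using multiplicity_decompose'[of M p] M(1) p by (metis not_prime_unit not_less_zero)
  define a where "a = multiplicity p M"
  have cop: "coprime m p" using prime_imp_coprime[OF p m(2)] by (simp only: coprime_commute)
  have "of_nat m * (of_nat p ^ a * x) = of_nat M * x" by (subst m(1)) (simp add: a_def)
  hence "of_nat m * (of_nat p ^ a * x) \<in> padic_ints p" using M(2) by (simp only:)
  moreover have "algebraic_int (of_nat p ^ a * x)"
    by (rule algebraic_int_mult[OF algebraic_int_power[OF algebraic_int_of_nat] x])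
  ultimately have "of_nat p ^ a * x \<in> padic_ints p"
    using padic_ints_saturated_coprime[OF p _ cop] by blast
  thus ?thesis using padic_ints_saturated_prime_power[OF p x] by blast
qed

lemma padic_ints_conjugate:
  assumes "Factorial_Ring.irreducible f" "evQ f x = 0" "evQ f y = 0" "x \<in> padic_ints p"
  shows "y \<in> padic_ints p"
proof -
  define D where "D = (\<lambda>k. ((\<lambda>g::rat poly. smult (1 / of_nat p) (g ^ p - g)) ^^ k) [:0,1:])"
  have D: "(frob_quot p ^^ k) z = evQ (D k) z" for k z
    by (induction k) (simp_all add: D_def frob_quot_def of_rat_divide)
  show ?thesis using assms(4) conjugate_algebraic_int[OF assms(1-3)] by (auto simp: padic_ints_def D)
qed

subsection \<open>The field\<close>

definition padic_field :: "nat set \<Rightarrow> complex set" where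
  "padic_field S = {z. algebraic z \<and> (\<forall>p\<in>S. \<exists>M>0. of_nat M * z \<in> padic_ints p)}"

lemma padic_field_integers:
  assumes "z \<in> padic_field S" "algebraic_int z" "p \<in> S" "Factorial_Ring.prime p"
  shows "z \<in> padic_ints p"
  using assms padic_ints_saturated by (auto simp: padic_field_def)

lemma padic_inverse:
  assumes p: "Factorial_Ring.prime p" and x: "x \<in> padic_ints p" "x \<noteq> 0"
  shows "\<exists>M>0. of_nat M * inverse x \<in> padic_ints p"
proof -
  have a: "algebraic_int x" using padic_ints_algebraic_int x by blast
  obtain f where f: "lead_coeff f = 1" "Factorial_Ring.irreducible f" "evQ f x = 0"
    using minimal_polynomial_exists[OF algebraic_int_imp_algebraic[OF a]] .
  obtain h where h: "f = map_poly of_int h" "lead_coeff h = 1"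
    using minimal_polynomial_integral[OF f(2,1,3) a] .
  obtain c q where cq: "h = pCons c q" by (cases h)
  have eq: "of_int c + x * evZ q x = 0" using f(3) h(1) cq by simp
  have "c \<noteq> 0"
  proof
    assume "c = 0"
    hence "evZ q x = 0" using eq x by simp
    hence "f dvd map_poly of_int q" using irreducible_root_dvd[OF f(2,3)] by simp
    moreover have "q \<noteq> 0" using h(2) cq \<open>c = 0\<close> by auto
    ultimately have "degree f \<le> degree q" using dvd_imp_degree_le[of f "map_poly of_int q"] by simp
    thus False using h(1) cq \<open>q \<noteq> 0\<close> by simp
  qed
  have "of_int c * inverse x = - evZ q x" using eq x(2) by (simp add: field_simps eq_neg_iff_add_eq_0)
  hence "of_int c * inverse x \<in> padic_ints p" using padic_ints_closure[OF p] x by simp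
  hence "of_int (sgn c) * (of_int c * inverse x) \<in> padic_ints p"
    by - (assumption | rule padic_ints_closure[OF p])+
  moreover have "of_int (sgn c) * (of_int c * inverse x) = of_nat (nat \<bar>c\<bar>) * inverse x"
    by (cases "c \<ge> 0") (auto simp: sgn_if)
  ultimately show ?thesis using \<open>c \<noteq> 0\<close> by (intro exI[of _ "nat \<bar>c\<bar>"]) auto
qed

lemma padic_field_subfield:
  assumes S: "\<And>p. p \<in> S \<Longrightarrow> Factorial_Ring.prime p"
  shows "subfield (padic_field S) complex_field"
proof (rule subfield_complexI)
  show "1 \<in> padic_field S"
    using padic_ints_closure(7)[OF S] by (auto simp: padic_field_def intro!: exI[of _ 1])
  fix x assume x: "x \<in> padic_field S"
  show "- x \<in> padic_field S"
    using x padic_ints_closure(4)[OF S] by (fastforce simp: padic_field_def)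
  show "inverse x \<in> padic_field S" if nz: "x \<noteq> 0"
    unfolding padic_field_def
  proof safe
    show "algebraic (inverse x)" using x by (auto simp: padic_field_def)
    fix p assume p: "p \<in> S"
    obtain M where M: "M > 0" "of_nat M * x \<in> padic_ints p" using x p by (auto simp: padic_field_def)
    have nzM: "of_nat M * x \<noteq> 0" using M(1) nz by simp
    obtain N where N: "N > 0" "of_nat N * inverse (of_nat M * x) \<in> padic_ints p"
      using padic_inverse[OF S[OF p] M(2)] nzM by blast
    have "of_nat M * (of_nat N * inverse (of_nat M * x)) \<in> padic_ints p"
      using N(2) by - (assumption | rule padic_ints_closure[OF S[OF p]])+
    hence "of_nat N * inverse x \<in> padic_ints p" using M(1) nz by (simp add: field_simps)
    thus "\<exists>M>0. of_nat M * inverse x \<in> padic_ints p" using N(1) by blast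
  qed
  fix y assume y: "y \<in> padic_field S"
  have *: "\<exists>M>0. of_nat M * (x + y) \<in> padic_ints p \<and> of_nat M * (x * y) \<in> padic_ints p" if p: "p \<in> S" for p
  proof -
    obtain M where M: "M > 0" "of_nat M * x \<in> padic_ints p" using x p by (auto simp: padic_field_def)
    obtain N where N: "N > 0" "of_nat N * y \<in> padic_ints p" using y p by (auto simp: padic_field_def)
    have "of_nat N * (of_nat M * x) + of_nat M * (of_nat N * y) \<in> padic_ints p"
         "(of_nat M * x) * (of_nat N * y) \<in> padic_ints p"
      using M(2) N(2) by - (assumption | rule padic_ints_closure[OF S[OF p]])+
    thus ?thesis using M N by (intro exI[of _ "M * N"]) (auto simp: algebra_simps)
  qed
  have "algebraic x" "algebraic y" using x y by (auto simp: padic_field_def)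
  hence "algebraic (x + y)" "algebraic (x * y)" by (auto intro: algebraic_add algebraic_mult)
  thus "x + y \<in> padic_field S" "x * y \<in> padic_field S"
    using * unfolding padic_field_def by blast+
qed

lemma padic_field_galois:
  assumes S: "\<And>p. p \<in> S \<Longrightarrow> Factorial_Ring.prime p"
  shows "galois_over_Q (padic_field S)"
  unfolding galois_over_Q_def
proof (intro conjI allI impI padic_field_subfield S)
  show "padic_field S \<subseteq> Qbar" by (auto simp: padic_field_def Qbar_def)
  fix f :: "rat poly" and z :: complex
  assume f: "Factorial_Ring.irreducible f" and ex: "\<exists>x\<in>padic_field S. poly (map_poly of_rat f) x = 0"
    and z: "poly (map_poly of_rat f) z = 0"
  from ex obtain x where x: "x \<in> padic_field S" "evQ f x = 0" by (auto simp: evQ_def)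
  have z: "evQ f z = 0" using z by (simp add: evQ_def)
  have "\<exists>M>0. of_nat M * z \<in> padic_ints p" if p: "p \<in> S" for p
  proof -
    obtain M where M: "M > 0" "of_nat M * x \<in> padic_ints p" using x p by (auto simp: padic_field_def)
    define g where "g = pcompose f [:0, 1 / of_nat M:]"
    have g: "evQ g (of_nat M * w) = evQ f w" for w using M(1) by (simp add: g_def of_rat_divide)
    have irr: "algebraic (of_nat M * x)" using M padic_ints_algebraic_int by blast
    obtain k where k: "Factorial_Ring.irreducible k" "evQ k (of_nat M * x) = 0"
      using minimal_polynomial_exists[OF irr] by blast
    have "evQ (pcompose k [:0, of_nat M:]) x = 0" using k by (simp add: mult.commute)
    hence "evQ (pcompose k [:0, of_nat M:]) z = 0" using conjugate_root[OF f x(2) z] by blast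
    hence "evQ k (of_nat M * z) = 0" by (simp add: mult.commute)
    hence "of_nat M * z \<in> padic_ints p" using padic_ints_conjugate[OF k _ M(2)] by blast
    thus ?thesis using M(1) by blast
  qed
  moreover have "algebraic z"
    using z f unfolding algebraic_iff_evQ Factorial_Ring.irreducible_def by blast
  ultimately show "z \<in> padic_field S" by (simp add: padic_field_def)
qed

lemma poly_coeffs_dvd_of_many_roots:
  fixes g :: "int poly" and p :: int
  assumes "Factorial_Ring.prime p" "finite S" "\<And>c. c \<in> S \<Longrightarrow> p dvd poly g c" "card S > degree g"
    "\<And>c d. c \<in> S \<Longrightarrow> d \<in> S \<Longrightarrow> p dvd c - d \<Longrightarrow> c = d"
  shows "p dvd coeff g i"
  using assms
proof (induction "degree g" arbitrary: g S i)
  case 0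
  then obtain a where a: "g = [:a:]" by (auto elim: degree_eq_zeroE)
  obtain c where "c \<in> S" using 0 by fastforce
  hence "p dvd a" using 0(4) a by force
  thus ?case using a by (simp add: coeff_pCons split: nat.split)
next
  case (Suc n)
  obtain c where c: "c \<in> S" using Suc.prems by fastforce
  define q where "q = synthetic_div g c"
  have eq: "g = [:-c, 1:] * q + [:poly g c:]"
    using synthetic_div_correct'[of c g] by (simp add: q_def)
  have dq: "degree q = n" using Suc.hyps(2) by (simp add: q_def degree_synthetic_div)
  have "p dvd coeff q j" for j
  proof (rule Suc.hyps(1)[of q "S - {c}"])
    fix d assume d: "d \<in> S - {c}"
    have "poly g d = (d - c) * poly q d + poly g c" by (subst eq) (simp add: algebra_simps)
    hence "p dvd (d - c) * poly q d" using Suc.prems(3)[of c] Suc.prems(3)[of d] c d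
      by (metis DiffD1 dvd_add_left_iff)
    moreover have "\<not> p dvd d - c" using Suc.prems(5)[of d c] c d by auto
    ultimately show "p dvd poly q d" using Suc.prems(1) prime_dvd_mult_iff by blast
  next
    show "degree q < card (S - {c})" using Suc.prems(2,4) Suc.hyps(2) c dq by simp
  qed (use Suc.prems dq in auto)
  moreover have "p dvd poly g c" using Suc.prems(3) c by blast
  ultimately show ?case by (subst eq) (simp add: coeff_pCons dvd_add dvd_diff split: nat.split)
qed

lemma poly_dvd_imp_smult:
  fixes g :: "int poly" and p :: int
  assumes "\<And>i. p dvd coeff g i"
  obtains s where "g = smult p s"
proof -
  have "g = smult p (map_poly (\<lambda>a. a div p) g)"
    by (intro poly_eqI) (simp add: coeff_map_poly assms)
  thus ?thesis by (rule that)
qed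

lemma fermat_int:
  assumes "Factorial_Ring.prime p" shows "int p dvd c ^ p - c"
proof -
  have p0: "p > 0" using assms prime_gt_0_nat by blast
  have "frob_quot p (of_int c) \<in> ring_gen {}" using frob_quot_ring_gen[OF assms, of "{}"] ring_gen_of_int by blast
  hence "algebraic_int (frob_quot p (of_int c))" using ring_gen_algebraic_int[of "{}"] by simp
  moreover have "frob_quot p (of_int c) \<in> \<rat>" by (auto simp: frob_quot_def)
  ultimately have "frob_quot p (of_int c) \<in> \<int>" using rational_algebraic_int_is_int by blast
  then obtain t where t: "frob_quot p (of_int c) = of_int t" by (auto elim: Ints_cases)
  hence "(of_int (c ^ p - c) :: complex) = of_int (int p * t)"
    using p0 by (simp add: frob_quot_def field_simps)
  hence "c ^ p - c = int p * t" by (simp only: of_int_eq_iff)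
  thus ?thesis by simp
qed

lemma degree_prod_linear: "finite S \<Longrightarrow> degree (\<Prod>c\<in>S. [:- f c, 1 :: 'a :: idom:]) = card S"
  by (subst degree_prod_eq_sum_degree) auto

lemma lead_coeff_prod_linear: "lead_coeff (\<Prod>c\<in>S. [:- f c, 1 :: 'a :: idom:]) = 1"
  by (subst lead_coeff_prod) auto

lemma frobenius_poly_factorization:
  assumes p: "Factorial_Ring.prime p"
  obtains s where "[:0, 1:] ^ p - [:0, 1:] = (\<Prod>c<p. [:- int c, 1:]) + smult (int p) s"
proof -
  have p1: "p > 1" using p prime_gt_1_nat by blast
  define u where "u = ([:0, 1:] ^ p - [:0, 1:] :: int poly)"
  define v where "v = (\<Prod>c<p. [:- int c, 1:])"
  have mon: "[:0, 1:] ^ p = (monom 1 p :: int poly)" by (simp add: monom_altdef)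
  have dv: "degree v = p" "lead_coeff v = 1" using degree_prod_linear[of "{..<p}" int] lead_coeff_prod_linear[of int "{..<p}"] by (simp_all add: v_def)
  have "coeff (u - v) i = 0" if "i \<ge> p" for i
  proof (cases "i = p")
    case True
    thus ?thesis using dv p1 by (simp add: u_def mon coeff_pCons split: nat.splits)
  next
    case False
    thus ?thesis using that dv p1 by (simp add: u_def mon coeff_pCons coeff_eq_0 split: nat.splits)
  qed
  hence "degree (u - v) < p" using p1 by (metis degree_0 leading_coeff_0_iff not_le not_less_zero gr0I)
  moreover have "int p dvd poly (u - v) (int c)" if "c < p" for c
  proof -
    have "poly v (int c) = 0" using that by (auto simp: v_def poly_prod)
    thus ?thesis using fermat_int[OF p, of "int c"] by (simp add: u_def poly_power)
  qed
  ultimately have "int p dvd coeff (u - v) i" for i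
  proof (intro poly_coeffs_dvd_of_many_roots[of "int p" "int ` {..<p}"])
    fix c d assume cd: "c \<in> int ` {..<p}" "d \<in> int ` {..<p}" "int p dvd c - d"
    hence "c mod int p = d mod int p" by (simp add: mod_eq_dvd_iff)
    thus "c = d" using cd by auto
  qed (use p in \<open>auto simp: card_image\<close>)
  then obtain s where "u - v = smult (int p) s" using poly_dvd_imp_smult by metis
  hence "u = v + smult (int p) s" by (simp add: algebra_simps)
  thus ?thesis using that unfolding u_def v_def by blast
qed

lemma split_mod_p_dvd_frobenius:
  assumes p: "Factorial_Ring.prime p" and S: "S \<subseteq> {..<p}" and f: "f = (\<Prod>c\<in>S. [:- int c, 1:]) + smult (int p) r"
  obtains q s where "[:0, 1:] ^ p - [:0, 1:] = f * q + smult (int p) s"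
proof -
  obtain t where t: "[:0, 1:] ^ p - [:0, 1:] = (\<Prod>c<p. [:- int c, 1:]) + smult (int p) t"
    using frobenius_poly_factorization[OF p] .
  define q where "q = (\<Prod>c\<in>{..<p} - S. [:- int c, 1:])"
  have "(\<Prod>c<p. [:- int c, 1:]) = q * (\<Prod>c\<in>S. [:- int c, 1:])"
    unfolding q_def using S by (intro prod.subset_diff) auto
  hence "[:0, 1:] ^ p - [:0, 1:] = f * q + smult (int p) (t - r * q)"
    unfolding t f by (simp add: algebra_simps smult_diff_right)
  thus ?thesis by (rule that)
qed

lemma frob_quot_via_divisor:
  assumes "[:0, 1:] ^ p - [:0, 1:] = f * q + smult (int p) s" "p > 0" "evZ f x = of_nat p * y"
  shows "frob_quot p x = y * evZ q x + evZ s x"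
proof -
  have "evZ ([:0, 1:] ^ p - [:0, 1:]) x = evZ (f * q + smult (int p) s) x" by (simp only: assms(1))
  hence "x ^ p - x = of_nat p * (y * evZ q x + evZ s x)" using assms(3) by (simp add: algebra_simps)
  thus ?thesis using assms(2) by (simp add: frob_quot_def)
qed

lemma algebraic_int_divides_integer:
  assumes "algebraic_int e" "e \<noteq> 0"
  obtains c :: nat and q where "c > 0" "of_nat c = e * evZ q e"
proof -
  obtain f where f: "lead_coeff f = 1" "Factorial_Ring.irreducible f" "evQ f e = 0"
    using minimal_polynomial_exists[OF algebraic_int_imp_algebraic[OF assms(1)]] .
  obtain h where h: "f = map_poly of_int h" "lead_coeff h = 1"
    using minimal_polynomial_integral[OF f(2,1,3) assms(1)] .
  obtain c q where cq: "h = pCons c q" by (cases h)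
  have eq: "of_int c + e * evZ q e = 0" using f(3) h(1) cq by simp
  have "c \<noteq> 0"
  proof
    assume "c = 0"
    hence "evZ q e = 0" using eq assms(2) by simp
    hence "f dvd map_poly of_int q" using irreducible_root_dvd[OF f(2,3)] by simp
    moreover have "q \<noteq> 0" using h(2) cq \<open>c = 0\<close> by auto
    ultimately have "degree f \<le> degree q" using dvd_imp_degree_le[of f "map_poly of_int q"] by simp
    thus False using h(1) cq \<open>q \<noteq> 0\<close> by simp
  qed
  have "of_nat (nat \<bar>c\<bar>) = of_int (- sgn c) * (e * evZ q e)"
  proof -
    have "e * evZ q e = - of_int c" using eq by (simp add: eq_neg_iff_add_eq_0 add.commute)
    thus ?thesis by (cases "c \<ge> 0") (auto simp: sgn_if)
  qed
  also have "\<dots> = e * evZ (smult (- sgn c) q) e" by simp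
  finally show ?thesis using \<open>c \<noteq> 0\<close> by (intro that[of "nat \<bar>c\<bar>" "smult (- sgn c) q"]) simp_all
qed

lemma integers_times_different:
  assumes f: "Factorial_Ring.irreducible f" "lead_coeff f = 1" "evQ f \<theta> = 0" and \<theta>: "algebraic_int \<theta>"
    and x: "x \<in> Qadj \<theta>" "algebraic_int x"
  obtains G :: "int poly" where "degree G < degree f" "x * evQ (pderiv f) \<theta> = evZ G \<theta>"
proof -
  obtain g where g: "x = evQ g \<theta>" using x by (auto simp: Qadj_def)
  define Z where "Z = {z. evQ f z = 0}"
  have Z: "finite Z" "card Z = degree f" "map_poly of_rat f = (\<Prod>z\<in>Z. [:-z, 1::complex:])"
    using card_roots_irreducible[OF f(1)] f(2) by (simp_all add: Z_def)
  have int: "algebraic_int w" "algebraic_int (evQ g w)" if "w \<in> Z" for w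
    using conjugate_algebraic_int[OF f(1,3), of w "[:0,1:]"] conjugate_algebraic_int[OF f(1,3), of w g] that \<theta> x g
    by (auto simp: Z_def)
  have pos: "degree f > 0" using irreducible_degree_pos f by blast
  define G where "G = (g * pderiv f) mod f"
  have G: "evQ G w = evQ g w * evQ (pderiv f) w" if "w \<in> Z" for w
  proof -
    have "evQ (g * pderiv f) w = evQ (f * ((g * pderiv f) div f) + G) w" by (simp add: G_def del: evQ_ring)
    thus ?thesis using that by (simp add: Z_def)
  qed
  have dG: "degree G < degree f"
    unfolding G_def using degree_mod_less[of f "g * pderiv f"] pos by (cases "f = 0"; cases "(g * pderiv f) mod f = 0") auto
  define H where "H = (\<Sum>w\<in>Z. smult (evQ g w) (\<Prod>v\<in>Z - {w}. [:-v, 1::complex:]))"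
  have "map_poly of_rat G = H"
  proof (rule poly_eqI_degree[of Z])
    fix u assume u: "u \<in> Z"
    have "poly H u = (\<Sum>w\<in>Z. evQ g w * (\<Prod>v\<in>Z - {w}. u - v))"
      by (simp add: H_def poly_sum poly_prod)
    also have "\<dots> = (\<Sum>w\<in>Z. if w = u then evQ g u * (\<Prod>v\<in>Z - {u}. u - v) else 0)"
      by (intro sum.cong refl) (use u Z in \<open>auto intro!: bexI[of _ u]\<close>)
    also have "\<dots> = evQ g u * (\<Prod>v\<in>Z - {u}. u - v)" using u Z by simp
    also have "(\<Prod>v\<in>Z - {u}. u - v) = evQ (pderiv f) u"
    proof -
      have "map_poly of_rat f = [:-u, 1:] * (\<Prod>v\<in>Z - {u}. [:-v, 1::complex:])"
        unfolding Z(3) by (rule prod.remove) (use u Z in auto)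
      thus ?thesis unfolding evQ_pderiv by (simp only: pderiv_mult poly_add poly_mult) (simp add: poly_prod pderiv_pCons)
    qed
    finally show "poly (map_poly of_rat G) u = poly H u" using G[OF u] by (simp add: evQ_def)
  next
    show "degree (map_poly of_rat G :: complex poly) < card Z" using dG Z by simp
    have "degree (smult (evQ g w) (\<Prod>v\<in>Z - {w}. [:-v, 1::complex:])) < card Z" if "w \<in> Z" for w
    proof -
      have "degree (smult (evQ g w) (\<Prod>v\<in>Z - {w}. [:-v, 1::complex:])) \<le> card (Z - {w})"
        using degree_prod_linear[of "Z - {w}" "\<lambda>v. v"] Z by (intro order.trans[OF degree_smult_le]) simp
      also have "\<dots> < card Z" using that Z by (intro psubset_card_mono) auto
      finally show ?thesis .
    qed
    thus "degree H < card Z" unfolding H_def using pos Z by (intro degree_sum_less) auto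
  qed
  moreover have "algebraic_int (coeff H i)" for i
    unfolding H_def coeff_sum coeff_smult using Z int
    by (intro algebraic_int_sum algebraic_int_mult algebraic_int_coeff_prod) auto
  ultimately have "algebraic_int (of_rat (coeff G i) :: complex)" for i
    by (metis coeff_map_poly of_rat_0)
  then obtain G' where G': "G = map_poly of_int G'" using rat_poly_integral by blast
  have "\<theta> \<in> Z" using f by (simp add: Z_def)
  hence "x * evQ (pderiv f) \<theta> = evZ G' \<theta>" using G[of \<theta>] g G' by simp
  moreover have "degree G' < degree f" using dG G' by simp
  ultimately show ?thesis using that by blast
qed

lemma discriminant_bound:
  assumes f: "Factorial_Ring.irreducible f" "lead_coeff f = 1" "evQ f \<theta> = 0" and \<theta>: "algebraic_int \<theta>"
  obtains D :: nat where "D > 0"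
    "\<And>x. x \<in> Qadj \<theta> \<Longrightarrow> algebraic_int x \<Longrightarrow> \<exists>G. degree G < degree f \<and> of_nat D * x = evZ G \<theta>"
proof -
  have sub: "subfield (Qadj \<theta>) complex_field" using \<theta> by (intro Qadj_subfield algebraic_int_imp_algebraic)
  obtain h where h: "f = map_poly of_int h" "lead_coeff h = 1"
    using minimal_polynomial_integral[OF f \<theta>] .
  define e where "e = evQ (pderiv f) \<theta>"
  have e: "e = evZ (pderiv h) \<theta>" by (simp add: e_def h(1) of_int_hom.map_poly_pderiv[symmetric])
  have "e \<noteq> 0" unfolding e_def using irreducible_imp_simple_roots f by blast
  moreover have ei: "algebraic_int e" unfolding e using \<theta> by (rule algebraic_int_evZ)
  ultimately obtain D q where D: "D > 0" "of_nat D = e * evZ q e" using algebraic_int_divides_integer by blast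
  have "\<exists>G. degree G < degree f \<and> of_nat D * x = evZ G \<theta>" if x: "x \<in> Qadj \<theta>" "algebraic_int x" for x
  proof -
    have ev: "evZ q e = evQ (pcompose (map_poly of_int q) (pderiv f)) \<theta>" by (simp add: e_def)
    have "evZ q e \<in> Qadj \<theta>" unfolding ev by (rule Qadj_evQ)
    hence "x * evZ q e \<in> Qadj \<theta>" using subfield_complexD(4)[OF sub] x by blast
    moreover have "algebraic_int (x * evZ q e)" using x ei by (intro algebraic_int_mult algebraic_int_evZ)
    ultimately obtain G where "degree G < degree f" "(x * evZ q e) * evQ (pderiv f) \<theta> = evZ G \<theta>"
      using integers_times_different[OF f \<theta>] by blast
    thus ?thesis using D(2) by (intro exI[of _ G]) (simp add: e_def mult_ac)
  qed
  thus ?thesis using that D by blast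
qed

lemma power_bound_imp_le:
  fixes q N B :: nat
  assumes "\<And>k. q ^ k \<le> B * N ^ k" "N > 0"
  shows "q \<le> N"
proof (rule ccontr)
  assume "\<not> q \<le> N"
  hence "(1 :: real) < real q / real N" using assms(2) by simp
  then obtain k where k: "real B < (real q / real N) ^ k" using real_arch_pow by blast
  have "real q ^ k \<le> real B * real N ^ k" using assms(1)[of k] by (metis of_nat_le_iff of_nat_mult of_nat_power)
  hence "(real q / real N) ^ k \<le> real B" using assms(2) by (simp add: power_divide divide_le_eq)
  thus False using k by simp
qed

locale number_field_at_prime =
  fixes F :: "complex set" and p :: nat and f :: "rat poly" and \<theta> :: complex
  assumes p: "Factorial_Ring.prime p" and F: "F = Qadj \<theta>" and \<theta>: "algebraic_int \<theta>"
    and f: "Factorial_Ring.irreducible f" "lead_coeff f = 1" "evQ f \<theta> = 0"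
begin

definition "A = {x \<in> F. algebraic_int x}"
definition "n = degree f"
definition pdvd :: "nat \<Rightarrow> complex \<Rightarrow> bool" where "pdvd k x \<longleftrightarrow> (\<exists>a\<in>A. x = of_nat p ^ k * a)"

lemma sub: "subfield F complex_field" using \<theta> unfolding F by (intro Qadj_subfield algebraic_int_imp_algebraic)

lemma A_closure:
  "x \<in> A \<Longrightarrow> y \<in> A \<Longrightarrow> x + y \<in> A" "x \<in> A \<Longrightarrow> y \<in> A \<Longrightarrow> x * y \<in> A" "x \<in> A \<Longrightarrow> y \<in> A \<Longrightarrow> x - y \<in> A"
  "x \<in> A \<Longrightarrow> - x \<in> A" "of_int j \<in> A" "of_nat k \<in> A" "0 \<in> A" "1 \<in> A" "x \<in> A \<Longrightarrow> x ^ m \<in> A"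
  using subfield_complexD(8)[OF sub, of "int k"]
  by (auto simp: A_def subfield_complexD[OF sub] intro: algebraic_int_closure)

lemma A_sum: "(\<And>i. i \<in> I \<Longrightarrow> g i \<in> A) \<Longrightarrow> sum g I \<in> A"
  by (induction I rule: infinite_finite_induct) (auto intro: A_closure)
lemma A_prod: "(\<And>i. i \<in> I \<Longrightarrow> g i \<in> A) \<Longrightarrow> prod g I \<in> A"
  by (induction I rule: infinite_finite_induct) (auto intro: A_closure)
lemma A_evZ: "x \<in> A \<Longrightarrow> evZ g x \<in> A"
  by (induction g) (auto intro: A_closure)
lemma \<theta>_in_A: "\<theta> \<in> A" unfolding A_def using \<theta> by (simp add: F)

lemma p1: "p > 1" using p prime_gt_1_nat by blast
lemma n0: "n > 0" unfolding n_def using f irreducible_degree_pos by blast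

lemma evZ_unique: "degree g < n \<Longrightarrow> evZ g \<theta> = 0 \<Longrightarrow> g = 0"
proof -
  assume "degree g < n" and "evZ g \<theta> = 0"
  hence "f dvd map_poly of_int g" using irreducible_root_dvd[OF f(1,3), of "map_poly of_int g"] by simp
  thus "g = 0" using dvd_imp_degree_le[of f "map_poly of_int g"] \<open>degree g < n\<close> by (auto simp: n_def)
qed

lemma pdvd_simps: "pdvd k x \<Longrightarrow> pdvd k y \<Longrightarrow> pdvd k (x + y)" "pdvd k x \<Longrightarrow> pdvd k y \<Longrightarrow> pdvd k (x - y)"
  "pdvd k x \<Longrightarrow> a \<in> A \<Longrightarrow> pdvd k (a * x)" "a \<in> A \<Longrightarrow> pdvd k (of_nat p ^ k * a)" "pdvd k x \<Longrightarrow> x \<in> A"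
  "pdvd k 0" "pdvd k x \<Longrightarrow> pdvd k (-x)"
proof -
  show "pdvd k x \<Longrightarrow> pdvd k y \<Longrightarrow> pdvd k (x + y)" unfolding pdvd_def by (metis A_closure(1) distrib_left)
  show "pdvd k x \<Longrightarrow> pdvd k y \<Longrightarrow> pdvd k (x - y)" unfolding pdvd_def by (metis A_closure(3) right_diff_distrib)
  show "pdvd k x \<Longrightarrow> a \<in> A \<Longrightarrow> pdvd k (a * x)" unfolding pdvd_def by (metis A_closure(2) mult.left_commute)
  show "a \<in> A \<Longrightarrow> pdvd k (of_nat p ^ k * a)" unfolding pdvd_def by blast
  show "pdvd k x \<Longrightarrow> x \<in> A" unfolding pdvd_def using A_closure(2,6,9) by blast
  show "pdvd k 0" unfolding pdvd_def using A_closure(7) by force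
  show "pdvd k x \<Longrightarrow> pdvd k (-x)" unfolding pdvd_def by (metis A_closure(4) mult_minus_right)
qed

lemma pdvd_shift: "pdvd (Suc k) (of_nat p * x) \<longleftrightarrow> pdvd k x"
  using p1 by (auto simp: pdvd_def)

lemma pdvd_mono: "pdvd (k + j) x \<Longrightarrow> pdvd k x"
  unfolding pdvd_def using A_closure(2,6,9) by (metis mult.assoc power_add of_nat_power)

lemma digits_unique:
  assumes "\<And>t t'. t \<in> T \<Longrightarrow> t' \<in> T \<Longrightarrow> pdvd 1 (t - t') \<Longrightarrow> t = t'" "T \<subseteq> A"
  shows "(\<And>i. i < k \<Longrightarrow> u i \<in> T) \<Longrightarrow> (\<And>i. i < k \<Longrightarrow> u' i \<in> T) \<Longrightarrow>
    pdvd k ((\<Sum>i<k. of_nat p ^ i * u i) - (\<Sum>i<k. of_nat p ^ i * u' i)) \<Longrightarrow> i < k \<Longrightarrow> u i = u' i"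
proof (induction k arbitrary: u u' i)
  case (Suc k)
  define s where "s = (\<Sum>i<k. of_nat p ^ i * u (Suc i))"
  define s' where "s' = (\<Sum>i<k. of_nat p ^ i * u' (Suc i))"
  have split: "(\<Sum>i<Suc k. of_nat p ^ i * w i) = w 0 + of_nat p * (\<Sum>i<k. of_nat p ^ i * w (Suc i))" for w :: "nat \<Rightarrow> complex"
    by (subst sum.lessThan_Suc_shift) (simp add: sum_distrib_left mult_ac)
  have pd: "pdvd (Suc k) ((u 0 - u' 0) + of_nat p * (s - s'))"
    using Suc.prems(3) unfolding split s_def s'_def by (simp add: algebra_simps)
  have sA: "s - s' \<in> A" unfolding s_def s'_def using Suc.prems(1,2) assms(2)
    by (intro A_closure(3) A_sum A_closure(2)[OF A_closure(9)[OF A_closure(6)]]) auto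
  have "pdvd 1 ((u 0 - u' 0) + of_nat p * (s - s'))" using pd pdvd_mono[of 1 k] by simp
  moreover have "pdvd 1 (of_nat p * (s - s'))" using pdvd_simps(4)[OF sA, of 1] by simp
  ultimately have "pdvd 1 (u 0 - u' 0)" using pdvd_simps(2) by fastforce
  hence u0: "u 0 = u' 0" using assms(1) Suc.prems(1,2) by simp
  hence "pdvd k (s - s')" using pd pdvd_shift by simp
  hence "u (Suc i) = u' (Suc i)" if "i < k" for i
    using Suc.IH[of "\<lambda>i. u (Suc i)" "\<lambda>i. u' (Suc i)" i] Suc.prems(1,2) that by (simp add: s_def s'_def)
  thus ?case using u0 Suc.prems(4) by (cases i) auto
qed simp

lemma digits_exist:
  assumes "\<And>x. x \<in> A \<Longrightarrow> \<exists>t\<in>T. pdvd 1 (x - t)" "T \<subseteq> A"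
  shows "x \<in> A \<Longrightarrow> \<exists>u. (\<forall>i<k. u i \<in> T) \<and> pdvd k (x - (\<Sum>i<k. of_nat p ^ i * u i))"
proof (induction k)
  case 0
  thus ?case by (auto simp: pdvd_def)
next
  case (Suc k)
  then obtain u where u: "\<forall>i<k. u i \<in> T" "pdvd k (x - (\<Sum>i<k. of_nat p ^ i * u i))" by blast
  then obtain a where a: "a \<in> A" "x - (\<Sum>i<k. of_nat p ^ i * u i) = of_nat p ^ k * a" by (auto simp: pdvd_def)
  obtain t where t: "t \<in> T" "pdvd 1 (a - t)" using assms(1) a by blast
  then obtain b where b: "b \<in> A" "a - t = of_nat p * b" by (auto simp: pdvd_def)
  have "(\<Sum>i<k. of_nat p ^ i * (u(k := t)) i) = (\<Sum>i<k. of_nat p ^ i * u i)" by (intro sum.cong) auto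
  hence "x - (\<Sum>i<Suc k. of_nat p ^ i * (u(k := t)) i) = of_nat p ^ k * (a - t)"
    using a(2) by (simp add: algebra_simps)
  also have "\<dots> = of_nat p ^ Suc k * b" using b(2) by simp
  finally have "pdvd (Suc k) (x - (\<Sum>i<Suc k. of_nat p ^ i * (u(k := t)) i))" using b(1) unfolding pdvd_def by blast
  moreover have "\<forall>i<Suc k. (u(k := t)) i \<in> T" using u(1) t by (auto simp: less_Suc_eq)
  ultimately show ?case by blast
qed

definition "Dc = (SOME D::nat. D > 0 \<and> (\<forall>x\<in>A. \<exists>G. degree G < n \<and> of_nat D * x = evZ G \<theta>))"
lemma Dc: "Dc > 0" "x \<in> A \<Longrightarrow> \<exists>G. degree G < n \<and> of_nat Dc * x = evZ G \<theta>"
proof -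
  have "\<exists>D::nat. D > 0 \<and> (\<forall>x\<in>A. \<exists>G. degree G < n \<and> of_nat D * x = evZ G \<theta>)"
  proof -
    obtain D :: nat where D: "D > 0" "\<And>x. x \<in> Qadj \<theta> \<Longrightarrow> algebraic_int x \<Longrightarrow> \<exists>G. degree G < degree f \<and> of_nat D * x = evZ G \<theta>"
      using discriminant_bound[OF f \<theta>] by metis
    thus ?thesis unfolding A_def n_def by (auto simp: F)
  qed
  from someI_ex[OF this] show "Dc > 0" "x \<in> A \<Longrightarrow> \<exists>G. degree G < n \<and> of_nat Dc * x = evZ G \<theta>"
    unfolding Dc_def by blast+
qed

lemma pdvd_cancel_Dc:
  assumes "x \<in> A" "pdvd (k + multiplicity p Dc) (of_nat Dc * x)"
  shows "pdvd k x"
proof -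
  define c where "c = multiplicity p Dc"
  obtain D' where D': "Dc = p ^ c * D'" "\<not> p dvd D'"
    using multiplicity_decompose'[of Dc p] Dc(1) p unfolding c_def by (metis not_prime_unit not_less_zero)
  obtain a where a: "a \<in> A" "of_nat Dc * x = of_nat p ^ (k + c) * a" using assms(2) by (auto simp: pdvd_def c_def)
  have "of_nat p ^ c * (of_nat D' * x) = of_nat p ^ c * (of_nat p ^ k * a)"
    using a(2) by (simp add: D'(1) power_add mult_ac)
  hence eq: "of_nat D' * x = of_nat p ^ k * a" using p1 by simp
  have "coprime (int D') (int p ^ k)" using prime_imp_coprime[OF p D'(2)] by (simp add: coprime_commute)
  then obtain u v where "u * int D' + v * int p ^ k = 1" using bezout_int[of "int D'" "int p ^ k"] by (auto simp: coprime_iff_gcd_eq_1)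
  hence "(of_int (u * int D' + v * int p ^ k) :: complex) = 1" by (simp only: of_int_1)
  hence "x = of_int (u * int D' + v * int p ^ k) * x" by simp
  also have "\<dots> = of_int u * (of_nat D' * x) + of_nat p ^ k * (of_int v * x)" by (simp add: algebra_simps)
  also have "\<dots> = of_nat p ^ k * (of_int u * a + of_int v * x)" unfolding eq by (simp add: algebra_simps)
  finally have "x = of_nat p ^ k * (of_int u * a + of_int v * x)" .
  moreover have "of_int u * a + of_int v * x \<in> A" using a(1) assms(1) by (intro A_closure)
  ultimately show ?thesis unfolding pdvd_def by blast
qed

definition poly_of :: "(nat \<Rightarrow> nat) \<Rightarrow> int poly" where "poly_of w = (\<Sum>i<n. monom (int (w i)) i)"

lemma poly_of: "coeff (poly_of w) i = (if i < n then int (w i) else 0)" "degree (poly_of w) < n"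
proof -
  show *: "coeff (poly_of w) i = (if i < n then int (w i) else 0)" for i
    by (simp add: poly_of_def coeff_sum)
  show "degree (poly_of w) < n"
    using * n0 by (metis degree_0 leading_coeff_0_iff)
qed

lemma card_incongruent_le:
  assumes T: "finite T" "T \<subseteq> A" "\<And>t t'. t \<in> T \<Longrightarrow> t' \<in> T \<Longrightarrow> pdvd 1 (t - t') \<Longrightarrow> t = t'"
  shows "card T \<le> p ^ n"
proof (rule power_bound_imp_le[where B = "p ^ (multiplicity p Dc * n)"])
  fix k
  define c where "c = multiplicity p Dc"
  define s where "s = (\<lambda>u. \<Sum>i<k. (of_nat p :: complex) ^ i * u i)"
  have sA: "s u \<in> A" if "u \<in> {..<k} \<rightarrow>\<^sub>E T" for u
    unfolding s_def using that T(2) by (intro A_sum A_closure(2)[OF A_closure(9)[OF A_closure(6)]]) auto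
  define g where "g = (\<lambda>u. SOME G. degree G < n \<and> of_nat Dc * s u = evZ G \<theta>)"
  have g: "degree (g u) < n \<and> of_nat Dc * s u = evZ (g u) \<theta>" if "u \<in> {..<k} \<rightarrow>\<^sub>E T" for u
    unfolding g_def by (rule someI_ex[OF Dc(2)[OF sA[OF that]]])
  define \<Phi> where "\<Phi> = (\<lambda>u. \<lambda>i\<in>{..<n}. nat (coeff (g u) i mod int (p ^ (k + c))))"
  have "card ({..<k} \<rightarrow>\<^sub>E T) \<le> card ({..<n} \<rightarrow>\<^sub>E {..<p ^ (k + c)})"
  proof (rule card_inj_on_le)
    show "finite ({..<n} \<rightarrow>\<^sub>E {..<p ^ (k + c)})" by (intro finite_PiE) auto
    show "\<Phi> ` ({..<k} \<rightarrow>\<^sub>E T) \<subseteq> {..<n} \<rightarrow>\<^sub>E {..<p ^ (k + c)}"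
    proof -
      have "nat (a mod int (p ^ (k + c))) < p ^ (k + c)" for a
        using p1 by (subst nat_less_iff) auto
      thus ?thesis by (auto simp: \<Phi>_def simp del: of_nat_power)
    qed
    show "inj_on \<Phi> ({..<k} \<rightarrow>\<^sub>E T)"
    proof (rule inj_onI)
      fix u u' assume u: "u \<in> {..<k} \<rightarrow>\<^sub>E T" "u' \<in> {..<k} \<rightarrow>\<^sub>E T" "\<Phi> u = \<Phi> u'"
      have "int (p ^ (k + c)) dvd coeff (g u - g u') i" for i
      proof (cases "i < n")
        case True
        hence "nat (coeff (g u) i mod int (p ^ (k + c))) = nat (coeff (g u') i mod int (p ^ (k + c)))"
          using fun_cong[OF u(3), of i] by (simp add: \<Phi>_def)
        hence "coeff (g u) i mod int (p ^ (k + c)) = coeff (g u') i mod int (p ^ (k + c))"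
          using p1 by (subst (asm) nat_eq_iff) auto
        thus ?thesis by (simp add: mod_eq_dvd_iff)
      next
        case False
        thus ?thesis using g[OF u(1)] g[OF u(2)] by (simp add: coeff_eq_0)
      qed
      then obtain r where r: "g u - g u' = smult (int (p ^ (k + c))) r" using poly_dvd_imp_smult by metis
      have "of_nat Dc * (s u - s u') = evZ (g u - g u') \<theta>"
        using g[OF u(1)] g[OF u(2)] by (simp add: algebra_simps)
      also have "\<dots> = of_nat p ^ (k + c) * evZ r \<theta>" unfolding r by simp
      finally have "pdvd (k + c) (of_nat Dc * (s u - s u'))"
        using A_evZ[OF \<theta>_in_A] unfolding pdvd_def by blast
      hence "pdvd k (s u - s u')" using pdvd_cancel_Dc A_closure(3)[OF sA sA] u(1,2) unfolding c_def by blast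
      hence "u i = u' i" if "i < k" for i
        using digits_unique[OF T(3,2), of k u u' i] u(1,2) that by (auto simp: s_def)
      thus "u = u'" using u(1,2) by (intro PiE_ext) auto
    qed
  qed
  hence "card T ^ k \<le> (p ^ (k + c)) ^ n" by (simp add: card_PiE)
  also have "\<dots> = p ^ (c * n) * (p ^ n) ^ k" by (simp add: power_add power_mult_distrib power_mult[symmetric] mult.commute)
  finally show "card T ^ k \<le> p ^ (multiplicity p Dc * n) * (p ^ n) ^ k" unfolding c_def .
qed (use p1 in simp)

lemma card_representatives_ge:
  assumes T: "finite T" "T \<subseteq> A" "\<And>x. x \<in> A \<Longrightarrow> \<exists>t\<in>T. pdvd 1 (x - t)"
  shows "p ^ n \<le> card T"
proof (rule power_bound_imp_le[where B = "card T ^ multiplicity p Dc"])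
  fix k
  define c where "c = multiplicity p Dc"
  define s where "s = (\<lambda>u. \<Sum>i<k+c. (of_nat p :: complex) ^ i * u i)"
  define x where "x = (\<lambda>w. evZ (poly_of w) \<theta>)"
  have xA: "x w \<in> A" for w unfolding x_def by (rule A_evZ[OF \<theta>_in_A])
  have "\<exists>u. u \<in> {..<k+c} \<rightarrow>\<^sub>E T \<and> pdvd (k + c) (x w - s u)" for w
  proof -
    obtain u where u: "\<forall>i<k+c. u i \<in> T" "pdvd (k+c) (x w - s u)"
      using digits_exist[OF T(3,2) xA[of w], of "k+c"] by (auto simp: s_def)
    have "s (restrict u {..<k+c}) = s u" by (simp add: s_def)
    thus ?thesis using u by (intro exI[of _ "restrict u {..<k+c}"]) auto
  qed
  then obtain \<Psi> where \<Psi>: "\<And>w. \<Psi> w \<in> {..<k+c} \<rightarrow>\<^sub>E T" "\<And>w. pdvd (k + c) (x w - s (\<Psi> w))" by metis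
  have "card ({..<n} \<rightarrow>\<^sub>E {..<p ^ k}) \<le> card ({..<k+c} \<rightarrow>\<^sub>E T)"
  proof (rule card_inj_on_le)
    show "finite ({..<k+c} \<rightarrow>\<^sub>E T)" using T by (intro finite_PiE) auto
    show "\<Psi> ` ({..<n} \<rightarrow>\<^sub>E {..<p ^ k}) \<subseteq> {..<k+c} \<rightarrow>\<^sub>E T" using \<Psi> by blast
    show "inj_on \<Psi> ({..<n} \<rightarrow>\<^sub>E {..<p ^ k})"
    proof (rule inj_onI)
      fix w w' assume w: "w \<in> {..<n} \<rightarrow>\<^sub>E {..<p ^ k}" "w' \<in> {..<n} \<rightarrow>\<^sub>E {..<p ^ k}" "\<Psi> w = \<Psi> w'"
      have "pdvd (k + c) ((x w - s (\<Psi> w)) - (x w' - s (\<Psi> w')))" by (rule pdvd_simps(2)[OF \<Psi>(2) \<Psi>(2)])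
      hence "pdvd (k + c) (x w - x w')" using w(3) by simp
      then obtain a where a: "a \<in> A" "x w - x w' = of_nat p ^ (k + c) * a" by (auto simp: pdvd_def)
      obtain r where r: "degree r < n" "of_nat Dc * a = evZ r \<theta>" using Dc(2)[OF a(1)] by blast
      define d where "d = smult (int Dc) (poly_of w - poly_of w') - smult (int p ^ (k + c)) r"
      have "evZ d \<theta> = of_nat Dc * (x w - x w') - of_nat p ^ (k + c) * evZ r \<theta>"
        by (simp add: d_def x_def)
      also have "\<dots> = 0" unfolding a(2) r(2)[symmetric] by simp
      finally have "evZ d \<theta> = 0" .
      moreover have "degree d < n" unfolding d_def using poly_of(2) r(1)
        by (intro degree_diff_less degree_smult_le[THEN le_less_trans])
      ultimately have "d = 0" using evZ_unique by blast
      have "w i = w' i" if i: "i < n" for i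
      proof -
        have "coeff d i = 0" using \<open>d = 0\<close> by simp
        hence eq: "int Dc * (int (w i) - int (w' i)) = int p ^ (k + c) * coeff r i"
          using i by (simp add: d_def poly_of)
        obtain D' where D': "Dc = p ^ c * D'" "\<not> p dvd D'"
          using multiplicity_decompose'[of Dc p] Dc(1) p unfolding c_def by (metis not_prime_unit not_less_zero)
        have "int p ^ c * (int D' * (int (w i) - int (w' i))) = int p ^ c * (int p ^ k * coeff r i)"
          using eq by (simp add: D'(1) power_add mult_ac)
        hence "int D' * (int (w i) - int (w' i)) = int p ^ k * coeff r i" using p1 by simp
        hence "int p ^ k dvd int D' * (int (w i) - int (w' i))" by simp
        moreover have "coprime (int p ^ k) (int D')" using prime_imp_coprime[OF p D'(2)] by simp
        ultimately have "int p ^ k dvd int (w i) - int (w' i)" using coprime_dvd_mult_right_iff by blast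
        hence "int (w i) mod int p ^ k = int (w' i) mod int p ^ k" by (simp add: mod_eq_dvd_iff)
        moreover have "w i < p ^ k" "w' i < p ^ k" using w(1,2) i by auto
        hence "int (w i) < int p ^ k" "int (w' i) < int p ^ k" by (metis of_nat_less_iff of_nat_power)+
        ultimately show ?thesis by simp
      qed
      thus "w = w'" using w(1,2) by (intro PiE_ext) auto
    qed
  qed
  hence "(p ^ k) ^ n \<le> card T ^ (k + c)" by (simp add: card_PiE)
  thus "(p ^ n) ^ k \<le> card T ^ multiplicity p Dc * card T ^ k"
    by (simp add: c_def power_add power_mult[symmetric] mult.commute)
next
  show "card T > 0" using T(1,3) A_closure(7) card_gt_0_iff by blast
qed

end

locale frobenius_trivial_at_prime = number_field_at_prime +
  assumes frob: "x \<in> A \<Longrightarrow> algebraic_int (frob_quot p x)"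
begin

definition "R = ring_of_integers F"

lemma R_simps: "carrier R = A" "x \<otimes>\<^bsub>R\<^esub> y = x * y" "x \<oplus>\<^bsub>R\<^esub> y = x + y" "\<one>\<^bsub>R\<^esub> = 1" "\<zero>\<^bsub>R\<^esub> = 0"
  by (simp_all add: R_def ring_of_integers_def A_def ring_of_type_algebra_def)

lemma cring_R: "cring R"
proof -
  have "subring A complex_field" by (rule CF.subringI) (auto intro: A_closure)
  hence "subcring A complex_field" by (rule CF.subcringI') 
  hence "cring (complex_field \<lparr>carrier := A\<rparr>)" by (subst (asm) CF.subcring_iff) auto
  thus ?thesis by (simp add: R_def ring_of_integers_def A_def)
qed

sublocale R: cring R by (rule cring_R)

definition idl :: "complex set \<Rightarrow> bool" where
  "idl J \<longleftrightarrow> J \<subseteq> A \<and> 0 \<in> J \<and> (\<forall>x\<in>J. \<forall>y\<in>J. x + y \<in> J) \<and> (\<forall>a\<in>A. \<forall>x\<in>J. a * x \<in> J)"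

lemma idlD: "idl J \<Longrightarrow> x \<in> J \<Longrightarrow> x \<in> A" "idl J \<Longrightarrow> 0 \<in> J" "idl J \<Longrightarrow> x \<in> J \<Longrightarrow> y \<in> J \<Longrightarrow> x + y \<in> J"
   "idl J \<Longrightarrow> a \<in> A \<Longrightarrow> x \<in> J \<Longrightarrow> a * x \<in> J" "idl J \<Longrightarrow> a \<in> A \<Longrightarrow> x \<in> J \<Longrightarrow> x * a \<in> J"
  by (auto simp: idl_def mult.commute)
lemma idl_minus: "idl J \<Longrightarrow> x \<in> J \<Longrightarrow> - x \<in> J"
  using idlD(4)[of J "-1" x] A_closure(5)[of "-1"] by simp
lemma idl_diff: "idl J \<Longrightarrow> x \<in> J \<Longrightarrow> y \<in> J \<Longrightarrow> x - y \<in> J"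
  using idlD(3)[of J x "-y"] idl_minus by simp
lemma idl_sum: "idl J \<Longrightarrow> (\<And>i. i \<in> I \<Longrightarrow> g i \<in> J) \<Longrightarrow> sum g I \<in> J"
  by (induction I rule: infinite_finite_induct) (auto intro: idlD)

lemma R_a_inv: "x \<in> A \<Longrightarrow> \<ominus>\<^bsub>R\<^esub> x = - x"
  using R.minus_equality[of "-x" x] A_closure(4)[of x] by (simp add: R_simps)

lemma ideal_idl: "idl J \<Longrightarrow> ideal J R"
proof (rule idealI)
  assume J: "idl J"
  show "subgroup J (add_monoid R)"
  proof (rule R.add.subgroupI)
    fix a assume a: "a \<in> J"
    hence "\<ominus>\<^bsub>R\<^esub> a = - a" using R_a_inv idlD(1)[OF J] by simp
    thus "\<ominus>\<^bsub>R\<^esub> a \<in> J" using idl_minus[OF J a] by simp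
  qed (use J in \<open>auto simp: R_simps idlD\<close>, use J in \<open>auto simp: idl_def\<close>)
qed (auto simp: R_simps R.ring_axioms idlD)

definition primes :: "complex set set" where
  "primes = {J. idl J \<and> 1 \<notin> J \<and> (\<forall>a\<in>A. \<forall>b\<in>A. a * b \<in> J \<longrightarrow> a \<in> J \<or> b \<in> J) \<and> of_nat p \<in> J}"

lemma primesD: 
  assumes "J \<in> primes"
  shows "idl J" "1 \<notin> J" "\<And>a b. a \<in> A \<Longrightarrow> b \<in> A \<Longrightarrow> a * b \<in> J \<Longrightarrow> a \<in> J \<or> b \<in> J" "of_nat p \<in> J" "pdvd 1 x \<Longrightarrow> x \<in> J"
proof -
  show i: "idl J" "1 \<notin> J" "\<And>a b. a \<in> A \<Longrightarrow> b \<in> A \<Longrightarrow> a * b \<in> J \<Longrightarrow> a \<in> J \<or> b \<in> J" and pj: "of_nat p \<in> J"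
    using assms by (auto simp: primes_def)
  show "pdvd 1 x \<Longrightarrow> x \<in> J" using idlD(5)[OF i(1) _ pj] by (auto simp: pdvd_def)
qed

lemma primeideal_primes: "J \<in> primes \<Longrightarrow> primeideal J R"
proof (rule primeidealI)
  assume J: "J \<in> primes"
  show "ideal J R" using ideal_idl primesD(1)[OF J] .
  show "carrier R \<noteq> J" using primesD(2)[OF J] A_closure(8) by (auto simp: R_simps)
  show "a \<in> J \<or> b \<in> J" if "a \<in> carrier R" "b \<in> carrier R" "a \<otimes>\<^bsub>R\<^esub> b \<in> J" for a b
    using primesD(3)[OF J] that by (simp add: R_simps)
qed (rule cring_R)

lemma frob_cong: "x \<in> A \<Longrightarrow> pdvd 1 (x ^ p - x)"
proof -
  assume x: "x \<in> A"
  have "frob_quot p x = of_rat (1 / of_nat p) * (x ^ p - x)"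
    using p1 by (simp add: frob_quot_def of_rat_divide)
  also have "\<dots> \<in> F" using x by (intro subfield_complexD(4)[OF sub] subfield_complexD(9)[OF sub] subfield_complexD(6)[OF sub] subfield_complexD(10)[OF sub]) (auto simp: A_def)
  finally have "frob_quot p x \<in> A" using frob[OF x] by (simp add: A_def)
  moreover have "x ^ p - x = of_nat p ^ 1 * frob_quot p x" using p1 by (simp add: frob_quot_def)
  ultimately show ?thesis unfolding pdvd_def by blast
qed

lemma mult_power_pred: "x * (x ^ (p - 1) - 1) = x ^ p - (x::complex)"
  using p1 by (cases p) (auto simp: algebra_simps)

lemma primes_unit_power:
  assumes "J \<in> primes" "x \<in> A" "x \<notin> J"
  shows "x ^ (p - 1) - 1 \<in> J"
proof -
  have "x * (x ^ (p - 1) - 1) \<in> J" unfolding mult_power_pred using primesD(5)[OF assms(1)] frob_cong[OF assms(2)] .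
  moreover have "x ^ (p - 1) - 1 \<in> A" by (rule A_closure(3)[OF A_closure(9)[OF assms(2)] A_closure(8)])
  ultimately show ?thesis using primesD(3)[OF assms(1,2)] assms(3) by blast
qed

lemma primes_power: "J \<in> primes \<Longrightarrow> x \<in> J \<Longrightarrow> x ^ (p - 1) \<in> J"
proof -
  assume J: "J \<in> primes" "x \<in> J"
  have "x ^ (p - 1) = x * x ^ (p - 2)" using p1 power_Suc[of x "p - 2"] by (simp add: Suc_diff_Suc numeral_2_eq_2)
  thus ?thesis using idlD(5)[OF primesD(1)[OF J(1)] _ J(2)] A_closure(9) idlD(1)[OF primesD(1)[OF J(1)] J(2)] by metis
qed

lemma primes_separate:
  assumes x: "x \<in> A" "\<not> pdvd 1 x"
  obtains J where "J \<in> primes" "x \<notin> J"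
proof -
  define e where "e = x ^ (p - 1)"
  have eA: "e \<in> A" using x A_closure by (simp add: e_def)
  have idem: "pdvd 1 (e * e - e)"
  proof -
    have "e * e - e = x ^ (p - 2) * (x ^ p - x)"
    proof -
      have "p - 1 + (p - 1) = (p - 2) + p" "p - 1 = (p - 2) + 1" using p1 by auto
      hence "x ^ (p - 1) * x ^ (p - 1) = x ^ (p - 2) * x ^ p" "x ^ (p - 1) = x ^ (p - 2) * x"
        by (metis power_add, metis power_add power_one_right)
      thus ?thesis by (simp add: e_def algebra_simps)
    qed
    thus ?thesis using pdvd_simps(3)[OF frob_cong[OF x(1)]] A_closure(9)[OF x(1)] by metis
  qed
  have ne: "\<not> pdvd 1 e"
  proof
    assume "pdvd 1 e"
    hence "pdvd 1 (x * e - (x ^ p - x))" using pdvd_simps(2,3) frob_cong x by blast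
    moreover have "x * e - (x ^ p - x) = x" using mult_power_pred[of x] by (simp add: e_def algebra_simps)
    ultimately show False using x by simp
  qed
  define \<A> where "\<A> = {J. idl J \<and> of_nat p \<in> J \<and> e \<notin> J}"
  have "{z. pdvd 1 z} \<in> \<A>"
  proof -
    have "idl {z. pdvd 1 z}" unfolding idl_def by (auto intro: pdvd_simps(1,3,5,6))
    moreover have "pdvd 1 (of_nat p)" using pdvd_simps(4)[OF A_closure(8), of 1] by simp
    ultimately show ?thesis using ne by (simp add: \<A>_def)
  qed
  hence "\<exists>M\<in>\<A>. \<forall>U\<in>\<A>. M \<subseteq> U \<longrightarrow> U = M"
  proof (intro subset_Zorn_nonempty)
    fix C assume C: "C \<noteq> {}" "subset.chain \<A> C"
    have CA: "J \<in> \<A>" if "J \<in> C" for J using C(2) that by (auto simp: subset.chain_def)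
    have "idl (\<Union>C)" unfolding idl_def
    proof (intro conjI ballI)
      show "\<Union>C \<subseteq> A" using CA idlD(1) unfolding \<A>_def by blast
      show "0 \<in> \<Union>C" using CA C(1) idlD(2) unfolding \<A>_def by blast
      fix x y assume xy: "x \<in> \<Union>C" "y \<in> \<Union>C"
      then obtain I J where IJ: "I \<in> C" "x \<in> I" "J \<in> C" "y \<in> J" by blast
      have "I \<subseteq> J \<or> J \<subseteq> I" using C(2) IJ(1,3) by (auto simp: subset.chain_def)
      then obtain K where "K \<in> C" "x \<in> K" "y \<in> K" using IJ by blast
      thus "x + y \<in> \<Union>C" using CA idlD(3) unfolding \<A>_def by blast
    next
      fix a x assume "a \<in> A" "x \<in> \<Union>C"
      thus "a * x \<in> \<Union>C" using CA idlD(4) unfolding \<A>_def by blast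
    qed
    moreover have "of_nat p \<in> \<Union>C" using CA C(1) by (auto simp: \<A>_def)
    moreover have "e \<notin> \<Union>C" using CA by (auto simp: \<A>_def)
    ultimately show "\<Union>C \<in> \<A>" by (simp add: \<A>_def)
  qed blast
  then obtain J where J: "J \<in> \<A>" and max: "\<And>U. U \<in> \<A> \<Longrightarrow> J \<subseteq> U \<Longrightarrow> U = J" by blast
  have iJ: "idl J" and pJ: "of_nat p \<in> J" and eJ: "e \<notin> J" using J by (auto simp: \<A>_def)
  have pdJ: "z \<in> J" if "pdvd 1 z" for z using that idlD(5)[OF iJ _ pJ] by (auto simp: pdvd_def)
  have gen: "\<exists>j\<in>J. \<exists>u\<in>A. e = j + a * u" if a: "a \<in> A" "a \<notin> J" for a
  proof (rule ccontr)
    assume nex: "\<not> (\<exists>j\<in>J. \<exists>u\<in>A. e = j + a * u)"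
    define U where "U = {j + a * u | j u. j \<in> J \<and> u \<in> A}"
    have sub: "J \<subseteq> U"
    proof
      fix j assume "j \<in> J"
      moreover have "j = j + a * 0" by simp
      ultimately show "j \<in> U" unfolding U_def using A_closure(7) by blast
    qed
    have "idl U" unfolding idl_def
    proof (intro conjI ballI)
      show "U \<subseteq> A" using a idlD(1)[OF iJ] by (auto simp: U_def intro!: A_closure)
      show "0 \<in> U" using sub idlD(2)[OF iJ] by blast
      fix x y assume "x \<in> U" "y \<in> U"
      then obtain j u j' u' where *: "x = j + a * u" "y = j' + a * u'" "j \<in> J" "j' \<in> J" "u \<in> A" "u' \<in> A" by (auto simp: U_def)
      have "x + y = (j + j') + a * (u + u')" using * by (simp add: algebra_simps)
      thus "x + y \<in> U" unfolding U_def using * idlD(3)[OF iJ] A_closure(1) by blast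
    next
      fix b x assume b: "b \<in> A" and "x \<in> U"
      then obtain j u where *: "x = j + a * u" "j \<in> J" "u \<in> A" by (auto simp: U_def)
      have "b * x = b * j + a * (b * u)" using * by (simp add: algebra_simps)
      thus "b * x \<in> U" unfolding U_def using * idlD(4)[OF iJ] A_closure(2) b by blast
    qed
    moreover have "e \<notin> U" using nex by (auto simp: U_def)
    ultimately have "U \<in> \<A>" using sub pJ by (auto simp: \<A>_def)
    hence "U = J" using max sub by blast
    moreover have "0 + a * 1 \<in> U" unfolding U_def using idlD(2)[OF iJ] A_closure(8) by blast
    ultimately show False using a by simp
  qed
  have "a \<in> J \<or> b \<in> J" if ab: "a \<in> A" "b \<in> A" "a * b \<in> J" for a b
  proof (rule ccontr)
    assume "\<not> (a \<in> J \<or> b \<in> J)"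
    then obtain j u j' u' where *: "j \<in> J" "u \<in> A" "e = j + a * u" "j' \<in> J" "u' \<in> A" "e = j' + b * u'"
      using gen ab by metis
    have "e * e = (j + a * u) * e" by (simp only: *(3)[symmetric])
    also have "\<dots> = j * e + (a * u) * (j' + b * u')" by (simp only: distrib_right *(6)[symmetric])
    also have "\<dots> = j * e + (a * u) * j' + (a * b) * (u * u')" by (simp add: algebra_simps)
    finally have "e * e = j * e + (a * u) * j' + (a * b) * (u * u')" .
    moreover have "j * e \<in> J" using idlD(5)[OF iJ eA] * by blast
    moreover have "(a * u) * j' \<in> J" using idlD(4)[OF iJ A_closure(2)] * ab by blast
    moreover have "(a * b) * (u * u') \<in> J" using idlD(5)[OF iJ A_closure(2)] * ab by blast
    ultimately have "e * e \<in> J" using idlD(3)[OF iJ] by simp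
    hence "e * e - (e * e - e) \<in> J" using idl_diff[OF iJ _ pdJ[OF idem]] by blast
    thus False using eJ by simp
  qed
  moreover have "1 \<notin> J" using eJ idlD(4)[OF iJ eA, of 1] by auto
  ultimately have Jp: "J \<in> primes" using iJ pJ by (auto simp: primes_def)
  moreover have "x \<notin> J" using primes_power[OF Jp] eJ by (auto simp: e_def)
  ultimately show ?thesis by (rule that)
qed

lemma primes_prod_mem:
  assumes "J \<in> primes" "finite S" "\<And>c. c \<in> S \<Longrightarrow> g c \<in> A" "prod g S \<in> J"
  shows "\<exists>c\<in>S. g c \<in> J"
  using assms(2-4)
proof (induction S rule: finite_induct)
  case empty
  thus ?case using primesD(2)[OF assms(1)] by simp
next
  case (insert c S)
  hence "g c * prod g S \<in> J" by simp
  hence "g c \<in> J \<or> prod g S \<in> J" using primesD(3)[OF assms(1)] insert.prems(1) A_prod[of S g] by auto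
  thus ?case using insert by blast
qed

lemma primes_residue:
  assumes J: "J \<in> primes" and x: "x \<in> A"
  shows "\<exists>c<p. x - of_nat c \<in> J"
proof -
  obtain s where s: "[:0, 1:] ^ p - [:0, 1:] = (\<Prod>c<p. [:- int c, 1:]) + smult (int p) s"
    using frobenius_poly_factorization[OF p] .
  have "evZ ([:0, 1:] ^ p - [:0, 1:]) x = evZ ((\<Prod>c<p. [:- int c, 1:]) + smult (int p) s) x" by (simp only: s)
  hence "(\<Prod>c<p. x - of_nat c) = (x ^ p - x) - of_nat p * evZ s x" by (simp add: algebra_simps)
  also have "\<dots> \<in> J" using primesD(5)[OF J frob_cong[OF x]] idlD(5)[OF primesD(1)[OF J] A_evZ[OF x] primesD(4)[OF J]]
    by (rule idl_diff[OF primesD(1)[OF J]])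
  finally have "\<exists>c\<in>{..<p}. x - of_nat c \<in> J" using x by (intro primes_prod_mem[OF J]) (auto intro: A_closure)
  thus ?thesis by blast
qed

lemma primes_residue_unique:
  assumes J: "J \<in> primes" and "c < p" "d < p" "of_nat c - of_nat d \<in> J"
  shows "c = d"
proof (rule ccontr)
  assume "c \<noteq> d"
  have *: False if "a < b" "b < p" "of_nat b - of_nat a \<in> J" for a b
  proof -
    have "\<not> p dvd b - a" using that by (auto dest: dvd_imp_le)
    hence "coprime p (b - a)" using prime_imp_coprime[OF p] by blast
    hence "coprime (int (b - a)) (int p)" by (subst coprime_commute) (simp only: coprime_int_iff)
    then obtain u v where uv: "u * int (b - a) + v * int p = 1" using bezout_int[of "int (b - a)" "int p"] by (auto simp: coprime_iff_gcd_eq_1)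
    have "(of_int (u * int (b - a) + v * int p) :: complex) = 1" unfolding uv by simp
    hence "of_int u * (of_nat b - of_nat a) + of_int v * of_nat p = (1::complex)" using that by (simp add: of_nat_diff)
    moreover have "of_int u * (of_nat b - of_nat a) + of_int v * of_nat p \<in> J"
      using that primesD(4)[OF J] A_closure(5) by (intro idlD(3,4)[OF primesD(1)[OF J]])
    ultimately show False using primesD(2)[OF J] by simp
  qed
  have "of_nat d - of_nat c \<in> J" using idl_minus[OF primesD(1)[OF J] assms(4)] by simp
  thus False using *[of c d] *[of d c] assms \<open>c \<noteq> d\<close> by (cases "c < d") auto
qed

lemma primes_comaximal:
  assumes "I \<in> primes" "J \<in> primes" "I \<noteq> J"
  shows "\<exists>u\<in>J. u - 1 \<in> I"
proof -
  note i = primesD(1)[OF assms(1)] and j = primesD(1)[OF assms(2)]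
  consider x where "x \<in> J" "x \<notin> I" | x where "x \<in> I" "x \<notin> J" using assms(3) by blast
  thus ?thesis
  proof cases
    case 1
    hence "x ^ (p - 1) \<in> J" "x ^ (p - 1) - 1 \<in> I"
      using primes_power[OF assms(2)] primes_unit_power[OF assms(1)] idlD(1)[OF j] by blast+
    thus ?thesis by blast
  next
    case 2
    hence "x ^ (p - 1) \<in> I" "x ^ (p - 1) - 1 \<in> J"
      using primes_power[OF assms(1)] primes_unit_power[OF assms(2)] idlD(1)[OF i] by blast+
    hence "- (x ^ (p - 1)) \<in> I" "- (x ^ (p - 1) - 1) \<in> J" using idl_minus i j by blast+
    thus ?thesis by (intro bexI[of _ "- (x ^ (p - 1) - 1)"]) auto
  qed
qed

lemma primes_idempotent:
  assumes "finite Q" "Q \<subseteq> primes" "I \<in> primes" "I \<notin> Q"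
  shows "\<exists>e\<in>A. e - 1 \<in> I \<and> (\<forall>J\<in>Q. e \<in> J)"
  using assms
proof (induction Q rule: finite_induct)
  case empty
  thus ?case using A_closure(8) idlD(2)[OF primesD(1)] by (intro bexI[of _ 1]) auto
next
  case (insert J Q)
  then obtain e where e: "e \<in> A" "e - 1 \<in> I" "\<forall>J\<in>Q. e \<in> J" by auto
  obtain u where u: "u \<in> J" "u - 1 \<in> I" using primes_comaximal[of I J] insert.prems by auto
  have J: "idl J" and I: "idl I" using insert.prems primesD(1) by auto
  have uA: "u \<in> A" using idlD(1)[OF J u(1)] .
  have "u * e - 1 = u * (e - 1) + (u - 1)" by (simp add: algebra_simps)
  hence "u * e - 1 \<in> I" using idlD(3,4)[OF I] u e uA by metis
  moreover have "u * e \<in> J" using idlD(5)[OF J e(1) u(1)] .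
  moreover have "u * e \<in> K" if "K \<in> Q" for K using idlD(4)[OF primesD(1) uA] insert.prems e(3) that by auto
  ultimately show ?case using A_closure(2)[OF uA e(1)] by blast
qed

lemma finite_primes_representatives:
  assumes Q: "finite Q" "Q \<subseteq> primes"
  obtains \<tau> :: "(complex set \<Rightarrow> nat) \<Rightarrow> complex" where
    "\<And>c. \<tau> c \<in> A" "\<And>c J. J \<in> Q \<Longrightarrow> \<tau> c - of_nat (c J) \<in> J"
proof -
  have "\<exists>e. e \<in> A \<and> e - 1 \<in> I \<and> (\<forall>J\<in>Q - {I}. e \<in> J)" if "I \<in> Q" for I
    using primes_idempotent[of "Q - {I}" I] that Q by blast
  then obtain e where e: "\<And>I. I \<in> Q \<Longrightarrow> e I \<in> A" "\<And>I. I \<in> Q \<Longrightarrow> e I - 1 \<in> I"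
    "\<And>I J. I \<in> Q \<Longrightarrow> J \<in> Q \<Longrightarrow> J \<noteq> I \<Longrightarrow> e I \<in> J" by (metis DiffI singletonD)
  define \<tau> where "\<tau> = (\<lambda>c :: complex set \<Rightarrow> nat. \<Sum>I\<in>Q. of_nat (c I) * e I)"
  show ?thesis
  proof (rule that)
    show "\<tau> c \<in> A" for c unfolding \<tau>_def using e(1) by (intro A_sum A_closure(2) A_closure(6))
    fix c J assume J: "J \<in> Q"
    have iJ: "idl J" using primesD(1) J Q by blast
    have "\<tau> c - of_nat (c J) = (\<Sum>I\<in>Q - {J}. of_nat (c I) * e I) + of_nat (c J) * (e J - 1)"
      unfolding \<tau>_def using Q J by (simp add: sum.remove[of Q J] algebra_simps)
    also have "\<dots> \<in> J"
      by (intro idlD(3)[OF iJ] idl_sum[OF iJ] idlD(4)[OF iJ] A_closure(6)) (use e J in auto)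
    finally show "\<tau> c - of_nat (c J) \<in> J" .
  qed
qed

lemma card_primes_le: "finite Q \<Longrightarrow> Q \<subseteq> primes \<Longrightarrow> card Q \<le> n"
proof -
  assume Q: "finite Q" "Q \<subseteq> primes"
  obtain \<tau> where \<tau>: "\<And>c. \<tau> c \<in> A" "\<And>c J. J \<in> Q \<Longrightarrow> \<tau> c - of_nat (c J) \<in> J"
    using finite_primes_representatives[OF Q] by blast
  define C where "C = Q \<rightarrow>\<^sub>E {..<p}"
  have fin: "finite C" unfolding C_def using Q by (intro finite_PiE) auto
  have uniq: "c = d" if cd: "c \<in> C" "d \<in> C" "pdvd 1 (\<tau> c - \<tau> d)" for c d
  proof -
    have "c J = d J" if J: "J \<in> Q" for J
    proof -
      have JP: "J \<in> primes" and iJ: "idl J" using J Q primesD(1) by auto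
      have "(\<tau> c - \<tau> d) - (\<tau> c - of_nat (c J)) + (\<tau> d - of_nat (d J)) \<in> J"
        by (rule idlD(3)[OF iJ idl_diff[OF iJ primesD(5)[OF JP cd(3)] \<tau>(2)[OF J]] \<tau>(2)[OF J]])
      hence "of_nat (c J) - of_nat (d J) \<in> J" by simp
      thus ?thesis using primes_residue_unique[OF JP] cd(1,2) J by (auto simp: C_def PiE_iff)
    qed
    thus ?thesis using cd(1,2) unfolding C_def by (intro PiE_ext) auto
  qed
  have "inj_on \<tau> C" using uniq pdvd_simps(6) by (intro inj_onI) auto
  hence "p ^ card Q = card (\<tau> ` C)" using Q by (simp add: card_image C_def card_PiE)
  also have "\<dots> \<le> p ^ n" using \<tau>(1) uniq fin by (intro card_incongruent_le) auto
  finally show "card Q \<le> n" using p1 by simp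
qed

lemma finite_primes: "finite primes"
  using finite_if_finite_subsets_card_bdd[of primes n] card_primes_le by blast

lemma Inter_primes: "x \<in> A \<Longrightarrow> (\<And>J. J \<in> primes \<Longrightarrow> x \<in> J) \<Longrightarrow> pdvd 1 x"
  using primes_separate by blast

lemma card_primes: "card primes = n"
proof (rule antisym)
  show "card primes \<le> n" using card_primes_le finite_primes by blast
  obtain \<tau> where \<tau>: "\<And>c. \<tau> c \<in> A" "\<And>c J. J \<in> primes \<Longrightarrow> \<tau> c - of_nat (c J) \<in> J"
    using finite_primes_representatives[OF finite_primes order.refl] by blast
  define C where "C = primes \<rightarrow>\<^sub>E {..<p}"
  have fin: "finite C" unfolding C_def using finite_primes by (intro finite_PiE) auto
  have "p ^ n \<le> card (\<tau> ` C)"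
  proof (rule card_representatives_ge)
    fix x assume x: "x \<in> A"
    obtain c where c: "\<And>J. J \<in> primes \<Longrightarrow> c J < p \<and> x - of_nat (c J) \<in> J" using primes_residue[OF _ x] by metis
    define d where "d = restrict c primes"
    have "pdvd 1 (x - \<tau> d)"
    proof (rule Inter_primes)
      show "x - \<tau> d \<in> A" using x \<tau>(1) A_closure(3) by blast
      fix J assume J: "J \<in> primes"
      have "(x - of_nat (c J)) - (\<tau> d - of_nat (d J)) \<in> J"
        using c[OF J] by (intro idl_diff[OF primesD(1)[OF J] _ \<tau>(2)[OF J]]) auto
      thus "x - \<tau> d \<in> J" using J by (simp add: d_def)
    qed
    moreover have "d \<in> C" using c by (auto simp: C_def d_def)
    ultimately show "\<exists>t\<in>\<tau> ` C. pdvd 1 (x - t)" by blast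
  qed (use \<tau>(1) fin in auto)
  also have "\<dots> \<le> card C" using fin by (rule card_image_le)
  also have "\<dots> = p ^ card primes" using finite_primes by (simp add: C_def card_PiE)
  finally show "n \<le> card primes" using p1 by simp
qed

lemma prod_primes: "(\<Otimes>\<^bsub>ideals_set R\<^esub>J\<in>primes. J) = PIdl\<^bsub>R\<^esub> (of_nat p)"
proof -
  interpret ISet: comm_monoid "ideals_set R" by (rule R.ideals_set_is_comm_monoid)
  have ne: "card primes > 0" using card_primes n0 by simp
  define m where "m = card primes - 1"
  obtain g where "bij_betw g {0..<card primes} primes" using ex_bij_betw_nat_finite[OF finite_primes] by blast
  moreover have "{0..<card primes} = {..m}" using ne by (auto simp: m_def)
  ultimately have g: "bij_betw g {..m} primes" by simp
  hence gP: "g i \<in> primes" if "i \<le> m" for i using that by (auto simp: bij_betw_def)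
  have "(\<Otimes>\<^bsub>ideals_set R\<^esub>J\<in>primes. J) = (\<Otimes>\<^bsub>ideals_set R\<^esub>J\<in>g ` {..m}. J)"
    using g by (simp add: bij_betw_def)
  also have "\<dots> = (\<Otimes>\<^bsub>ideals_set R\<^esub>i\<in>{..m}. g i)"
    using g gP ideal_idl primesD(1) by (intro ISet.finprod_reindex) (auto simp: bij_betw_def ideals_set_def)
  also have "\<dots> = (\<Inter>i\<in>{..m}. g i)"
  proof (rule R.ideal_prod_eq_Inter)
    show "g \<in> {..m} \<rightarrow> {J. ideal J R}" using gP ideal_idl primesD(1) by auto
    fix i j assume ij: "i \<in> {..m}" "j \<in> {..m}" "i \<noteq> j"
    have "g i \<noteq> g j" using g ij by (auto simp: bij_betw_def inj_on_def)
    then obtain u where u: "u \<in> g j" "u - 1 \<in> g i" using primes_comaximal[OF gP gP] ij by force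
    have I: "idl (g i)" and J: "idl (g j)" using gP primesD(1) ij by auto
    have "x \<in> g i <+>\<^bsub>R\<^esub> g j" if x: "x \<in> A" for x
    proof -
      have "x = - (x * (u - 1)) + x * u" by (simp add: algebra_simps)
      moreover have "- (x * (u - 1)) \<in> g i" using idl_minus[OF I idlD(4)[OF I x u(2)]] .
      moreover have "x * u \<in> g j" using idlD(4)[OF J x u(1)] .
      ultimately have "\<exists>a\<in>g i. \<exists>b\<in>g j. x = a + b" by blast
      thus ?thesis by (auto simp: set_add_def set_mult_def R_simps)
    qed
    moreover have "g i <+>\<^bsub>R\<^esub> g j \<subseteq> A" using idlD(1)[OF I] idlD(1)[OF J]
      by (auto simp: set_add_def set_mult_def R_simps intro: A_closure)
    ultimately show "g i <+>\<^bsub>R\<^esub> g j = carrier R" by (auto simp: R_simps)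
  qed
  also have "\<dots> = \<Inter>primes" using g by (simp add: bij_betw_def)
  also have "\<dots> = {x. pdvd 1 x}"
  proof
    show "\<Inter>primes \<subseteq> {x. pdvd 1 x}"
    proof
      fix x assume x: "x \<in> \<Inter>primes"
      moreover obtain J where "J \<in> primes" using ne by (metis all_not_in_conv card.empty less_nat_zero_code)
      ultimately have "x \<in> A" using idlD(1)[OF primesD(1)] by blast
      thus "x \<in> {x. pdvd 1 x}" using Inter_primes x by blast
    qed
  qed (use primesD(5) in blast)
  also have "\<dots> = PIdl\<^bsub>R\<^esub> (of_nat p)" by (auto simp: cgenideal_def R_simps pdvd_def mult.commute)
  finally show ?thesis .
qed

lemma totally_split_number_field: "totally_split_in_number_field p F"
proof -
  have "degree_over_Q F = n" unfolding F n_def using f by (intro degree_over_Q_Qadj)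
  thus ?thesis
    unfolding totally_split_in_number_field_def R_def[symmetric]
    using finite_primes card_primes primeideal_primes prod_primes by (intro exI[of _ primes]) auto
qed

end

theorem totally_split_of_frobenius:
  assumes nf: "number_field F" and p: "Factorial_Ring.prime p"
    and frob: "\<And>x. x \<in> F \<Longrightarrow> algebraic_int x \<Longrightarrow> algebraic_int (frob_quot p x)"
  shows "totally_split_in_number_field p F"
proof -
  obtain \<theta> where t: "algebraic_int \<theta>" "F = Qadj \<theta>" using number_field_primitive_element[OF nf] .
  obtain f where f: "lead_coeff f = 1" "Factorial_Ring.irreducible f" "evQ f \<theta> = 0"
    using minimal_polynomial_exists[OF algebraic_int_imp_algebraic[OF t(1)]] .
  interpret L: number_field_at_prime F p f \<theta> using p t f by unfold_locales
  interpret frobenius_trivial_at_prime F p f \<theta>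
    by unfold_locales (use frob L.A_def in auto)
  show ?thesis by (rule totally_split_number_field)
qed

lemma totally_split_padic_field:
  assumes "p \<in> S" "\<And>p. p \<in> S \<Longrightarrow> Factorial_Ring.prime p"
  shows "totally_split p (padic_field S)"
  unfolding totally_split_def
proof safe
  fix F assume F: "number_field F" "F \<subseteq> padic_field S"
  show "totally_split_in_number_field p F"
  proof (rule totally_split_of_frobenius[OF F(1)])
    fix x assume "x \<in> F" "algebraic_int x"
    hence "x \<in> padic_ints p" using padic_field_integers assms F(2) by blast
    thus "algebraic_int (frob_quot p x)" using padic_ints_frob_quot padic_ints_algebraic_int by blast
  qed (use assms in auto)
qed

lemma int_minimal_polynomial_dvd:
  assumes h: "lead_coeff h = 1" "Factorial_Ring.irreducible (map_poly rat_of_int h)" "evZ h \<theta> = 0" and g: "evZ g \<theta> = 0"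
  obtains k where "g = h * k"
proof -
  obtain q r where qr: "pseudo_divmod g h = (q, r)" by fastforce
  have "h \<noteq> 0" using h(1) by auto
  from pseudo_divmod[OF this qr] have *: "g = h * q + r" "r = 0 \<or> degree r < degree h" using h(1) by auto
  have "evZ r \<theta> = 0" using * g h(3) by simp
  hence "map_poly of_int h dvd (map_poly of_int r :: rat poly)"
    using h irreducible_root_dvd[OF h(2), of \<theta>] by simp
  hence "r = 0" using *(2) dvd_imp_degree_le[of "map_poly rat_of_int h" "map_poly of_int r"] by (cases "r = 0") auto
  thus ?thesis using that[of q] *(1) by simp
qed

lemma prime_divisor_of_poly_value:
  fixes h :: "int poly"
  assumes "degree h > 0"
  obtains q :: nat and a where "Factorial_Ring.prime q" "q > N" "int q dvd poly h a"
proof -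
  define c where "c = poly h 0"
  show ?thesis
  proof (cases "c = 0")
    case True
    obtain q :: nat where "Factorial_Ring.prime q" "q > N" using bigger_prime by blast
    thus ?thesis using that[of q 0] True by (simp add: c_def)
  next
    case False
    obtain b h1 where h: "h = pCons b h1" by (cases h)
    have b: "b = c" by (simp add: c_def h)
    define V where "V = {a. poly (h - [:c:]) a = 0} \<union> {a. poly (h - [:-c:]) a = 0}"
    have "h - [:c:] \<noteq> 0" "h - [:-c:] \<noteq> 0" using assms by (auto simp: h)
    hence "finite V" unfolding V_def by (intro finite_UnI poly_roots_finite)
    moreover have "infinite (range (\<lambda>t::int. c * fact N * t))"
      using False by (subst finite_image_iff) (auto simp: inj_on_def infinite_UNIV_int)
    ultimately obtain a where "a \<in> range (\<lambda>t::int. c * fact N * t)" "a \<notin> V"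
      by (meson finite_subset subsetI)
    then obtain t where t: "c * fact N * t \<notin> V" by blast
    define a where "a = c * fact N * t"
    define u where "u = 1 + fact N * t * poly h1 a"
    have hu: "poly h a = c * u" by (simp add: h b u_def a_def algebra_simps)
    have "u \<noteq> 1" "u \<noteq> -1" using t hu by (auto simp: V_def a_def)
    hence "\<not> is_unit u" by auto
    have "\<exists>q::int. Factorial_Ring.prime q \<and> q dvd u"
    proof (cases "u = 0")
      case True
      thus ?thesis by (intro exI[of _ 2]) auto
    next
      case False
      thus ?thesis using prime_divisor_exists[of u] \<open>\<not> is_unit u\<close> by blast
    qed
    then obtain q where q: "Factorial_Ring.prime q" "q dvd u" by blast
    define r where "r = nat q"
    have r: "int r = q" "Factorial_Ring.prime r" using q(1) prime_ge_0_int[of q] by (auto simp: r_def)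
    have "r > N"
    proof (rule ccontr)
      assume "\<not> r > N"
      hence "r dvd fact N" using prime_gt_0_nat[OF r(2)] by (intro dvd_fact) auto
      hence "q dvd fact N" using r(1) by (metis of_nat_dvd_iff of_nat_fact)
      hence "q dvd u - fact N * (t * poly h1 a)" using q(2) by (intro dvd_diff) auto
      hence "q dvd 1" by (simp add: u_def)
      thus False using q(1) by auto
    qed
    moreover have "int r dvd poly h a" using q(2) hu r(1) by simp
    ultimately show ?thesis using that r(2) by blast
  qed
qed

lemma integral_scaling:
  obtains M :: nat and G :: "int poly" where "M > 0" "smult (of_nat M) g = map_poly rat_of_int G"
proof -
  have "\<exists>M>0. \<exists>G. smult (of_nat M) g = map_poly rat_of_int G"
  proof (induction g)
    case 0
    show ?case by (intro exI[of _ 1] exI[of _ 0] conjI) auto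
  next
    case (pCons a g)
    then obtain M G where M: "M > 0" "smult (of_nat M) g = map_poly rat_of_int G" by blast
    obtain b c where bc: "quotient_of a = (b, c)" by fastforce
    have c: "c > 0" "a = of_int b / of_int c" using quotient_of_denom_pos[OF bc] quotient_of_div[OF bc] by auto
    have "smult (of_nat (M * nat c)) (pCons a g) = map_poly rat_of_int (pCons (int M * b) (smult c G))"
    proof -
      have "smult (of_nat (M * nat c)) g = smult (of_int c) (smult (of_nat M) g)" using c(1) by (simp add: mult.commute)
      also have "\<dots> = map_poly of_int (smult c G)" unfolding M(2) by (simp add: of_int_hom.map_poly_hom_smult)
      finally show ?thesis using c by (simp add: of_int_hom.map_poly_pCons_hom)
    qed
    thus ?case using M(1) c(1) by (intro exI[of _ "M * nat c"]) auto
  qed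
  thus ?thesis using that by blast
qed

lemma Qadj_integral_scaling:
  assumes "x \<in> Qadj \<theta>"
  obtains M :: nat and G where "M > 0" "of_nat M * x = evZ G \<theta>"
proof -
  obtain g where g: "x = evQ g \<theta>" using assms by (auto simp: Qadj_def)
  obtain M G where M: "M > 0" "smult (of_nat M) g = map_poly rat_of_int G" using integral_scaling[of g] by blast
  have "evQ (smult (of_nat M) g) \<theta> = evZ G \<theta>" unfolding M(2) by simp
  thus ?thesis using that[of M G] M(1) g by simp
qed

lemma Qadj_integral_scaling_finite:
  assumes "finite S" "S \<subseteq> Qadj \<theta>"
  obtains M :: nat where "M > 0" "\<And>x. x \<in> S \<Longrightarrow> \<exists>G. of_nat M * x = evZ G \<theta>"
proof -
  have "\<exists>M>0. \<forall>x\<in>S. \<exists>G. of_nat M * x = evZ G \<theta>" using assms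
  proof (induction S rule: finite_induct)
    case empty
    show ?case by (intro exI[of _ 1]) auto
  next
    case (insert x S)
    then obtain M :: nat where M: "M > 0" "\<forall>x\<in>S. \<exists>G. of_nat M * x = evZ G \<theta>" by auto
    obtain M' G where M': "M' > 0" "of_nat M' * x = evZ G \<theta>" using Qadj_integral_scaling insert.prems by blast
    have "\<exists>G. of_nat (M * M') * y = evZ G \<theta>" if yS: "y \<in> insert x S" for y
    proof (cases "y = x")
      case True
      have "of_nat (M * M') * x = evZ (smult (int M) G) \<theta>" using M'(2) by simp
      thus ?thesis using True by blast
    next
      case False
      hence "y \<in> S" using yS by simp
      then obtain H where "of_nat M * y = evZ H \<theta>" using M(2) by blast
      hence "of_nat (M * M') * y = evZ (smult (int M') H) \<theta>" by simp
      thus ?thesis by blast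
    qed
    thus ?case using M(1) M'(1) by (intro exI[of _ "M * M'"]) auto
  qed
  thus ?thesis using that by blast
qed

lemma algebraic_integer_primitive:
  assumes "finite S" "\<And>x. x \<in> S \<Longrightarrow> algebraic x"
  obtains \<theta> where "algebraic_int \<theta>" "S \<subseteq> Qadj \<theta>"
proof -
  obtain \<eta> where e: "algebraic \<eta>" "S \<subseteq> Qadj \<eta>" using primitive_element_finite[OF assms] by blast
  obtain M :: nat where M: "M > 0" "algebraic_int (of_nat M * \<eta>)" using algebraic_imp_scaled_int[OF e(1)] .
  have sM: "subfield (Qadj (of_nat M * \<eta>)) complex_field" using M by (intro Qadj_subfield algebraic_int_imp_algebraic)
  have "of_rat (1 / of_nat M) * (of_nat M * \<eta>) \<in> Qadj (of_nat M * \<eta>)"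
    using subfield_complexD(4,9)[OF sM] Qadj_gen by blast
  hence "\<eta> \<in> Qadj (of_nat M * \<eta>)" using M(1) by (simp add: of_rat_divide)
  hence "Qadj \<eta> \<subseteq> Qadj (of_nat M * \<eta>)" using Qadj_min[OF sM] by blast
  thus ?thesis using that M(2) e(2) by blast
qed

lemma int_minimal_polynomial_exists:
  assumes "algebraic_int z"
  obtains h where "lead_coeff h = 1" "Factorial_Ring.irreducible (map_poly rat_of_int h)" "evZ h z = 0"
proof -
  obtain f where f: "lead_coeff f = 1" "Factorial_Ring.irreducible f" "evQ f z = 0"
    using minimal_polynomial_exists[OF algebraic_int_imp_algebraic[OF assms]] .
  obtain h where h: "f = map_poly of_int h" "lead_coeff h = 1"
    using minimal_polynomial_integral[OF f(2,1,3) assms] .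
  show ?thesis using that[of h] h f by simp
qed

lemma padic_ints_of_split_mod_p:
  assumes p: "Factorial_Ring.prime p" and f: "lead_coeff f = 1" "evZ f \<alpha> = 0" "degree f > 0"
    and S: "S \<subseteq> {..<p}" "card S = degree f" "\<And>c. c \<in> S \<Longrightarrow> int p dvd poly f (int c)"
  shows "\<alpha> \<in> padic_ints p"
proof -
  define v where "v = (\<Prod>c\<in>S. [:- int c, 1:])"
  have fin: "finite S" using S(1) finite_subset by blast
  have v: "degree v = degree f" "lead_coeff v = 1"
    using degree_prod_linear[OF fin, of int] lead_coeff_prod_linear[of int S] S(2) by (simp_all add: v_def)
  have "coeff (f - v) i = 0" if "i \<ge> degree f" for i
    using v f(1) that by (cases "i = degree f") (auto simp: coeff_eq_0)
  hence "degree (f - v) < degree f" using f(3) by (metis degree_0 leading_coeff_0_iff not_le)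
  moreover have "int p dvd poly (f - v) (int c)" if "c \<in> S" for c
  proof -
    have "poly v (int c) = 0" using that fin by (auto simp: v_def poly_prod prod_zero_iff)
    thus ?thesis using S(3)[OF that] by simp
  qed
  ultimately have "int p dvd coeff (f - v) i" for i
  proof (intro poly_coeffs_dvd_of_many_roots[of "int p" "int ` S"])
    fix c d assume cd: "c \<in> int ` S" "d \<in> int ` S" "int p dvd c - d"
    hence "c mod int p = d mod int p" by (simp add: mod_eq_dvd_iff)
    moreover have "c \<in> int ` {..<p}" "d \<in> int ` {..<p}" using cd(1,2) S(1) by auto
    ultimately show "c = d" by auto
  qed (use p fin S(2) in \<open>auto simp: card_image\<close>)
  then obtain r where "f - v = smult (int p) r" using poly_dvd_imp_smult by metis
  hence "f = (\<Prod>c\<in>S. [:- int c, 1:]) + smult (int p) r" by (simp add: algebra_simps v_def)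
  then obtain q s where qs: "[:0, 1:] ^ p - [:0, 1:] = f * q + smult (int p) s"
    using split_mod_p_dvd_frobenius[OF p S(1)] by blast
  have fr: "frob_quot p \<alpha> = evZ s \<alpha>"
    using frob_quot_via_divisor[OF qs, of \<alpha> 0] f(2) prime_gt_0_nat[OF p] by simp
  have "algebraic_int \<alpha>" using f algebraic_int_iff_evZ by blast
  hence "ring_gen {\<alpha>} \<subseteq> padic_ints p"
    using fr by (intro ring_gen_subset_padic_ints[OF p]) (auto intro: ring_gen_evZ ring_gen.base)
  thus ?thesis using ring_gen.base[of \<alpha> "{\<alpha>}"] by blast
qed

lemma split_prime_exists:
  assumes U: "finite U" "\<And>x. x \<in> U \<Longrightarrow> algebraic_int x"
  obtains p where "Factorial_Ring.prime p" "p > N" "U \<subseteq> padic_ints p"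
proof -
  obtain \<alpha> where \<alpha>: "algebraic_int \<alpha>" "U \<subseteq> Qadj \<alpha>"
    using algebraic_integer_primitive[OF U(1)] U(2) algebraic_int_imp_algebraic by blast
  obtain f0 where f0: "lead_coeff f0 = 1" "Factorial_Ring.irreducible f0" "evQ f0 \<alpha> = 0"
    using minimal_polynomial_exists[OF algebraic_int_imp_algebraic[OF \<alpha>(1)]] .
  define Z where "Z = {z. evQ f0 z = 0}"
  have Z: "finite Z" using card_roots_irreducible[OF f0(2)] by (simp add: Z_def)
  have "algebraic z" if "z \<in> Z" for z
    using that f0(2) unfolding algebraic_iff_evQ Z_def Factorial_Ring.irreducible_def by blast
  then obtain \<theta> where t: "algebraic_int \<theta>" "Z \<subseteq> Qadj \<theta>" using algebraic_integer_primitive[OF Z] by blast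
  obtain M :: nat where M: "M > 0" "\<And>x. x \<in> Z \<Longrightarrow> \<exists>G. of_nat M * x = evZ G \<theta>"
    using Qadj_integral_scaling_finite[OF Z t(2)] by blast
  define \<beta> where "\<beta> = of_nat M * \<alpha>"
  have bi: "algebraic_int \<beta>" unfolding \<beta>_def by (rule algebraic_int_mult[OF algebraic_int_of_nat \<alpha>(1)])
  obtain f where f: "lead_coeff f = 1" "Factorial_Ring.irreducible (map_poly rat_of_int f)" "evZ f \<beta> = 0"
    using int_minimal_polynomial_exists[OF bi] .
  define Y where "Y = {z. evZ f z = 0}"
  have Y: "finite Y" "card Y = degree f" using card_roots_irreducible[OF f(2)] by (simp_all add: Y_def)
  have df: "degree f > 0" using irreducible_degree_pos[OF f(2)] by simp
  have "\<exists>G. y = evZ G \<theta>" if y: "y \<in> Y" for y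
  proof -
    have "evQ (pcompose f0 [:0, 1 / of_nat M:]) \<beta> = 0" using f0(3) M(1) by (simp add: \<beta>_def of_rat_divide)
    hence "evQ (pcompose f0 [:0, 1 / of_nat M:]) y = 0"
      by (rule conjugate_root[OF f(2), rotated 2]) (use f(3) y in \<open>auto simp: Y_def\<close>)
    hence "y / of_nat M \<in> Z" by (simp add: Z_def of_rat_divide)
    thus ?thesis using M(2)[of "y / of_nat M"] M(1) by simp
  qed
  then obtain G where G: "\<And>y. y \<in> Y \<Longrightarrow> y = evZ (G y) \<theta>" by metis
  obtain h where h: "lead_coeff h = 1" "Factorial_Ring.irreducible (map_poly rat_of_int h)" "evZ h \<theta> = 0"
    using int_minimal_polynomial_exists[OF t(1)] .
  have dh: "degree h > 0" using irreducible_degree_pos[OF h(2)] by simp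
  have "\<exists>D q. D > 0 \<and> of_nat D = (y - z) * evZ q (y - z)" if "y \<in> Y" "z \<in> Y" "y \<noteq> z" for y z
  proof -
    have "algebraic_int y" "algebraic_int z" using that f(1) algebraic_int_iff_evZ unfolding Y_def by blast+
    thus ?thesis using algebraic_int_divides_integer[of "y - z"] that(3) algebraic_int_diff by (metis right_minus_eq)
  qed
  then obtain D q where D: "\<And>y z. y \<in> Y \<Longrightarrow> z \<in> Y \<Longrightarrow> y \<noteq> z \<Longrightarrow> D y z > (0::nat)"
    "\<And>y z. y \<in> Y \<Longrightarrow> z \<in> Y \<Longrightarrow> y \<noteq> z \<Longrightarrow> of_nat (D y z) = (y - z) * evZ (q y z) (y - z)" by metis
  define N' where "N' = Max (insert N ((\<lambda>(y,z). D y z) ` (Y \<times> Y)))"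
  have N': "N \<le> N'" "\<And>y z. y \<in> Y \<Longrightarrow> z \<in> Y \<Longrightarrow> D y z \<le> N'"
    unfolding N'_def using Y(1) by (auto intro!: Max_ge)
  obtain p a where p: "Factorial_Ring.prime p" "p > N'" "int p dvd poly h a"
    using prime_divisor_of_poly_value[OF dh] by blast
  have ev: "int p dvd poly g a" if g: "evZ g \<theta> = 0" for g
  proof -
    obtain k where "g = h * k" using int_minimal_polynomial_dvd[OF h g] .
    thus ?thesis using p(3) by simp
  qed
  define c where "c = (\<lambda>y. poly (G y) a mod int p)"
  have p0: "p > 0" using prime_gt_0_nat[OF p(1)] .
  have c: "0 \<le> c y" "c y < int p" "int p dvd c y - poly (G y) a" for y
    using p0 by (auto simp: c_def mod_eq_dvd_iff[symmetric])
  define S where "S = (\<lambda>y. nat (c y)) ` Y"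
  have inj: "inj_on (\<lambda>y. nat (c y)) Y"
  proof (rule inj_onI, rule ccontr)
    fix y z assume yz: "y \<in> Y" "z \<in> Y" "nat (c y) = nat (c z)" "y \<noteq> z"
    hence "c y = c z" using c(1) by (metis nat_eq_iff)
    hence "int p dvd poly (G y) a - poly (G z) a" by (simp add: c_def mod_eq_dvd_iff)
    define g where "g = [:int (D y z):] - (G y - G z) * pcompose (q y z) (G y - G z)"
    have "evZ g \<theta> = 0" using D(2)[OF yz(1,2,4)] G[OF yz(1)] G[OF yz(2)] by (simp add: g_def)
    hence "int p dvd poly g a" by (rule ev)
    hence "int p dvd poly g a + (poly (G y) a - poly (G z) a) * poly (pcompose (q y z) (G y - G z)) a"
      using \<open>int p dvd poly (G y) a - poly (G z) a\<close> by (intro dvd_add) auto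
    hence "p dvd D y z" by (simp add: g_def)
    hence "p \<le> D y z" using D(1)[OF yz(1,2,4)] by (intro dvd_imp_le)
    thus False using N'(2)[OF yz(1,2)] p(2) by simp
  qed
  have "\<beta> \<in> padic_ints p"
  proof (rule padic_ints_of_split_mod_p[OF p(1) f(1,3) df])
    show "S \<subseteq> {..<p}" using c(1,2) by (auto simp: S_def nat_less_iff)
    show "card S = degree f" using inj Y by (simp add: S_def card_image)
    fix s assume "s \<in> S"
    then obtain y where y: "y \<in> Y" "s = nat (c y)" by (auto simp: S_def)
    have "evZ (pcompose f (G y)) \<theta> = 0" using G[OF y(1)] y(1) by (simp add: Y_def)
    from ev[OF this] have 1: "int p dvd poly f (poly (G y) a)" by (simp add: poly_pcompose)
    have "poly f (c y) - poly f (poly (G y) a) = (c y - poly (G y) a) * poly (synthetic_div (f - [:poly f (poly (G y) a):]) (poly (G y) a)) (c y)"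
    proof -
      let ?b = "poly (G y) a" let ?f = "f - [:poly f ?b:]"
      have "?f = [:-?b, 1:] * synthetic_div ?f ?b + [:poly ?f ?b:]" using synthetic_div_correct'[of ?b ?f] by simp
      hence "poly ?f (c y) = poly ([:-?b, 1:] * synthetic_div ?f ?b + [:poly ?f ?b:]) (c y)" by (rule arg_cong)
      thus ?thesis by (simp add: algebra_simps)
    qed
    hence "int p dvd poly f (c y) - poly f (poly (G y) a)" using c(3)[of y] by simp
    hence "int p dvd poly f (c y)" using 1 by (metis dvd_add_right_iff diff_add_cancel)
    thus "int p dvd poly f (int s)" using y(2) c(1) by simp
  qed
  moreover have "U \<subseteq> padic_ints p"  if b: "\<beta> \<in> padic_ints p"
  proof
    have a: "\<alpha> \<in> padic_ints p" using padic_ints_saturated[OF p(1) \<alpha>(1) M(1)] b by (simp add: \<beta>_def)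
    fix x assume x: "x \<in> U"
    obtain M' H where M': "M' > 0" "of_nat M' * x = evZ H \<alpha>" using Qadj_integral_scaling x \<alpha>(2) by blast
    have "of_nat M' * x \<in> padic_ints p" unfolding M'(2) by (rule padic_ints_closure(9)[OF p(1) a])
    thus "x \<in> padic_ints p" using padic_ints_saturated[OF p(1) U(2)[OF x] M'(1)] by blast
  qed
  ultimately show ?thesis using that[of p] p N'(1) by simp
qed

lemma absolute_value_basic:
  assumes v: "absolute_value_on F v" and F: "subfield F complex_field"
  shows "v 0 = 0" "v 1 = 1" "x \<in> F \<Longrightarrow> v (- x) = v x" "x \<in> F \<Longrightarrow> y \<in> F \<Longrightarrow> v (x - y) \<le> v x + v y"
    "x \<in> F \<Longrightarrow> y \<in> F \<Longrightarrow> \<bar>v x - v y\<bar> \<le> v (x - y)" "x \<in> F \<Longrightarrow> v (x ^ n) = v x ^ n"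
    "(\<And>i. i \<in> I \<Longrightarrow> g i \<in> F) \<Longrightarrow> v (sum g I) \<le> (\<Sum>i\<in>I. v (g i))" "x \<in> F \<Longrightarrow> v x \<ge> 0"
proof -
  note FD = subfield_complexD[OF F]
  have mult: "v (x * y) = v x * v y" and tri: "v (x + y) \<le> v x + v y" and zero: "v x = 0 \<longleftrightarrow> x = 0" if "x \<in> F" "y \<in> F" for x y
    using v that by (auto simp: absolute_value_on_def)
  show pos: "x \<in> F \<Longrightarrow> v x \<ge> 0" for x using v by (auto simp: absolute_value_on_def)
  show v0: "v 0 = 0" using zero FD(1) by blast
  have "v 1 = v 1 * v 1" using mult[OF FD(2,2)] by simp
  thus v1: "v 1 = 1" using zero[OF FD(2,2)] by simp
  have m1: "v (-1) = 1"
  proof -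
    have "-1 \<in> F" using FD(5)[OF FD(2)] .
    hence "v (-1) * v (-1) = 1" "v (-1) \<ge> 0" using mult[of "-1" "-1"] v1 pos by auto
    hence "(v (-1) - 1) * (v (-1) + 1) = 0" by (simp add: algebra_simps)
    thus ?thesis using \<open>v (-1) \<ge> 0\<close> by simp
  qed
  show vm: "v (- x) = v x" if "x \<in> F" for x
    using mult[OF FD(5)[OF FD(2)] that] m1 by simp
  show d: "v (x - y) \<le> v x + v y" if "x \<in> F" "y \<in> F" for x y
    using tri[OF that(1) FD(5)[OF that(2)]] vm[OF that(2)] by simp
  show "\<bar>v x - v y\<bar> \<le> v (x - y)" if xy: "x \<in> F" "y \<in> F"
  proof -
    have "v x \<le> v (x - y) + v y" using tri[OF FD(6)[OF xy] xy(2)] by simp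
    moreover have "v y \<le> v x + v (x - y)" using d[OF xy(1) FD(6)[OF xy]] by simp
    ultimately show ?thesis by linarith
  qed
  show "v (x ^ n) = v x ^ n" if "x \<in> F"
    by (induction n) (use that v1 mult FD(10) in auto)
  show "(\<And>i. i \<in> I \<Longrightarrow> g i \<in> F) \<Longrightarrow> v (sum g I) \<le> (\<Sum>i\<in>I. v (g i))"
  proof (induction I rule: infinite_finite_induct)
    case (insert i I)
    have "v (g i + sum g I) \<le> v (g i) + v (sum g I)" using insert.prems by (intro tri subfield_sum[OF F]) auto
    thus ?case using insert by force
  qed (use v0 in auto)
qed

lemma power_bounded_imp_le_one:
  fixes a :: real assumes "\<And>k. a ^ k \<le> C" shows "a \<le> 1"
proof (rule ccontr)
  assume "\<not> a \<le> 1"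
  then obtain k where "C < a ^ k" using real_arch_pow[of a C] by auto
  thus False using assms[of k] by simp
qed

lemma nonarchimedean_place_integral:
  assumes v: "absolute_value_on F v" and F: "subfield F complex_field"
    and int: "\<And>j. v (of_int j) \<le> 1" and x: "x \<in> F" "algebraic_int x"
  shows "v x \<le> 1"
proof -
  obtain h where h: "lead_coeff h = 1" "evZ h x = 0" using x(2) algebraic_int_iff_evZ by blast
  have h0: "h \<noteq> 0" using h(1) by auto
  define n where "n = Suc (degree h)"
  have "v x ^ k \<le> (\<Sum>i<n. v x ^ i)" for k
  proof -
    obtain q r where qr: "pseudo_divmod (monom 1 k) h = (q, r)" by fastforce
    from pseudo_divmod[OF h0 qr] have *: "monom 1 k = h * q + r" "r = 0 \<or> degree r < degree h" using h(1) by auto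
    have "evZ (monom 1 k) x = evZ (h * q + r) x" by (simp only: *)
    hence "x ^ k = evZ r x" using h(2) by simp
    also have "\<dots> = (\<Sum>i\<le>degree r. of_int (coeff r i) * x ^ i)" by (simp add: evZ_def poly_altdef)
    also have "\<dots> = (\<Sum>i<n. of_int (coeff r i) * x ^ i)"
      using *(2) by (intro sum.mono_neutral_left) (auto simp: n_def coeff_eq_0)
    finally have "v x ^ k = v (\<Sum>i<n. of_int (coeff r i) * x ^ i)"
      using absolute_value_basic(6)[OF v F x(1), of k] by simp
    also have "\<dots> \<le> (\<Sum>i<n. v (of_int (coeff r i) * x ^ i))"
      using x(1) by (intro absolute_value_basic(7)[OF v F] subfield_complexD[OF F])
    also have "\<dots> \<le> (\<Sum>i<n. v x ^ i)"
    proof (intro sum_mono)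
      fix i
      have "v (of_int (coeff r i) * x ^ i) = v (of_int (coeff r i)) * v x ^ i"
        using v x(1) absolute_value_basic(6)[OF v F x(1)] subfield_complexD[OF F] by (simp add: absolute_value_on_def)
      also have "\<dots> \<le> 1 * v x ^ i" using int absolute_value_basic(8)[OF v F x(1)] by (intro mult_right_mono) auto
      finally show "v (of_int (coeff r i) * x ^ i) \<le> v x ^ i" by simp
    qed
    finally show ?thesis .
  qed
  thus ?thesis by (rule power_bounded_imp_le_one)
qed

lemma padic_abs_of_int: "Factorial_Ring.prime p \<Longrightarrow> padic_abs p (of_int j) \<le> 1"
proof -
  assume p: "Factorial_Ring.prime p"
  have q: "quotient_of (of_int j) = (j, 1)" by (simp add: quotient_of_int)
  have "real p powi (- int k) \<le> 1" for k
    using prime_gt_1_nat[OF p] by (simp add: power_int_minus field_simps one_le_power)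
  thus ?thesis unfolding padic_abs_def q by simp
qed

lemma of_real_of_rat [simp]: "complex_of_real (of_rat q) = of_rat q"
  by (cases q) (simp add: of_rat_rat)

lemma cnj_of_rat: "cnj (of_rat q) = of_rat q"
  by (metis complex_cnj_complex_of_real of_real_of_rat)

lemma of_real_poly:
  "map_poly complex_of_real (P + Q) = map_poly of_real P + map_poly of_real Q"
  "map_poly complex_of_real (P * Q) = map_poly of_real P * map_poly of_real Q"
  "map_poly complex_of_real P = map_poly of_real Q \<longleftrightarrow> P = Q"
  "poly (map_poly complex_of_real P) (of_real x) = of_real (poly P x)"
proof -
  show "map_poly complex_of_real (P + Q) = map_poly of_real P + map_poly of_real Q"
    by (intro poly_eqI) (simp add: coeff_map_poly)
  show "map_poly complex_of_real (P * Q) = map_poly of_real P * map_poly of_real Q"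
    by (intro poly_eqI) (simp add: coeff_map_poly coeff_mult)
  show "map_poly complex_of_real P = map_poly of_real Q \<longleftrightarrow> P = Q"
    by (simp add: poly_eq_iff coeff_map_poly)
  show "poly (map_poly complex_of_real P) (of_real x) = of_real (poly P x)"
    by (simp add: poly_altdef coeff_map_poly)
qed

definition rat_approx :: "nat \<Rightarrow> real \<Rightarrow> rat" where "rat_approx k c = of_int \<lfloor>c * of_nat (Suc k)\<rfloor> / of_nat (Suc k)"

lemma rat_approx_0 [simp]: "rat_approx k 0 = 0" by (simp add: rat_approx_def)

lemma rat_approx_tendsto: "(\<lambda>k. of_rat (rat_approx k c) :: real) \<longlonglongrightarrow> c"
proof (rule LIMSEQ_I)
  fix e :: real assume e: "e > 0"
  obtain N where N: "inverse (real (Suc N)) < e" using reals_Archimedean[OF e] by blast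
  have "norm (of_rat (rat_approx k c) - c) < e" if "k \<ge> N" for k
  proof -
    have "(of_rat (rat_approx k c) - c) * real (Suc k) = of_int \<lfloor>c * real (Suc k)\<rfloor> - c * real (Suc k)"
      by (simp add: rat_approx_def of_rat_divide of_rat_add field_simps)
    moreover have "\<bar>of_int \<lfloor>c * real (Suc k)\<rfloor> - c * real (Suc k)\<bar> \<le> 1" by linarith
    ultimately have "\<bar>of_rat (rat_approx k c) - c\<bar> * real (Suc k) \<le> 1" by (metis abs_mult abs_of_nat)
    hence "\<bar>of_rat (rat_approx k c) - c\<bar> \<le> inverse (real (Suc k))" by (simp add: field_simps)
    also have "\<dots> \<le> inverse (real (Suc N))" using that by (simp add: field_simps)
    finally show ?thesis using N by simp
  qed
  thus "\<exists>N. \<forall>k\<ge>N. norm (of_rat (rat_approx k c) - c) < e" by blast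
qed

locale archimedean_absolute_value =
  fixes \<alpha> :: complex and v :: "complex \<Rightarrow> real"
  assumes alg: "algebraic \<alpha>" and v: "absolute_value_on (Qadj \<alpha>) v" and vQ: "\<And>q. v (of_rat q) = \<bar>of_rat q\<bar>"
begin

lemma F: "subfield (Qadj \<alpha>) complex_field" using alg by (rule Qadj_subfield)
lemmas vb = absolute_value_basic[OF v F]
lemma v_mult: "v (evQ g \<alpha> * evQ h \<alpha>) = v (evQ g \<alpha>) * v (evQ h \<alpha>)"
  using v by (simp add: absolute_value_on_def)

lemma v_bound: "degree g \<le> m \<Longrightarrow> v (evQ g \<alpha>) \<le> (\<Sum>i\<le>m. \<bar>of_rat (coeff g i)\<bar> * v \<alpha> ^ i)"
proof -
  assume m: "degree g \<le> m"
  have "evQ g \<alpha> = (\<Sum>i\<le>m. of_rat (coeff g i) * \<alpha> ^ i)"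
    using evQ_altdef[of g "Suc m" \<alpha>] m by (simp add: lessThan_Suc_atMost)
  also have "v \<dots> \<le> (\<Sum>i\<le>m. v (of_rat (coeff g i) * \<alpha> ^ i))"
    by (intro vb(7) subfield_complexD[OF F] Qadj_gen)
  also have "\<dots> = (\<Sum>i\<le>m. \<bar>of_rat (coeff g i)\<bar> * v \<alpha> ^ i)"
    using v vQ vb(6)[OF Qadj_gen] subfield_complexD[OF F] by (intro sum.cong) (auto simp: absolute_value_on_def)
  finally show ?thesis .
qed

definition approximates :: "(nat \<Rightarrow> rat poly) \<Rightarrow> real poly \<Rightarrow> bool" where
  "approximates G P \<longleftrightarrow> (\<exists>m. \<forall>k. degree (G k) \<le> m) \<and> (\<forall>i. (\<lambda>k. of_rat (coeff (G k) i)) \<longlonglongrightarrow> coeff P i)"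

lemma approximates_diff:
  assumes "approximates G P" "approximates H P"
  shows "(\<lambda>k. v (evQ (G k) \<alpha>) - v (evQ (H k) \<alpha>)) \<longlonglongrightarrow> 0"
proof -
  obtain m1 m2 where m: "\<And>k. degree (G k) \<le> m1" "\<And>k. degree (H k) \<le> m2" using assms by (auto simp: approximates_def)
  define m where "m = max m1 m2"
  define C where "C = (\<lambda>k. \<Sum>i\<le>m. \<bar>(of_rat (coeff (G k) i) :: real) - of_rat (coeff (H k) i)\<bar> * v \<alpha> ^ i)"
  have le: "\<bar>v (evQ (G k) \<alpha>) - v (evQ (H k) \<alpha>)\<bar> \<le> C k" for k
  proof -
    have "\<bar>v (evQ (G k) \<alpha>) - v (evQ (H k) \<alpha>)\<bar> \<le> v (evQ (G k - H k) \<alpha>)"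
      using vb(5)[of "evQ (G k) \<alpha>" "evQ (H k) \<alpha>"] by simp
    also have "\<dots> \<le> (\<Sum>i\<le>m. \<bar>of_rat (coeff (G k - H k) i)\<bar> * v \<alpha> ^ i)"
      using m by (intro v_bound degree_diff_le) (auto simp: m_def le_max_iff_disj)
    finally show ?thesis by (simp add: of_rat_diff C_def)
  qed
  have "C \<longlonglongrightarrow> (\<Sum>i\<le>m. \<bar>coeff P i - coeff P i\<bar> * v \<alpha> ^ i)"
    using assms unfolding approximates_def C_def by (intro tendsto_intros) auto
  hence C0: "C \<longlonglongrightarrow> 0" by simp
  have "norm (v (evQ (G k) \<alpha>) - v (evQ (H k) \<alpha>)) \<le> norm (C k) * 1" for k using le[of k] by simp
  hence "\<forall>\<^sub>F k in sequentially. norm (v (evQ (G k) \<alpha>) - v (evQ (H k) \<alpha>)) \<le> norm (C k) * 1"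
    by (intro always_eventually allI)
  from tendsto_0_le[OF C0 this] show ?thesis .
qed

definition rat_approx_poly :: "nat \<Rightarrow> real poly \<Rightarrow> rat poly" where "rat_approx_poly k P = map_poly (rat_approx k) P"

lemma approximates_exists: "approximates (\<lambda>k. rat_approx_poly k P) P"
  unfolding approximates_def
proof (intro conjI allI)
  show "\<exists>m. \<forall>k. degree (rat_approx_poly k P) \<le> m"
    by (intro exI[of _ "degree P"]) (simp add: rat_approx_poly_def degree_map_poly_le)
  show "(\<lambda>k. of_rat (coeff (rat_approx_poly k P) i)) \<longlonglongrightarrow> coeff P i" for i
    using rat_approx_tendsto[of "coeff P i"] by (simp add: rat_approx_poly_def coeff_map_poly)
qed

lemma approximates_convergent:
  assumes "approximates G P" shows "convergent (\<lambda>k. v (evQ (G k) \<alpha>))"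
proof -
  obtain m where m: "\<And>k. degree (G k) \<le> m" using assms by (auto simp: approximates_def)
  define B where "B = (\<lambda>k l. \<Sum>i\<le>m. \<bar>(of_rat (coeff (G k) i) :: real) - of_rat (coeff (G l) i)\<bar> * v \<alpha> ^ i)"
  have le: "\<bar>v (evQ (G k) \<alpha>) - v (evQ (G l) \<alpha>)\<bar> \<le> B k l" for k l
  proof -
    have "\<bar>v (evQ (G k) \<alpha>) - v (evQ (G l) \<alpha>)\<bar> \<le> v (evQ (G k - G l) \<alpha>)"
      using vb(5)[of "evQ (G k) \<alpha>" "evQ (G l) \<alpha>"] by simp
    also have "\<dots> \<le> (\<Sum>i\<le>m. \<bar>of_rat (coeff (G k - G l) i)\<bar> * v \<alpha> ^ i)"
      using m by (intro v_bound degree_diff_le)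
    finally show ?thesis by (simp add: B_def of_rat_diff)
  qed
  define C where "C = (\<lambda>k. \<Sum>i\<le>m. \<bar>(of_rat (coeff (G k) i) :: real) - coeff P i\<bar> * v \<alpha> ^ i)"
  have "C \<longlonglongrightarrow> (\<Sum>i\<le>m. \<bar>coeff P i - coeff P i\<bar> * v \<alpha> ^ i)"
    using assms unfolding approximates_def C_def by (intro tendsto_intros) auto
  hence C0: "C \<longlonglongrightarrow> 0" by simp
  have BC: "B k l \<le> C k + C l" for k l unfolding B_def C_def sum.distrib[symmetric]
    by (intro sum_mono) (simp add: vb(8) distrib_right[symmetric] mult_right_mono)
  have "Cauchy (\<lambda>k. v (evQ (G k) \<alpha>))"
  proof (rule metric_CauchyI)
    fix e :: real assume "e > 0"
    then obtain N where N: "\<And>k. k \<ge> N \<Longrightarrow> \<bar>C k\<bar> < e / 2" using LIMSEQ_D[OF C0, of "e/2"] by auto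
    have "dist (v (evQ (G k) \<alpha>)) (v (evQ (G l) \<alpha>)) < e" if "k \<ge> N" "l \<ge> N" for k l
      using le[of k l] BC[of k l] N[OF that(1)] N[OF that(2)] by (auto simp: dist_real_def)
    thus "\<exists>N. \<forall>k\<ge>N. \<forall>l\<ge>N. dist (v (evQ (G k) \<alpha>)) (v (evQ (G l) \<alpha>)) < e" by blast
  qed
  thus ?thesis by (simp add: Cauchy_convergent_iff)
qed

definition Nv :: "real poly \<Rightarrow> real" where "Nv P = lim (\<lambda>k. v (evQ (rat_approx_poly k P) \<alpha>))"

lemma Nv_limit:
  assumes "approximates G P" shows "(\<lambda>k. v (evQ (G k) \<alpha>)) \<longlonglongrightarrow> Nv P"
proof -
  have "(\<lambda>k. v (evQ (rat_approx_poly k P) \<alpha>)) \<longlonglongrightarrow> Nv P"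
    unfolding Nv_def using approximates_convergent[OF approximates_exists] by (simp add: convergent_LIMSEQ_iff)
  from tendsto_add[OF this approximates_diff[OF assms approximates_exists]] show ?thesis by simp
qed

lemma approximates_mult:
  assumes "approximates G P" "approximates H Q" shows "approximates (\<lambda>k. G k * H k) (P * Q)"
proof -
  obtain m1 m2 where m: "\<And>k. degree (G k) \<le> m1" "\<And>k. degree (H k) \<le> m2" using assms by (auto simp: approximates_def)
  have "degree (G k * H k) \<le> m1 + m2" for k using degree_mult_le[of "G k" "H k"] m[of k] by linarith
  moreover have "(\<lambda>k. of_rat (coeff (G k * H k) i)) \<longlonglongrightarrow> coeff (P * Q) i" for i
    using assms unfolding approximates_def coeff_mult of_rat_sum of_rat_mult by (intro tendsto_intros) auto
  ultimately show ?thesis unfolding approximates_def by blast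
qed

lemma Nv_mult: "Nv (P * Q) = Nv P * Nv Q"
proof -
  note A = approximates_exists[of P] approximates_exists[of Q]
  have "(\<lambda>k. v (evQ (rat_approx_poly k P * rat_approx_poly k Q) \<alpha>)) \<longlonglongrightarrow> Nv (P * Q)"
    by (rule Nv_limit[OF approximates_mult[OF A]])
  moreover have "(\<lambda>k. v (evQ (rat_approx_poly k P * rat_approx_poly k Q) \<alpha>)) \<longlonglongrightarrow> Nv P * Nv Q"
    unfolding evQ_ring v_mult by (intro tendsto_mult Nv_limit A)
  ultimately show ?thesis by (rule LIMSEQ_unique)
qed

lemma Nv_rat: "Nv (map_poly of_rat g) = v (evQ g \<alpha>)"
proof -
  have "approximates (\<lambda>k. g) (map_poly of_rat g)" by (auto simp: approximates_def coeff_map_poly)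
  from LIMSEQ_unique[OF Nv_limit[OF this] tendsto_const] show ?thesis .
qed

lemma Nv_add: "Nv (P + Q) \<le> Nv P + Nv Q"
proof -
  note A = approximates_exists[of P] approximates_exists[of Q]
  have "approximates (\<lambda>k. rat_approx_poly k P + rat_approx_poly k Q) (P + Q)"
  proof -
    obtain m1 m2 where m: "\<And>k. degree (rat_approx_poly k P) \<le> m1" "\<And>k. degree (rat_approx_poly k Q) \<le> m2"
      using A by (auto simp: approximates_def)
    have "degree (rat_approx_poly k P + rat_approx_poly k Q) \<le> max m1 m2" for k
      using m by (intro degree_add_le) (auto simp: le_max_iff_disj)
    moreover have "(\<lambda>k. of_rat (coeff (rat_approx_poly k P + rat_approx_poly k Q) i)) \<longlonglongrightarrow> coeff (P + Q) i" for i
      using A unfolding approximates_def coeff_add of_rat_add by (intro tendsto_intros) auto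
    ultimately show ?thesis unfolding approximates_def by blast
  qed
  from Nv_limit[OF this] have "(\<lambda>k. v (evQ (rat_approx_poly k P + rat_approx_poly k Q) \<alpha>)) \<longlonglongrightarrow> Nv (P + Q)" .
  moreover have "(\<lambda>k. v (evQ (rat_approx_poly k P) \<alpha>) + v (evQ (rat_approx_poly k Q) \<alpha>)) \<longlonglongrightarrow> Nv P + Nv Q"
    by (intro tendsto_add Nv_limit A)
  ultimately show ?thesis
    by (rule LIMSEQ_le) (use v in \<open>auto simp: absolute_value_on_def\<close>)
qed

lemma Nv_bound: "degree P \<le> m \<Longrightarrow> Nv P \<le> (\<Sum>i\<le>m. \<bar>coeff P i\<bar> * v \<alpha> ^ i)"
proof -
  assume m: "degree P \<le> m"
  note A = approximates_exists[of P]
  have "(\<lambda>k. \<Sum>i\<le>m. \<bar>of_rat (coeff (rat_approx_poly k P) i)\<bar> * v \<alpha> ^ i) \<longlonglongrightarrow> (\<Sum>i\<le>m. \<bar>coeff P i\<bar> * v \<alpha> ^ i)"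
    using A unfolding approximates_def by (intro tendsto_intros) auto
  with Nv_limit[OF A] show ?thesis
  proof (rule LIMSEQ_le)
    have "degree (rat_approx_poly k P) \<le> m" for k
      using degree_map_poly_le[of "rat_approx k" P] m by (simp add: rat_approx_poly_def)
    thus "\<exists>N. \<forall>k\<ge>N. v (evQ (rat_approx_poly k P) \<alpha>) \<le> (\<Sum>i\<le>m. \<bar>of_rat (coeff (rat_approx_poly k P) i)\<bar> * v \<alpha> ^ i)"
      using v_bound by blast
  qed
qed

lemma Nv_prod: "finite S \<Longrightarrow> Nv (prod P S) = (\<Prod>i\<in>S. Nv (P i))"
proof (induction S rule: finite_induct)
  case empty
  show ?case using Nv_rat[of 1] vb(2) by simp
qed (simp add: Nv_mult)

lemma Nv_nonneg: "Nv P \<ge> 0"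
  by (rule LIMSEQ_le_const[OF Nv_limit[OF approximates_exists[of P]]]) (use vb(8) in auto)

definition quad :: "complex \<Rightarrow> real poly" where "quad \<beta> = [: (cmod \<beta>)\<^sup>2, - 2 * Re \<beta>, 1 :]"

lemma quad: "map_poly of_real (quad \<beta>) = [:-\<beta>, 1:] * [:-cnj \<beta>, 1:]"
proof -
  have "complex_of_real ((cmod \<beta>)\<^sup>2) = \<beta> * cnj \<beta>" by (rule complex_norm_square)
  moreover have "complex_of_real (2 * Re \<beta>) = \<beta> + cnj \<beta>" by (simp add: complex_eq_iff)
  ultimately show ?thesis by (simp add: quad_def)
qed

lemma cnj_root: "evQ f \<beta> = 0 \<Longrightarrow> evQ f (cnj \<beta>) = 0"
proof -
  have "evQ f (cnj \<beta>) = cnj (evQ f \<beta>)" by (induction f) (auto simp: cnj_of_rat)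
  thus "evQ f \<beta> = 0 \<Longrightarrow> evQ f (cnj \<beta>) = 0" by simp
qed

lemma vanishing_quad:
  assumes f: "Factorial_Ring.irreducible f" "lead_coeff f = 1" "evQ f \<alpha> = 0"
  obtains \<beta> where "evQ f \<beta> = 0" "Nv (quad \<beta>) = 0"
proof -
  define Z where "Z = {z. evQ f z = 0}"
  have Z: "finite Z" "map_poly of_rat f = (\<Prod>z\<in>Z. [:-z, 1::complex:])"
    using card_roots_irreducible[OF f(1)] f(2) by (simp_all add: Z_def)
  have cnjZ: "bij_betw cnj Z Z"
    by (rule bij_betw_byWitness[where f' = cnj]) (auto simp: Z_def cnj_root)
  have "map_poly complex_of_real (\<Prod>z\<in>Z. quad z) = (\<Prod>z\<in>Z. [:-z, 1:] * [:-cnj z, 1:])"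
    unfolding quad[symmetric] by (induction Z rule: infinite_finite_induct) (auto simp: of_real_poly)
  also have "\<dots> = (\<Prod>z\<in>Z. [:-z, 1:]) * (\<Prod>z\<in>Z. [:-cnj z, 1:])" by (rule prod.distrib)
  also have "(\<Prod>z\<in>Z. [:-cnj z, 1:]) = (\<Prod>z\<in>Z. [:-z, 1:])"
    by (rule prod.reindex_bij_betw[OF cnjZ])
  also have "(\<Prod>z\<in>Z. [:-z, 1:]) * (\<Prod>z\<in>Z. [:-z, 1:]) = map_poly complex_of_real (map_poly of_rat f * map_poly of_rat f)"
    by (simp add: Z(2)[symmetric] of_real_poly map_poly_map_poly o_def)
  finally have "(\<Prod>z\<in>Z. quad z) = map_poly of_rat f * map_poly of_rat f" by (simp only: of_real_poly(3))
  hence "(\<Prod>z\<in>Z. Nv (quad z)) = v (evQ f \<alpha>) * v (evQ f \<alpha>)"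
    using Nv_prod[OF Z(1), of quad] by (simp add: Nv_mult Nv_rat)
  also have "\<dots> = 0" using f(3) vb(1) by simp
  finally obtain \<beta> where "\<beta> \<in> Z" "Nv (quad \<beta>) = 0" using Z(1) by auto
  thus ?thesis using that by (simp add: Z_def)
qed

lemma v_le_const_times:
  assumes "Nv (quad \<beta>) = 0"
  obtains C where "\<And>g. v (evQ g \<alpha>) \<le> C * cmod (evQ g \<beta>)"
proof -
  have red: "v (evQ g \<alpha>) \<le> Nv r" if "map_poly of_rat g = q * w + r" "Nv q = 0" for g q w r
  proof -
    have "v (evQ g \<alpha>) = Nv (q * w + r)" using Nv_rat[of g] that(1) by simp
    also have "\<dots> \<le> Nv q * Nv w + Nv r" using Nv_add[of "q * w" r] by (simp add: Nv_mult)
    finally show ?thesis using that(2) by simp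
  qed
  have ev: "evQ g \<beta> = poly (map_poly of_real (map_poly of_rat g)) \<beta>" for g
    by (simp add: evQ_def map_poly_map_poly o_def)
  show ?thesis
  proof (cases "Im \<beta> = 0")
    case True
    define q where "q = [:- Re \<beta>, 1:]"
    have "(cmod \<beta>)\<^sup>2 = Re \<beta> * Re \<beta>" using True unfolding cmod_power2 by (simp add: power2_eq_square)
    hence "quad \<beta> = q * q" by (simp add: quad_def q_def)
    hence q0: "Nv q = 0" using assms by (simp add: Nv_mult)
    have b: "\<beta> = of_real (Re \<beta>)" using True by (simp add: complex_eq_iff)
    have "v (evQ g \<alpha>) \<le> 1 * cmod (evQ g \<beta>)" for g
    proof -
      define P where "P = (map_poly of_rat g :: real poly)"
      define w where "w = synthetic_div P (Re \<beta>)"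
      have "P = q * w + [:poly P (Re \<beta>):]" using synthetic_div_correct'[of "Re \<beta>" P] by (simp add: q_def w_def)
      hence "v (evQ g \<alpha>) \<le> Nv [:poly P (Re \<beta>):]" using red q0 unfolding P_def by blast
      also have "\<dots> \<le> \<bar>poly P (Re \<beta>)\<bar>" using Nv_bound[of "[:poly P (Re \<beta>):]" 0] by simp
      also have "\<dots> = cmod (evQ g \<beta>)"
        by (subst ev, subst b) (simp add: P_def[symmetric] of_real_poly)
      finally show ?thesis by simp
    qed
    thus ?thesis by (rule that)
  next
    case False
    define C where "C = v \<alpha> / \<bar>Im \<beta>\<bar> + 1 + \<bar>Re \<beta>\<bar> / \<bar>Im \<beta>\<bar>"
    have "v (evQ g \<alpha>) \<le> C * cmod (evQ g \<beta>)" for g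
    proof -
      define P where "P = (map_poly of_rat g :: real poly)"
      define r where "r = P mod quad \<beta>"
      define A where "A = coeff r 1" define B where "B = coeff r 0"
      have q2: "degree (quad \<beta>) = 2" "quad \<beta> \<noteq> 0" by (simp_all add: quad_def)
      have dr: "degree r \<le> 1" using degree_mod_less[OF q2(2), of P] q2(1) unfolding r_def by fastforce
      have rAB: "r = [:B, A:]"
        using dr by (intro poly_eqI) (auto simp: A_def B_def coeff_pCons coeff_eq_0 split: nat.split)
      have P: "P = quad \<beta> * (P div quad \<beta>) + r" by (simp add: r_def)
      have "poly (map_poly complex_of_real (quad \<beta>)) \<beta> = 0" unfolding quad by simp
      moreover have "poly (map_poly complex_of_real P) \<beta> = poly (map_poly of_real (quad \<beta> * (P div quad \<beta>) + r)) \<beta>"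
        using P by simp
      moreover have "poly (map_poly complex_of_real [:B, A:]) \<beta> = of_real B + \<beta> * of_real A"
        by (cases "A = 0"; cases "B = 0") (simp_all add: map_poly_pCons)
      ultimately have "evQ g \<beta> = of_real B + \<beta> * of_real A"
        unfolding ev P_def[symmetric] by (simp add: of_real_poly rAB)
      hence re: "Re (evQ g \<beta>) = B + Re \<beta> * A" "Im (evQ g \<beta>) = Im \<beta> * A" by simp_all
      define z where "z = cmod (evQ g \<beta>)"
      have "\<bar>Im \<beta>\<bar> * \<bar>A\<bar> \<le> z" using abs_Im_le_cmod[of "evQ g \<beta>"] by (simp add: re z_def abs_mult)
      hence A: "\<bar>A\<bar> \<le> z / \<bar>Im \<beta>\<bar>" using False by (simp add: field_simps)
      have "\<bar>B\<bar> \<le> \<bar>B + Re \<beta> * A\<bar> + \<bar>Re \<beta>\<bar> * \<bar>A\<bar>" by (simp add: abs_mult[symmetric])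
      also have "\<dots> \<le> z + \<bar>Re \<beta>\<bar> * (z / \<bar>Im \<beta>\<bar>)"
        using abs_Re_le_cmod[of "evQ g \<beta>"] A by (intro add_mono mult_left_mono) (auto simp: re z_def)
      finally have B: "\<bar>B\<bar> \<le> z + \<bar>Re \<beta>\<bar> * (z / \<bar>Im \<beta>\<bar>)" .
      have "v (evQ g \<alpha>) \<le> Nv r" using red[OF P[unfolded P_def] assms] by (simp add: P_def)
      also have "\<dots> \<le> \<bar>B\<bar> + \<bar>A\<bar> * v \<alpha>" using Nv_bound[OF dr] by (simp add: rAB)
      also have "\<dots> \<le> (z + \<bar>Re \<beta>\<bar> * (z / \<bar>Im \<beta>\<bar>)) + z / \<bar>Im \<beta>\<bar> * v \<alpha>"
        using A B vb(8)[OF Qadj_gen] by (intro add_mono mult_right_mono) auto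
      also have "\<dots> = C * z" by (simp add: C_def field_simps)
      finally show ?thesis by (simp add: z_def)
    qed
    thus ?thesis by (rule that)
  qed
qed

theorem archimedean_place_is_embedding:
  assumes f: "Factorial_Ring.irreducible f" "lead_coeff f = 1" "evQ f \<alpha> = 0"
  obtains \<beta> where "evQ f \<beta> = 0" "\<And>g. v (evQ g \<alpha>) = cmod (evQ g \<beta>)"
proof -
  obtain \<beta> where b: "evQ f \<beta> = 0" "Nv (quad \<beta>) = 0" using vanishing_quad[OF f] .
  obtain C where C: "\<And>g. v (evQ g \<alpha>) \<le> C * cmod (evQ g \<beta>)" using v_le_const_times[OF b(2)] by blast
  have le: "v (evQ g \<alpha>) \<le> cmod (evQ g \<beta>)" for g
  proof (cases "evQ g \<beta> = 0")
    case True
    thus ?thesis using C[of g] by simp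
  next
    case False
    have "(v (evQ g \<alpha>) / cmod (evQ g \<beta>)) ^ k \<le> C" for k
    proof -
      have "v (evQ g \<alpha>) ^ k = v (evQ (g ^ k) \<alpha>)" using vb(6)[of "evQ g \<alpha>" k] by simp
      also have "\<dots> \<le> C * cmod (evQ g \<beta>) ^ k" using C[of "g ^ k"] by (simp add: norm_power)
      finally show ?thesis using False by (simp add: power_divide divide_le_eq)
    qed
    hence "v (evQ g \<alpha>) / cmod (evQ g \<beta>) \<le> 1" by (rule power_bounded_imp_le_one)
    thus ?thesis using False by (simp add: divide_le_eq)
  qed
  have "v (evQ g \<alpha>) = cmod (evQ g \<beta>)" for g
  proof (cases "evQ g \<alpha> = 0")
    case True
    hence "evQ g \<beta> = 0" using conjugate_root[OF f(1,3) b(1)] by blast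
    thus ?thesis using True vb(1) by simp
  next
    case False
    hence "\<not> f dvd g" using irreducible_root_iff[OF f(1,3)] by simp
    then obtain a h where ah: "a * f + h * g = 1" using rat_bezout f(1) by blast
    have "evQ (a * f + h * g) \<alpha> = 1" "evQ (a * f + h * g) \<beta> = 1" unfolding ah by simp_all
    hence 1: "evQ h \<alpha> * evQ g \<alpha> = 1" "evQ h \<beta> * evQ g \<beta> = 1" using f(3) b(1) by simp_all
    have "v (evQ h \<alpha>) * v (evQ g \<alpha>) = 1" using v_mult[of h g] vb(2) 1 by simp
    moreover have "cmod (evQ h \<beta>) * cmod (evQ g \<beta>) = 1" using 1(2) by (metis norm_mult norm_one)
    ultimately have "cmod (evQ h \<beta>) * cmod (evQ g \<beta>) = v (evQ h \<alpha>) * v (evQ g \<alpha>)" by simp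
    also have "\<dots> \<le> cmod (evQ h \<beta>) * v (evQ g \<alpha>)" using le vb(8) by (intro mult_right_mono) auto
    finally have "cmod (evQ g \<beta>) \<le> v (evQ g \<alpha>)"
      using \<open>cmod (evQ h \<beta>) * cmod (evQ g \<beta>) = 1\<close> by (metis mult_le_cancel_left_pos mult_zero_left norm_ge_zero order_le_less zero_neq_one)
    thus ?thesis using le[of g] by simp
  qed
  thus ?thesis using that b(1) by blast
qed

end

locale complex_place =
  fixes \<alpha> \<beta> :: complex and v :: "complex \<Rightarrow> real"
  assumes alg: "algebraic \<alpha>" and v\<beta>: "\<And>g. v (evQ g \<alpha>) = cmod (evQ g \<beta>)"
begin

abbreviation "F \<equiv> Qadj \<alpha>"

lemma F: "subfield F complex_field" using alg by (rule Qadj_subfield)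
lemmas FD = subfield_complexD[OF F]

definition \<sigma> :: "complex \<Rightarrow> complex" where "\<sigma> x = evQ (SOME g. x = evQ g \<alpha>) \<beta>"

lemma \<sigma>_evQ: "\<sigma> (evQ g \<alpha>) = evQ g \<beta>"
proof -
  define h where "h = (SOME h. evQ g \<alpha> = evQ h \<alpha>)"
  have h: "evQ g \<alpha> = evQ h \<alpha>" unfolding h_def by (rule someI[of _ g]) simp
  have "cmod (evQ (g - h) \<beta>) = v (evQ (g - h) \<alpha>)" by (simp only: v\<beta>)
  also have "\<dots> = v (evQ 0 \<alpha>)" using h by simp
  also have "\<dots> = 0" by (simp only: v\<beta>) simp
  finally have "evQ h \<beta> = evQ g \<beta>" by simp
  thus ?thesis by (simp add: \<sigma>_def h_def)
qed

lemma F_cases: "x \<in> F \<Longrightarrow> (\<And>g. x = evQ g \<alpha> \<Longrightarrow> thesis) \<Longrightarrow> thesis" by (auto simp: Qadj_def)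

lemma \<sigma>: "x \<in> F \<Longrightarrow> y \<in> F \<Longrightarrow> \<sigma> (x + y) = \<sigma> x + \<sigma> y" "x \<in> F \<Longrightarrow> y \<in> F \<Longrightarrow> \<sigma> (x * y) = \<sigma> x * \<sigma> y"
  "x \<in> F \<Longrightarrow> y \<in> F \<Longrightarrow> \<sigma> (x - y) = \<sigma> x - \<sigma> y" "x \<in> F \<Longrightarrow> \<sigma> (- x) = - \<sigma> x"
  "\<sigma> (of_rat q) = of_rat q" "\<sigma> \<alpha> = \<beta>" "x \<in> F \<Longrightarrow> v x = cmod (\<sigma> x)"
proof -
  show "x \<in> F \<Longrightarrow> y \<in> F \<Longrightarrow> \<sigma> (x + y) = \<sigma> x + \<sigma> y"
    using \<sigma>_evQ[of "g + h" for g h] by (auto simp: Qadj_def \<sigma>_evQ)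
  show "x \<in> F \<Longrightarrow> y \<in> F \<Longrightarrow> \<sigma> (x * y) = \<sigma> x * \<sigma> y"
    using \<sigma>_evQ[of "g * h" for g h] by (auto simp: Qadj_def \<sigma>_evQ)
  show "x \<in> F \<Longrightarrow> y \<in> F \<Longrightarrow> \<sigma> (x - y) = \<sigma> x - \<sigma> y"
    using \<sigma>_evQ[of "g - h" for g h] by (auto simp: Qadj_def \<sigma>_evQ)
  show "x \<in> F \<Longrightarrow> \<sigma> (- x) = - \<sigma> x"
    using \<sigma>_evQ[of "- g" for g] by (auto simp: Qadj_def \<sigma>_evQ)
  show "\<sigma> (of_rat q) = of_rat q" using \<sigma>_evQ[of "[:q:]"] by simp
  show "\<sigma> \<alpha> = \<beta>" using \<sigma>_evQ[of "[:0,1:]"] by simp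
  show "x \<in> F \<Longrightarrow> v x = cmod (\<sigma> x)" by (auto simp: Qadj_def \<sigma>_evQ v\<beta>)
qed

lemma \<sigma>_simps: "\<sigma> 0 = 0" "\<sigma> 1 = 1" using \<sigma>(5)[of 0] \<sigma>(5)[of 1] by simp_all

definition "CS = cauchy_ring F v"
definition "I = null_seqs F v"

lemma Cauchy_iff: "s \<in> cauchy_seqs F v \<longleftrightarrow> (\<forall>n. s n \<in> F) \<and> convergent (\<lambda>n. \<sigma> (s n))"
proof -
  have "(\<forall>e>0. \<exists>N. \<forall>m\<ge>N. \<forall>n\<ge>N. v (s m - s n) < e) \<longleftrightarrow> Cauchy (\<lambda>n. \<sigma> (s n))" if "\<forall>n. s n \<in> F"
  proof -
    have "v (s m - s n) = dist (\<sigma> (s m)) (\<sigma> (s n))" for m n using \<sigma>(3,7) FD(6) that by (simp add: dist_norm)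
    thus ?thesis by (simp add: Cauchy_def)
  qed
  thus ?thesis by (auto simp: cauchy_seqs_def Cauchy_convergent_iff)
qed

lemma null_iff: "s \<in> I \<longleftrightarrow> (\<forall>n. s n \<in> F) \<and> (\<lambda>n. \<sigma> (s n)) \<longlonglongrightarrow> 0"
  unfolding I_def null_seqs_def using \<sigma>(7) by (auto simp: tendsto_norm_zero_iff)

lemma CS_simps: "carrier CS = cauchy_seqs F v" "s \<otimes>\<^bsub>CS\<^esub> t = (\<lambda>n. s n * t n)" "s \<oplus>\<^bsub>CS\<^esub> t = (\<lambda>n. s n + t n)"
  "\<one>\<^bsub>CS\<^esub> = (\<lambda>n. 1)" "\<zero>\<^bsub>CS\<^esub> = (\<lambda>n. 0)"
  by (simp_all add: CS_def cauchy_ring_def)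

lemma Cauchy_closed:
  assumes "s \<in> cauchy_seqs F v" "t \<in> cauchy_seqs F v"
  shows "(\<lambda>n. s n + t n) \<in> cauchy_seqs F v" "(\<lambda>n. s n * t n) \<in> cauchy_seqs F v" "(\<lambda>n. - s n) \<in> cauchy_seqs F v"
  using assms FD by (auto simp: Cauchy_iff \<sigma> intro: convergent_add convergent_mult simp: convergent_minus_iff[symmetric])

lemma Cauchy_const: "x \<in> F \<Longrightarrow> (\<lambda>n. x) \<in> cauchy_seqs F v"
  by (simp add: Cauchy_iff convergent_const)

lemma cring_CS: "cring CS"
proof (rule cringI)
  show "abelian_group CS"
  proof (rule abelian_groupI)
    fix s assume s: "s \<in> carrier CS"
    show "\<exists>t\<in>carrier CS. t \<oplus>\<^bsub>CS\<^esub> s = \<zero>\<^bsub>CS\<^esub>"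
      using s Cauchy_closed(3)[of s s] by (intro bexI[of _ "\<lambda>n. - s n"]) (auto simp: CS_simps)
  qed (use FD(1) in \<open>auto simp: CS_simps Cauchy_closed Cauchy_const algebra_simps\<close>)
  show "Group.comm_monoid CS"
    by (rule comm_monoidI) (use FD(2) in \<open>auto simp: CS_simps Cauchy_closed Cauchy_const algebra_simps\<close>)
qed (auto simp: CS_simps algebra_simps)

sublocale CS: cring CS by (rule cring_CS)

lemma CS_a_inv: "s \<in> carrier CS \<Longrightarrow> \<ominus>\<^bsub>CS\<^esub> s = (\<lambda>n. - s n)"
  using CS.minus_equality[of "\<lambda>n. - s n" s] Cauchy_closed(3)[of s s] by (simp add: CS_simps)

lemma null_Cauchy: "s \<in> I \<Longrightarrow> s \<in> cauchy_seqs F v"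
  by (auto simp: null_iff Cauchy_iff convergent_def)

lemma ideal_I: "ideal I CS"
proof (rule idealI)
  show "ring CS" by (rule CS.ring_axioms)
  show "subgroup I (add_monoid CS)"
  proof (rule CS.add.subgroupI)
    show "I \<subseteq> carrier CS" using null_Cauchy by (auto simp: CS_simps)
    have "(\<lambda>n. 0) \<in> I" using FD(1) by (simp add: null_iff \<sigma>_simps)
    thus "I \<noteq> {}" by blast
    fix s assume s: "s \<in> I"
    have "(\<lambda>n. - s n) \<in> I" using s FD(5) tendsto_minus[of "\<lambda>n. \<sigma> (s n)" 0] by (auto simp: null_iff \<sigma>)
    thus "\<ominus>\<^bsub>CS\<^esub> s \<in> I" using CS_a_inv null_Cauchy[OF s] by (simp add: CS_simps)
    fix t assume t: "t \<in> I"
    show "s \<oplus>\<^bsub>CS\<^esub> t \<in> I" using s t FD(3) tendsto_add[of "\<lambda>n. \<sigma> (s n)" 0 _ "\<lambda>n. \<sigma> (t n)" 0] by (auto simp: null_iff \<sigma> CS_simps)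
  qed
  have *: "(\<lambda>n. s n * t n) \<in> I" if s: "s \<in> I" and t: "t \<in> cauchy_seqs F v" for s t
  proof -
    obtain l where "(\<lambda>n. \<sigma> (t n)) \<longlonglongrightarrow> l" using t by (auto simp: Cauchy_iff convergent_def)
    hence "(\<lambda>n. \<sigma> (s n) * \<sigma> (t n)) \<longlonglongrightarrow> 0 * l" using s by (intro tendsto_mult) (auto simp: null_iff)
    thus ?thesis using s t FD(4) by (auto simp: null_iff Cauchy_iff \<sigma>)
  qed
  show "x \<otimes>\<^bsub>CS\<^esub> a \<in> I" "a \<otimes>\<^bsub>CS\<^esub> x \<in> I" if "a \<in> I" "x \<in> carrier CS" for a x
    using *[of a x] that by (auto simp: CS_simps mult.commute)
qed

sublocale I: ideal I CS by (rule ideal_I)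

definition "C = CS Quot I"
definition \<pi> :: "(nat \<Rightarrow> complex) \<Rightarrow> (nat \<Rightarrow> complex) set" where "\<pi> = (\<lambda>s. I +>\<^bsub>CS\<^esub> s)"

lemma completion_C: "completion F v = C" by (simp add: completion_def C_def CS_def I_def)

lemma cring_C: "cring C" unfolding C_def by (rule I.quotient_is_cring[OF cring_CS])
sublocale C: cring C by (rule cring_C)

sublocale \<pi>: ring_hom_ring CS C \<pi> unfolding C_def \<pi>_def by (rule I.rcos_ring_hom_ring)

lemma carrier_C: "carrier C = \<pi> ` cauchy_seqs F v"
  by (auto simp: C_def \<pi>_def FactRing_def A_RCOSETS_def' CS_simps)

lemma \<pi>_eq:
  assumes "s \<in> cauchy_seqs F v" "t \<in> cauchy_seqs F v" "(\<lambda>n. \<sigma> (s n) - \<sigma> (t n)) \<longlonglongrightarrow> 0"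
  shows "\<pi> s = \<pi> t"
proof -
  have d: "(\<lambda>n. s n - t n) \<in> I" using assms FD(6) by (auto simp: null_iff Cauchy_iff \<sigma>)
  have "\<pi> s = \<pi> ((\<lambda>n. s n - t n) \<oplus>\<^bsub>CS\<^esub> t)" by (simp add: CS_simps)
  also have "\<dots> = \<pi> (\<lambda>n. s n - t n) \<oplus>\<^bsub>C\<^esub> \<pi> t"
    using null_Cauchy[OF d] assms by (intro \<pi>.hom_add) (auto simp: CS_simps)
  also have "\<pi> (\<lambda>n. s n - t n) = \<zero>\<^bsub>C\<^esub>" using d I.a_rcos_const[of "\<lambda>n. s n - t n"]
    by (simp add: \<pi>_def C_def FactRing_def)
  finally show ?thesis using assms carrier_C by simp
qed

lemma one_neq_zero_C: "\<one>\<^bsub>C\<^esub> \<noteq> \<zero>\<^bsub>C\<^esub>"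
proof
  assume "\<one>\<^bsub>C\<^esub> = \<zero>\<^bsub>C\<^esub>"
  hence "I +>\<^bsub>CS\<^esub> (\<lambda>n. 1) = I" by (simp add: C_def FactRing_def CS_simps)
  hence "(\<lambda>n. 1) \<in> I" using I.a_rcos_self[of "\<lambda>n. 1"] Cauchy_const FD(2) by (simp add: CS_simps)
  thus False by (simp add: null_iff \<sigma>_simps LIMSEQ_const_iff)
qed

definition "QS = cauchy_seqs \<rat> v"
definition "K = \<pi> ` QS"

lemma Rats_F: "x \<in> \<rat> \<Longrightarrow> x \<in> F" using FD(9) by (auto elim: Rats_cases)
lemma \<sigma>_Rats: "x \<in> \<rat> \<Longrightarrow> \<sigma> x = x" using \<sigma>(5) by (auto elim: Rats_cases)

lemma QS_iff: "s \<in> QS \<longleftrightarrow> (\<forall>n. s n \<in> \<rat>) \<and> convergent s"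
proof -
  have "s \<in> QS \<longleftrightarrow> (\<forall>n. s n \<in> \<rat>) \<and> s \<in> cauchy_seqs F v"
    unfolding QS_def cauchy_seqs_def using Rats_F by auto
  also have "\<dots> \<longleftrightarrow> (\<forall>n. s n \<in> \<rat>) \<and> convergent s"
    using \<sigma>_Rats Rats_F by (auto simp: Cauchy_iff)
  finally show ?thesis .
qed

lemma QS_Cauchy: "s \<in> QS \<Longrightarrow> s \<in> cauchy_seqs F v"
  using Rats_F unfolding QS_def cauchy_seqs_def by auto

lemma completion_Q_K: "completion_Q F v = K"
  by (auto simp: completion_Q_def K_def \<pi>_def QS_def CS_def I_def)

lemma subcring_K: "subcring K C"
proof -
  have "subring QS CS"
  proof (rule CS.subringI)
    show "QS \<subseteq> carrier CS" using QS_Cauchy by (auto simp: CS_simps)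
    show "\<one>\<^bsub>CS\<^esub> \<in> QS" by (simp add: CS_simps QS_iff convergent_const)
    show "\<ominus>\<^bsub>CS\<^esub> s \<in> QS" if "s \<in> QS" for s
      using that CS_a_inv[of s] QS_Cauchy[OF that] by (auto simp: CS_simps QS_iff convergent_minus_iff[symmetric])
  qed (auto simp: CS_simps QS_iff intro: convergent_add convergent_mult)
  hence "subring K C" unfolding K_def by (rule \<pi>.img_is_subring)
  thus ?thesis by (rule C.subcringI')
qed

lemma K_inverse:
  assumes "k \<in> K" "k \<noteq> \<zero>\<^bsub>C\<^esub>"
  shows "\<exists>k'\<in>K. k \<otimes>\<^bsub>C\<^esub> k' = \<one>\<^bsub>C\<^esub>"
proof -
  obtain s where s: "s \<in> QS" "k = \<pi> s" using assms(1) by (auto simp: K_def)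
  obtain l where l: "s \<longlonglongrightarrow> l" using s(1) by (auto simp: QS_iff convergent_def)
  have sQ: "s n \<in> \<rat>" for n using s(1) by (simp add: QS_iff)
  have "l \<noteq> 0"
  proof
    assume "l = 0"
    have "\<pi> s = \<pi> \<zero>\<^bsub>CS\<^esub>"
      using l \<open>l = 0\<close> sQ s(1) QS_Cauchy Cauchy_const FD(1) by (intro \<pi>_eq) (auto simp: CS_simps \<sigma>_Rats)
    thus False using assms(2) s(2) \<pi>.hom_zero by simp
  qed
  define t where "t = (\<lambda>n. inverse (s n))"
  have t: "t \<longlonglongrightarrow> inverse l" unfolding t_def using l \<open>l \<noteq> 0\<close> by (rule tendsto_inverse)
  hence tQ: "t \<in> QS" using sQ by (auto simp: QS_iff convergent_def t_def)
  have st: "(\<lambda>n. s n * t n) \<longlonglongrightarrow> 1" using tendsto_mult[OF l t] \<open>l \<noteq> 0\<close> by simp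
  have "\<pi> (s \<otimes>\<^bsub>CS\<^esub> t) = \<pi> \<one>\<^bsub>CS\<^esub>"
  proof (rule \<pi>_eq)
    show "s \<otimes>\<^bsub>CS\<^esub> t \<in> cauchy_seqs F v" using Cauchy_closed(2) s(1) tQ QS_Cauchy by (simp add: CS_simps)
    show "\<one>\<^bsub>CS\<^esub> \<in> cauchy_seqs F v" using Cauchy_const FD(2) by (simp add: CS_simps)
    have "\<sigma> (s n * t n) = s n * t n" for n using sQ by (intro \<sigma>_Rats) (auto simp: t_def)
    thus "(\<lambda>n. \<sigma> ((s \<otimes>\<^bsub>CS\<^esub> t) n) - \<sigma> (\<one>\<^bsub>CS\<^esub> n)) \<longlonglongrightarrow> 0"
      using tendsto_diff[OF st tendsto_const[of 1]] by (simp add: CS_simps \<sigma>_simps)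
  qed
  moreover have "\<pi> (s \<otimes>\<^bsub>CS\<^esub> t) = \<pi> s \<otimes>\<^bsub>C\<^esub> \<pi> t"
    by (rule \<pi>.hom_mult) (simp_all add: CS_simps(1) s(1) tQ QS_Cauchy)
  ultimately have "\<pi> s \<otimes>\<^bsub>C\<^esub> \<pi> t = \<one>\<^bsub>C\<^esub>" using \<pi>.hom_one by simp
  thus ?thesis using tQ s(2) by (auto simp: K_def)
qed

lemma subfield_K: "subfield K C"
proof (rule C.subfieldI[OF subcring_K])
  have K: "K \<subseteq> carrier C" "\<one>\<^bsub>C\<^esub> \<in> K" "\<zero>\<^bsub>C\<^esub> \<in> K" using subcringE[OF subcring_K] by auto
  show "Units (C\<lparr>carrier := K\<rparr>) = K - {\<zero>\<^bsub>C\<^esub>}"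
  proof
    show "Units (C\<lparr>carrier := K\<rparr>) \<subseteq> K - {\<zero>\<^bsub>C\<^esub>}"
    proof
      fix x assume "x \<in> Units (C\<lparr>carrier := K\<rparr>)"
      then obtain y where *: "x \<in> K" "y \<in> K" "y \<otimes>\<^bsub>C\<^esub> x = \<one>\<^bsub>C\<^esub>" by (auto simp: Units_def)
      have "x \<noteq> \<zero>\<^bsub>C\<^esub>" using * K one_neq_zero_C C.r_null by auto
      thus "x \<in> K - {\<zero>\<^bsub>C\<^esub>}" using * by simp
    qed
    show "K - {\<zero>\<^bsub>C\<^esub>} \<subseteq> Units (C\<lparr>carrier := K\<rparr>)"
    proof
      fix x assume x: "x \<in> K - {\<zero>\<^bsub>C\<^esub>}"
      then obtain y where y: "y \<in> K" "x \<otimes>\<^bsub>C\<^esub> y = \<one>\<^bsub>C\<^esub>" using K_inverse by blast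
      have "x \<in> carrier C" "y \<in> carrier C" using K(1) x y(1) by auto
      hence "y \<otimes>\<^bsub>C\<^esub> x = \<one>\<^bsub>C\<^esub>" using C.m_comm[of y x] y(2) by simp
      thus "x \<in> Units (C\<lparr>carrier := K\<rparr>)" using x y by (auto simp: Units_def)
    qed
  qed
qed

lemma rational_sequence: "\<exists>r\<in>QS. r \<longlonglongrightarrow> complex_of_real c"
proof -
  have "(\<lambda>k. complex_of_real (of_rat (rat_approx k c))) \<longlonglongrightarrow> of_real c" by (intro tendsto_of_real rat_approx_tendsto)
  thus ?thesis by (intro bexI[of _ "\<lambda>k. of_rat (rat_approx k c)"]) (auto simp: QS_iff convergent_def)
qed

lemma \<pi>_eqD:
  assumes "s \<in> cauchy_seqs F v" "t \<in> cauchy_seqs F v" "\<pi> s = \<pi> t"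
  shows "(\<lambda>n. \<sigma> (s n) - \<sigma> (t n)) \<longlonglongrightarrow> 0"
proof -
  have "s \<in> I +>\<^bsub>CS\<^esub> t" using I.a_rcos_self[of s] assms by (simp add: \<pi>_def CS_simps)
  then obtain u where u: "u \<in> I" "s = (\<lambda>n. u n + t n)" by (auto simp: a_r_coset_def' CS_simps)
  have "(\<lambda>n. \<sigma> (s n) - \<sigma> (t n)) = (\<lambda>n. \<sigma> (u n))"
    using u assms(2) by (auto simp: null_iff Cauchy_iff \<sigma>)
  thus ?thesis using u(1) by (simp add: null_iff)
qed

lemma Span_one: "C.Span K [\<one>\<^bsub>C\<^esub>] = K"
proof -
  have K: "K \<subseteq> carrier C" using subcringE[OF subcring_K] by auto
  have "C.Span K [\<one>\<^bsub>C\<^esub>] = {C.combine Ks [\<one>\<^bsub>C\<^esub>] | Ks. length Ks = length [\<one>\<^bsub>C\<^esub>] \<and> set Ks \<subseteq> K}"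
    by (rule C.Span_eq_combine_set_length_version[OF subfield_K]) auto
  also have "\<dots> = K"
  proof safe
    fix Ks assume "length Ks = length [\<one>\<^bsub>C\<^esub>]" "set Ks \<subseteq> K"
    then obtain k where "Ks = [k]" "k \<in> K" by (auto simp: length_Suc_conv)
    thus "C.combine Ks [\<one>\<^bsub>C\<^esub>] \<in> K" using K by auto
  next
    fix k assume "k \<in> K"
    thus "\<exists>Ks. k = C.combine Ks [\<one>\<^bsub>C\<^esub>] \<and> length Ks = length [\<one>\<^bsub>C\<^esub>] \<and> set Ks \<subseteq> K"
      using K by (intro exI[of _ "[k]"]) auto
  qed
  finally show ?thesis .
qed

lemma independent_one: "C.independent K [\<one>\<^bsub>C\<^esub>]"
  using one_neq_zero_C by (intro C.li_Cons) auto

lemma local_degreeI: "C.independent K Us \<Longrightarrow> C.Span K Us = carrier C \<Longrightarrow> local_degree F v = length Us"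
  using C.dimI[OF subfield_K C.dimensionI[OF subfield_K]]
  unfolding local_degree_def completion_C completion_Q_K over_def by blast

lemma \<pi>_in_K:
  assumes "s \<in> cauchy_seqs F v" "(\<lambda>n. \<sigma> (s n)) \<longlonglongrightarrow> complex_of_real c"
  shows "\<pi> s \<in> K"
proof -
  obtain r where r: "r \<in> QS" "r \<longlonglongrightarrow> complex_of_real c" using rational_sequence by blast
  have "(\<lambda>n. \<sigma> (s n) - r n) \<longlonglongrightarrow> 0" using tendsto_diff[OF assms(2) r(2)] by simp
  moreover have "r n \<in> \<rat>" for n using r(1) by (simp add: QS_iff)
  ultimately have "\<pi> s = \<pi> r" using assms(1) QS_Cauchy[OF r(1)] by (intro \<pi>_eq) (auto simp: \<sigma>_Rats)
  thus ?thesis using r(1) by (simp add: K_def)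
qed

lemma real_evQ: "Im \<beta> = 0 \<Longrightarrow> Im (evQ g \<beta>) = 0"
proof -
  assume "Im \<beta> = 0"
  hence "cnj \<beta> = \<beta>" by (simp add: complex_eq_iff)
  have "cnj (evQ g \<beta>) = evQ g (cnj \<beta>)" by (induction g) (auto simp: cnj_of_rat)
  hence "cnj (evQ g \<beta>) = evQ g \<beta>" using \<open>cnj \<beta> = \<beta>\<close> by simp
  thus "Im (evQ g \<beta>) = 0" by (metis Reals_cnj_iff complex_is_Real_iff)
qed

lemma local_degree_real:
  assumes "Im \<beta> = 0" shows "local_degree F v = 1"
proof -
  have "carrier C \<subseteq> K"
  proof
    fix x assume "x \<in> carrier C"
    then obtain s where s: "s \<in> cauchy_seqs F v" "x = \<pi> s" by (auto simp: carrier_C)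
    then obtain z where z: "(\<lambda>n. \<sigma> (s n)) \<longlonglongrightarrow> z" by (auto simp: Cauchy_iff convergent_def)
    have "Im (\<sigma> (s n)) = 0" for n
    proof -
      have "s n \<in> F" using s(1) by (simp add: Cauchy_iff)
      thus ?thesis using real_evQ[OF assms] by (auto simp: Qadj_def \<sigma>_evQ)
    qed
    hence "Im z = 0" using tendsto_Im[OF z] by (simp add: LIMSEQ_const_iff)
    hence "z = of_real (Re z)" by (simp add: complex_eq_iff)
    thus "x \<in> K" using \<pi>_in_K[OF s(1)] z s(2) by metis
  qed
  moreover have "K \<subseteq> carrier C" using subcringE[OF subcring_K] by auto
  ultimately have "C.Span K [\<one>\<^bsub>C\<^esub>] = carrier C" using Span_one by auto
  from local_degreeI[OF independent_one this] show ?thesis by simp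
qed

lemma local_degree_complex:
  assumes "Im \<beta> \<noteq> 0" shows "local_degree F v = 2"
proof -
  define a where "a = \<pi> (\<lambda>n. \<alpha>)"
  have aC: "(\<lambda>n. \<alpha>) \<in> cauchy_seqs F v" by (rule Cauchy_const) simp
  have a: "a \<in> carrier C" using aC by (simp add: a_def carrier_C)
  have K: "K \<subseteq> carrier C" using subcringE[OF subcring_K] by auto
  have "a \<notin> K"
  proof
    assume "a \<in> K"
    then obtain r where r: "r \<in> QS" "a = \<pi> r" by (auto simp: K_def)
    have rQ: "r n \<in> \<rat>" for n using r(1) by (simp add: QS_iff)
    have "(\<lambda>n. \<beta> - r n) \<longlonglongrightarrow> 0" using \<pi>_eqD[OF aC QS_Cauchy[OF r(1)]] r(2) rQ
      by (simp add: a_def \<sigma> \<sigma>_Rats)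
    hence "(\<lambda>n. Im (\<beta> - r n)) \<longlonglongrightarrow> 0" using tendsto_Im by fastforce
    moreover have "Im (r n) = 0" for n using rQ[of n] by (metis Rats_cases cnj_of_rat Reals_cnj_iff complex_is_Real_iff)
    ultimately show False using assms by (simp add: LIMSEQ_const_iff)
  qed
  hence ind: "C.independent K [a, \<one>\<^bsub>C\<^esub>]" using a Span_one by (intro C.li_Cons[OF _ _ independent_one]) auto
  have "carrier C \<subseteq> C.Span K [a, \<one>\<^bsub>C\<^esub>]"
  proof
    fix x assume "x \<in> carrier C"
    then obtain s where s: "s \<in> cauchy_seqs F v" "x = \<pi> s" by (auto simp: carrier_C)
    then obtain z where z: "(\<lambda>n. \<sigma> (s n)) \<longlonglongrightarrow> z" by (auto simp: Cauchy_iff convergent_def)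
    define u where "u = Im z / Im \<beta>"
    define w where "w = Re z - u * Re \<beta>"
    have zz: "z = of_real u * \<beta> + of_real w" using assms by (simp add: complex_eq_iff u_def w_def)
    obtain r where r: "r \<in> QS" "r \<longlonglongrightarrow> complex_of_real u" using rational_sequence by blast
    obtain t where t: "t \<in> QS" "t \<longlonglongrightarrow> complex_of_real w" using rational_sequence by blast
    have rtQ: "r n \<in> \<rat>" "t n \<in> \<rat>" for n using r(1) t(1) by (simp_all add: QS_iff)
    have rtC: "r \<in> cauchy_seqs F v" "t \<in> cauchy_seqs F v" using r(1) t(1) QS_Cauchy by auto
    have ra: "(\<lambda>n. r n * \<alpha>) \<in> cauchy_seqs F v" using Cauchy_closed(2)[OF rtC(1) aC] .
    have "\<sigma> (r n * \<alpha> + t n) = r n * \<beta> + t n" for n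
      using rtQ[of n] Rats_F FD(4) by (simp add: \<sigma> \<sigma>_Rats)
    moreover have "(\<lambda>n. \<sigma> (s n) - (r n * \<beta> + t n)) \<longlonglongrightarrow> z - (of_real u * \<beta> + of_real w)"
      by (intro tendsto_intros z r t)
    ultimately have "(\<lambda>n. \<sigma> (s n) - \<sigma> (r n * \<alpha> + t n)) \<longlonglongrightarrow> 0" by (simp add: zz)
    hence "x = \<pi> (\<lambda>n. r n * \<alpha> + t n)"
      unfolding s(2) using s(1) Cauchy_closed(1)[OF ra rtC(2)] by (intro \<pi>_eq) auto
    also have "\<dots> = \<pi> ((r \<otimes>\<^bsub>CS\<^esub> (\<lambda>n. \<alpha>)) \<oplus>\<^bsub>CS\<^esub> t)" by (simp add: CS_simps)
    also have "\<dots> = \<pi> r \<otimes>\<^bsub>C\<^esub> a \<oplus>\<^bsub>C\<^esub> \<pi> t"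
    proof -
      have "\<pi> ((r \<otimes>\<^bsub>CS\<^esub> (\<lambda>n. \<alpha>)) \<oplus>\<^bsub>CS\<^esub> t) = \<pi> (r \<otimes>\<^bsub>CS\<^esub> (\<lambda>n. \<alpha>)) \<oplus>\<^bsub>C\<^esub> \<pi> t"
        by (rule \<pi>.hom_add) (use ra rtC in \<open>simp_all add: CS_simps(1,2)\<close>)
      moreover have "\<pi> (r \<otimes>\<^bsub>CS\<^esub> (\<lambda>n. \<alpha>)) = \<pi> r \<otimes>\<^bsub>C\<^esub> a"
        unfolding a_def by (rule \<pi>.hom_mult) (use rtC aC in \<open>simp_all add: CS_simps(1)\<close>)
      ultimately show ?thesis by simp
    qed
    finally have x: "x = \<pi> r \<otimes>\<^bsub>C\<^esub> a \<oplus>\<^bsub>C\<^esub> \<pi> t" .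
    have rt: "\<pi> r \<in> K" "\<pi> t \<in> K" using r t by (auto simp: K_def)
    have "x = C.combine [\<pi> r, \<pi> t] [a, \<one>\<^bsub>C\<^esub>]" using x rt K a by auto
    thus "x \<in> C.Span K [a, \<one>\<^bsub>C\<^esub>]"
      using rt a by (subst C.Span_eq_combine_set[OF subfield_K]) (auto simp del: C.combine.simps intro!: exI[of _ "[\<pi> r, \<pi> t]"])
  qed
  moreover have "C.Span K [a, \<one>\<^bsub>C\<^esub>] \<subseteq> carrier C"
    using a C.Span_in_carrier[OF K, of "[a, \<one>\<^bsub>C\<^esub>]"] by auto
  ultimately show ?thesis using local_degreeI[OF ind] by auto
qed

lemma local_degree_eq: "local_degree F v = card {\<beta>, cnj \<beta>}"
proof (cases "Im \<beta> = 0")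
  case True
  hence "cnj \<beta> = \<beta>" by (simp add: complex_eq_iff)
  thus ?thesis using local_degree_real[OF True] by simp
next
  case False
  hence "cnj \<beta> \<noteq> \<beta>" by (simp add: complex_eq_iff)
  thus ?thesis using local_degree_complex[OF False] by (simp add: card_insert_if)
qed

end

lemma cmod_reflect:
  "(cmod (x - a * y))\<^sup>2 - (cmod (y - cnj a * x))\<^sup>2 = (1 - (cmod a)\<^sup>2) * ((cmod x)\<^sup>2 - (cmod y)\<^sup>2)"
  unfolding cmod_power2 by (simp add: power2_eq_square algebra_simps)

definition norm2 :: "nat \<Rightarrow> complex poly \<Rightarrow> real" where "norm2 m p = (\<Sum>i\<le>m. (cmod (coeff p i))\<^sup>2)"

lemma norm2_reflect_factor:
  assumes "degree q < m"
  shows "norm2 m ([:-a, 1:] * q) = norm2 m ([:1, - cnj a:] * q)"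
proof -
  define x where "x = (\<lambda>i. coeff (pCons 0 q) i)"
  have x: "x 0 = 0" "x (Suc i) = coeff q i" for i by (simp_all add: x_def)
  have "norm2 m ([:-a, 1:] * q) - norm2 m ([:1, - cnj a:] * q) =
    (\<Sum>i\<le>m. (cmod (x i - a * x (Suc i)))\<^sup>2 - (cmod (x (Suc i) - cnj a * x i))\<^sup>2)"
    unfolding norm2_def sum_subtractf[symmetric]
    by (intro sum.cong refl arg_cong2[where f = "(-)"] arg_cong[where f = "\<lambda>z. (cmod z)\<^sup>2"]) (simp_all add: x_def coeff_pCons split: nat.split)
  also have "\<dots> = (1 - (cmod a)\<^sup>2) * (\<Sum>i\<le>m. (cmod (x i))\<^sup>2 - (cmod (x (Suc i)))\<^sup>2)"
    unfolding cmod_reflect by (simp add: sum_distrib_left)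
  also have "(\<Sum>i\<le>m. (cmod (x i))\<^sup>2 - (cmod (x (Suc i)))\<^sup>2) = (cmod (x 0))\<^sup>2 - (cmod (x (Suc m)))\<^sup>2"
    by (rule sum_telescope)
  also have "\<dots> = 0" using assms by (simp add: x coeff_eq_0)
  finally show ?thesis by simp
qed

lemma norm2_reflect_prod:
  assumes "finite Z" "degree q + card Z \<le> m"
  shows "norm2 m (q * (\<Prod>z\<in>Z. [:-z, 1:])) = norm2 m (q * (\<Prod>z\<in>Z. if cmod z \<le> 1 then [:-z, 1:] else [:1, - cnj z:]))"
  using assms
proof (induction Z arbitrary: q rule: finite_induct)
  case (insert a Z)
  define P where "P = (\<Prod>z\<in>Z. [:-z, 1:] :: complex poly)"
  define P' where "P' = (\<Prod>z\<in>Z. if cmod z \<le> 1 then [:-z, 1:] else [:1, - cnj z:] :: complex poly)"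
  define L where "L = (if cmod a \<le> 1 then [:-a, 1:] else [:1, - cnj a:])"
  have dP: "degree P = card Z" unfolding P_def using degree_prod_linear[OF insert.hyps(1), of "\<lambda>z. z"] by simp
  have "degree (q * P) < m" using degree_mult_le[of q P] dP insert by simp
  hence "norm2 m ([:-a, 1:] * (q * P)) = norm2 m (L * (q * P))"
    using norm2_reflect_factor by (auto simp: L_def)
  also have "L * (q * P) = (L * q) * P" by (simp only: mult.assoc)
  also have "norm2 m ((L * q) * P) = norm2 m ((L * q) * P')"
  proof -
    have "degree L \<le> 1" by (simp add: L_def)
    hence "degree (L * q) \<le> degree q + 1" using degree_mult_le[of L q] by linarith
    thus ?thesis unfolding P_def P'_def using insert.prems insert.hyps by (intro insert.IH) simp
  qed
  finally have *: "norm2 m ([:-a, 1:] * (q * P)) = norm2 m ((L * q) * P')" .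
  have "q * (\<Prod>z\<in>insert a Z. [:-z, 1:]) = [:-a, 1:] * (q * P)"
    unfolding prod.insert[OF insert.hyps] P_def[symmetric] by (simp only: mult_ac)
  moreover have "q * (\<Prod>z\<in>insert a Z. if cmod z \<le> 1 then [:-z, 1:] else [:1, - cnj z:]) = (L * q) * P'"
    unfolding prod.insert[OF insert.hyps] P'_def[symmetric] L_def[symmetric] by (simp only: mult_ac)
  ultimately show ?case using * by (simp only:)
qed simp

lemma Landau_inequality:
  assumes "finite Z"
  shows "(\<Prod>z\<in>Z. max 1 (cmod z))\<^sup>2 \<le> norm2 (card Z) (\<Prod>z\<in>Z. [:-z, 1:])"
proof -
  define P' where "P' = (\<Prod>z\<in>Z. if cmod z \<le> 1 then [:-z, 1:] else [:1, - cnj z:] :: complex poly)"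
  have "degree P' = (\<Sum>z\<in>Z. degree (if cmod z \<le> 1 then [:-z, 1:] else [:1, - cnj z:]))"
    unfolding P'_def by (intro degree_prod_eq_sum_degree) auto
  also have "\<dots> = card Z" by (subst sum.cong[of Z Z _ "\<lambda>_. 1"]) auto
  finally have d: "degree P' = card Z" .
  have "lead_coeff P' = (\<Prod>z\<in>Z. lead_coeff (if cmod z \<le> 1 then [:-z, 1:] else [:1, - cnj z:]))"
    unfolding P'_def by (rule lead_coeff_prod)
  hence "cmod (lead_coeff P') = (\<Prod>z\<in>Z. cmod (lead_coeff (if cmod z \<le> 1 then [:-z, 1:] else [:1, - cnj z:])))"
    by (simp add: prod_norm)
  also have "\<dots> = (\<Prod>z\<in>Z. max 1 (cmod z))" by (intro prod.cong) (auto simp: max_def)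
  finally have "(\<Prod>z\<in>Z. max 1 (cmod z))\<^sup>2 = (cmod (coeff P' (card Z)))\<^sup>2" using d by simp
  also have "\<dots> \<le> norm2 (card Z) P'" unfolding norm2_def by (intro member_le_sum) auto
  also have "\<dots> = norm2 (card Z) (\<Prod>z\<in>Z. [:-z, 1:])"
    using norm2_reflect_prod[OF assms, of 1 "card Z"] by (simp add: P'_def)
  finally show ?thesis .
qed

lemma mahler_measure_bound:
  fixes N :: real
  assumes "finite Z" "\<And>i. cmod (coeff (\<Prod>z\<in>Z. [:-z, 1:]) i) \<le> N" "N \<ge> 0"
  shows "(\<Prod>z\<in>Z. max 1 (cmod z)) \<le> (card Z + 1) * N"
proof -
  have "(\<Prod>z\<in>Z. max 1 (cmod z))\<^sup>2 \<le> (\<Sum>i\<le>card Z. N\<^sup>2)"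
    using Landau_inequality[OF assms(1)] unfolding norm2_def
    by (rule order.trans) (intro sum_mono power_mono assms, auto)
  also have "\<dots> = (card Z + 1) * N\<^sup>2" by simp
  also have "\<dots> \<le> ((card Z + 1) * N)\<^sup>2" unfolding power_mult_distrib
    by (intro mult_right_mono) (auto simp: power2_eq_square)
  finally show ?thesis by (rule power2_le_imp_le) (use assms in auto)
qed

definition arch_places :: "complex set \<Rightarrow> (complex \<Rightarrow> real) set" where
  "arch_places F = {v \<in> places F. \<forall>q. v (of_rat q) = \<bar>of_rat q\<bar>}"

lemma place_ge_one_archimedean:
  assumes "v \<in> places F" "subfield F complex_field" "x \<in> F" "algebraic_int x" "v \<notin> arch_places F"
  shows "v x \<le> 1"
proof -
  obtain w where w: "w \<in> standard_abs_Q" "\<And>q. v (of_rat q) = w q" using assms(1) by (auto simp: places_def)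
  have "w \<noteq> (\<lambda>q. \<bar>of_rat q\<bar>)" using w(2) assms(1,5) by (auto simp: arch_places_def)
  then obtain p where p: "w = padic_abs p" "Factorial_Ring.prime p" using w(1) by (auto simp: standard_abs_Q_def)
  have "v (of_int j) \<le> 1" for j using w(2)[of "of_int j"] padic_abs_of_int[OF p(2), of j] p(1) by simp
  thus ?thesis using nonarchimedean_place_integral[of F v x] assms by (auto simp: places_def)
qed

theorem weil_height_le:
  assumes h: "lead_coeff h = 1" "Factorial_Ring.irreducible (map_poly rat_of_int h)" "evZ h \<alpha> = 0"
    and N: "\<And>i. \<bar>coeff h i\<bar> \<le> int N"
  shows "weil_height \<alpha> \<le> ln ((degree h + 1) * N) / degree h"
proof -
  define d where "d = degree h"
  have d0: "d > 0" using irreducible_degree_pos[OF h(2)] by (simp add: d_def)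
  have int: "algebraic_int \<alpha>" using h algebraic_int_iff_evZ by blast
  have alg: "algebraic \<alpha>" using int by (rule algebraic_int_imp_algebraic)
  define f where "f = map_poly rat_of_int h"
  have f: "Factorial_Ring.irreducible f" "lead_coeff f = 1" "evQ f \<alpha> = 0" "degree f = d"
    using h by (simp_all add: f_def d_def)
  define F where "F = Qadj \<alpha>"
  have F: "subfield F complex_field" unfolding F_def by (rule Qadj_subfield[OF alg])
  have \<alpha>F: "\<alpha> \<in> F" by (simp add: F_def)
  define Z where "Z = {z. evQ f z = 0}"
  have Z: "finite Z" "card Z = d" "map_poly of_rat f = (\<Prod>z\<in>Z. [:-z, 1::complex:])"
    using card_roots_irreducible[OF f(1)] f(2,4) by (simp_all add: Z_def)
  define A where "A = arch_places F"
  have ex: "\<exists>\<beta>. evQ f \<beta> = 0 \<and> (\<forall>g. v (evQ g \<alpha>) = cmod (evQ g \<beta>))" if v: "v \<in> A" for v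
  proof -
    interpret archimedean_absolute_value \<alpha> v
      by unfold_locales (use v alg in \<open>auto simp: A_def arch_places_def places_def F_def\<close>)
    show ?thesis using archimedean_place_is_embedding[OF f(1-3)] by metis
  qed
  then obtain b where b: "\<And>v. v \<in> A \<Longrightarrow> evQ f (b v) = 0" "\<And>v g. v \<in> A \<Longrightarrow> v (evQ g \<alpha>) = cmod (evQ g (b v))" by metis
  define B where "B = (\<lambda>v. {b v, cnj (b v)})"
  have cnj: "cnj (evQ g z) = evQ g (cnj z)" for g z by (induction g) (auto simp: cnj_of_rat)
  have vB: "v (evQ g \<alpha>) = cmod (evQ g z)" if "v \<in> A" "z \<in> B v" for v z g
    using that b(2)[OF that(1)] cnj[of g "b v", symmetric] by (auto simp: B_def)
  have BZ: "B v \<subseteq> Z" if "v \<in> A" for v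
    using b(1)[OF that] cnj[of f "b v", symmetric] by (auto simp: B_def Z_def)
  have disj: "v = w" if "v \<in> A" "w \<in> A" "z \<in> B v" "z \<in> B w" for v w z
  proof
    fix x
    show "v x = w x"
    proof (cases "x \<in> F")
      case True
      thus ?thesis using vB[OF that(1,3)] vB[OF that(2,4)] by (auto simp: F_def Qadj_def)
    next
      case False
      thus ?thesis using that(1,2) by (auto simp: A_def arch_places_def places_def extensional_def)
    qed
  qed
  have "inj_on b A" using disj by (intro inj_onI) (auto simp: B_def)
  moreover have "b ` A \<subseteq> Z" using b(1) by (auto simp: Z_def)
  ultimately have finA: "finite A" using Z(1) by (rule inj_on_finite)
  have ld: "real (local_degree F v) * ln (max 1 (v \<alpha>)) = (\<Sum>z\<in>B v. ln (max 1 (cmod z)))" if v: "v \<in> A" for v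
  proof -
    interpret complex_place \<alpha> "b v" v
      by unfold_locales (use alg b(2)[OF v] in auto)
    have "ln (max 1 (cmod z)) = ln (max 1 (v \<alpha>))" if "z \<in> B v" for z
      using vB[OF v that, of "[:0,1:]"] by simp
    hence "(\<Sum>z\<in>B v. ln (max 1 (cmod z))) = real (card (B v)) * ln (max 1 (v \<alpha>))" by simp
    thus ?thesis using local_degree_eq by (simp add: F_def B_def)
  qed
  have "(\<Sum>\<^sub>\<infinity>v\<in>places F. real (local_degree F v) * ln (max 1 (v \<alpha>))) = (\<Sum>\<^sub>\<infinity>v\<in>A. real (local_degree F v) * ln (max 1 (v \<alpha>)))"
  proof (rule infsum_cong_neutral)
    fix v assume "v \<in> places F - A"
    hence "v \<alpha> \<le> 1" using place_ge_one_archimedean[OF _ F \<alpha>F int] by (simp add: A_def)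
    thus "real (local_degree F v) * ln (max 1 (v \<alpha>)) = 0" by (simp add: max_def)
  qed (auto simp: A_def arch_places_def)
  also have "\<dots> = (\<Sum>v\<in>A. real (local_degree F v) * ln (max 1 (v \<alpha>)))" using finA by simp
  also have "\<dots> = (\<Sum>v\<in>A. \<Sum>z\<in>B v. ln (max 1 (cmod z)))" using ld by (intro sum.cong) auto
  also have "\<dots> = (\<Sum>z\<in>(\<Union>v\<in>A. B v). ln (max 1 (cmod z)))"
    using finA disj by (intro sum.UNION_disjoint[symmetric]) (auto simp: B_def)
  also have "\<dots> \<le> (\<Sum>z\<in>Z. ln (max 1 (cmod z)))" using BZ Z(1) by (intro sum_mono2) auto
  also have "\<dots> = ln (\<Prod>z\<in>Z. max 1 (cmod z))" using Z(1) by (subst ln_prod) auto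
  also have "\<dots> \<le> ln ((d + 1) * N)"
  proof -
    have "cmod (coeff (\<Prod>z\<in>Z. [:-z, 1:]) i) \<le> real N" for i
    proof -
      have "coeff (\<Prod>z\<in>Z. [:-z, 1:]) i = complex_of_int (coeff h i)"
        unfolding Z(3)[symmetric] f_def by (simp add: coeff_map_poly)
      hence "cmod (coeff (\<Prod>z\<in>Z. [:-z, 1:]) i) = of_int \<bar>coeff h i\<bar>" by simp
      also have "\<dots> \<le> of_int (int N)" using N[of i] by (simp only: of_int_le_iff)
      finally show ?thesis by simp
    qed
    hence "(\<Prod>z\<in>Z. max 1 (cmod z)) \<le> (d + 1) * N" using mahler_measure_bound[OF Z(1), of N] Z(2) by (simp add: algebra_simps)
    moreover have "(\<Prod>z\<in>Z. max 1 (cmod z)) > 0" by (intro prod_pos) auto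
    ultimately show ?thesis by (intro ln_mono) auto
  qed
  finally have S: "(\<Sum>\<^sub>\<infinity>v\<in>places F. real (local_degree F v) * ln (max 1 (v \<alpha>))) \<le> ln ((d + 1) * N)" .
  have "degree_over_Q F = d" unfolding F_def using degree_over_Q_Qadj[OF f(1,3)] f(4) by simp
  hence "weil_height \<alpha> = 1 / real d * (\<Sum>\<^sub>\<infinity>v\<in>places F. real (local_degree F v) * ln (max 1 (v \<alpha>)))"
    by (simp add: weil_height_def height_in_def generate_field_eq_Qadj[OF alg] F_def)
  also have "\<dots> \<le> 1 / real d * ln ((d + 1) * N)" using S d0 by (intro mult_left_mono) auto
  finally show ?thesis by (simp add: d_def)
qed

text \<open>tower\<close>

primrec tower_exp :: "nat \<Rightarrow> nat \<Rightarrow> nat" where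
  "tower_exp D 0 = 0" | "tower_exp D (Suc k) = D * tower_exp D k + 1"

primrec tower_poly :: "nat \<Rightarrow> nat \<Rightarrow> nat \<Rightarrow> int poly" where
  "tower_poly p D 0 = [:0, 1:]"
| "tower_poly p D (Suc k) = (\<Prod>c<D. tower_poly p D k - [:int (c * p ^ tower_exp D k):])"

lemma tower_exp_eq: "(D - 1) * tower_exp D k + 1 = D ^ k" if "D > 0"
proof (induction k)
  case (Suc k)
  have "D ^ Suc k = D * ((D - 1) * tower_exp D k + 1)" by (simp only: power_Suc Suc.IH)
  also have "\<dots> = (D - 1) * tower_exp D (Suc k) + 1" using that by (cases D) (auto simp: algebra_simps)
  finally show ?case by simp
qed simp

lemma tower_poly_monic: "D > 0 \<Longrightarrow> lead_coeff (tower_poly p D k) = 1 \<and> degree (tower_poly p D k) = D ^ k"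
proof (induction k)
  case (Suc k)
  define a where "a = (\<lambda>c. [:int (c * p ^ tower_exp D k):])"
  have G: "lead_coeff (tower_poly p D k) = 1" "degree (tower_poly p D k) = D ^ k" using Suc by auto
  have pos: "0 < D ^ k" using Suc.prems by simp
  have d: "degree (tower_poly p D k - a c) = D ^ k" for c
  proof -
    have "degree (- a c) < degree (tower_poly p D k)" using G(2) pos by (simp add: a_def)
    from degree_add_eq_left[OF this] show ?thesis using G(2) by simp
  qed
  have l: "lead_coeff (tower_poly p D k - a c) = 1" for c
  proof -
    have "coeff (a c) (D ^ k) = 0" using pos by (intro coeff_eq_0) (simp add: a_def)
    thus ?thesis unfolding d using G by simp
  qed
  have nz: "tower_poly p D k - a c \<noteq> 0" for c using l[of c] by auto
  have t: "tower_poly p D (Suc k) = (\<Prod>c<D. tower_poly p D k - a c)" by (simp add: a_def)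
  have "degree (tower_poly p D (Suc k)) = (\<Sum>c<D. D ^ k)"
    unfolding t using nz d by (subst degree_prod_eq_sum_degree) auto
  moreover have "lead_coeff (tower_poly p D (Suc k)) = 1"
    unfolding t lead_coeff_prod using l by (intro prod.neutral) blast
  ultimately show ?case by simp
qed simp

lemma tower_padic:
  assumes p: "Factorial_Ring.prime p" and D: "0 < D" "D \<le> p" and K: "K > 0"
    and \<alpha>: "algebraic_int \<alpha>" "evZ f \<alpha> = 0" and cong: "\<And>i. int p ^ tower_exp D K dvd coeff (f - tower_poly p D K) i"
  shows "\<alpha> \<in> padic_ints p"
proof -
  have p0: "p > 0" using prime_gt_0_nat[OF p] .
  define g where "g = (\<Prod>c<D. [:- int c, 1:])"
  have "g = (\<Prod>c\<in>{..<D}. [:- int c, 1:]) + smult (int p) 0" by (simp add: g_def)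
  then obtain q s where qs: "[:0, 1:] ^ p - [:0, 1:] = g * q + smult (int p) s"
    using split_mod_p_dvd_frobenius[OF p, of "{..<D}" g 0] D(2) by auto
  obtain r where r: "f - tower_poly p D K = smult (int p ^ tower_exp D K) r" using poly_dvd_imp_smult[OF cong] .
  define x where "x = (\<lambda>k. evZ (tower_poly p D k) \<alpha> / of_nat p ^ tower_exp D k)"
  have x0: "x 0 = \<alpha>" by (simp add: x_def)
  have step: "evZ g (x k) = of_nat p * x (Suc k)" for k
  proof -
    have "evZ g (x k) = (\<Prod>c<D. (evZ (tower_poly p D k) \<alpha> - of_nat c * of_nat p ^ tower_exp D k) / of_nat p ^ tower_exp D k)"
      using p0 by (simp add: g_def x_def diff_divide_distrib)
    also have "\<dots> = evZ (tower_poly p D (Suc k)) \<alpha> / of_nat p ^ (D * tower_exp D k)"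
      by (simp add: prod_dividef power_mult[symmetric] mult.commute)
    also have "\<dots> = of_nat p * x (Suc k)" using p0 by (simp add: x_def)
    finally show ?thesis .
  qed
  have xK: "x K = - evZ r \<alpha>"
  proof -
    have "evZ (f - tower_poly p D K) \<alpha> = of_nat p ^ tower_exp D K * evZ r \<alpha>" unfolding r by simp
    hence "- evZ (tower_poly p D K) \<alpha> = of_nat p ^ tower_exp D K * evZ r \<alpha>" using \<alpha>(2) by simp
    from arg_cong[OF this, of uminus]
    have "evZ (tower_poly p D K) \<alpha> = of_nat p ^ tower_exp D K * (- evZ r \<alpha>)" by simp
    thus ?thesis unfolding x_def using p0 by simp
  qed
  have g1: "lead_coeff g = 1" unfolding g_def by (rule lead_coeff_prod_linear)
  have gd: "degree g = D" unfolding g_def using degree_prod_linear[of "{..<D}" int] by simp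
  have alg: "algebraic_int (x (K - j))" if "j \<le> K" for j
    using that
  proof (induction j)
    case 0
    thus ?case using xK \<alpha>(1) algebraic_int_evZ by simp
  next
    case (Suc j)
    hence S: "Suc (K - Suc j) = K - j" by simp
    have "algebraic_int (of_nat p * x (K - j))" using Suc by (intro algebraic_int_mult algebraic_int_of_nat) simp
    hence "algebraic_int (evZ g (x (K - Suc j)))" using step[of "K - Suc j"] S by simp
    thus ?case unfolding evZ_def
      by (rule algebraic_int_root) (use g1 gd D in auto)
  qed
  have alg': "algebraic_int (x k)" if "k \<le> K" for k using alg[of "K - k"] that by simp
  define X' where "X' = x ` {..<K}"
  have \<alpha>X: "\<alpha> \<in> ring_gen X'" using K x0 by (intro ring_gen.base) (force simp: X'_def)
  have xs: "x (Suc k) \<in> ring_gen X'" if "k < K" for k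
  proof (cases "Suc k = K")
    case True
    thus ?thesis using xK ring_gen_minus[OF ring_gen_evZ[OF \<alpha>X]] by simp
  next
    case False
    thus ?thesis using that by (intro ring_gen.base) (auto simp: X'_def)
  qed
  have "ring_gen X' \<subseteq> padic_ints p"
  proof (rule ring_gen_subset_padic_ints[OF p])
    show "algebraic_int z" if "z \<in> X'" for z using that alg' by (auto simp: X'_def)
    fix z assume "z \<in> X'"
    then obtain k where k: "k < K" "z = x k" by (auto simp: X'_def)
    have "frob_quot p z = x (Suc k) * evZ q z + evZ s z"
      unfolding k(2) by (rule frob_quot_via_divisor[OF qs p0 step])
    also have "\<dots> \<in> ring_gen X'"
      using xs[OF k(1)] ring_gen.base[OF \<open>z \<in> X'\<close>] by (intro ring_gen.add ring_gen.mult ring_gen_evZ)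
    finally show "frob_quot p z \<in> ring_gen X'" .
  qed
  thus ?thesis using \<alpha>X by blast
qed

lemma chinese_remainder_int:
  fixes m a :: "'a \<Rightarrow> int"
  assumes "finite I" "\<And>i. i \<in> I \<Longrightarrow> m i > 0" "\<And>i j. i \<in> I \<Longrightarrow> j \<in> I \<Longrightarrow> i \<noteq> j \<Longrightarrow> coprime (m i) (m j)"
  shows "\<exists>x. 0 \<le> x \<and> x < prod m I \<and> (\<forall>i\<in>I. m i dvd x - a i)"
  using assms
proof (induction I rule: finite_induct)
  case empty
  show ?case by (intro exI[of _ 0]) auto
next
  case (insert j I)
  then obtain x where x: "\<forall>i\<in>I. m i dvd x - a i" by auto
  have "coprime (m j) (prod m I)" using insert by (intro prod_coprime_right) auto
  then obtain u v where uv: "u * m j + v * prod m I = 1" using bezout_int[of "m j" "prod m I"] by (auto simp: coprime_iff_gcd_eq_1)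
  define y where "y = x + (a j - x) * v * prod m I"
  define M where "M = prod m (insert j I)"
  have M0: "M > 0" using insert unfolding M_def by (intro prod_pos) auto
  have "m i dvd y mod M - a i" if i: "i \<in> insert j I" for i
  proof -
    have "m i dvd y - a i"
    proof (cases "i = j")
      case True
      have "y - a j = (x - a j) * (1 - v * prod m I)" by (simp add: y_def algebra_simps)
      also have "1 - v * prod m I = u * m j" using uv by simp
      finally show ?thesis using True by simp
    next
      case False
      hence "i \<in> I" using i by simp
      hence "m i dvd prod m I" using insert.hyps(1) by (intro dvd_prodI)
      hence "m i dvd (a j - x) * v * prod m I" by (rule dvd_mult)
      moreover have "m i dvd x - a i" using x \<open>i \<in> I\<close> by blast
      ultimately have "m i dvd (x - a i) + (a j - x) * v * prod m I" by (intro dvd_add)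
      thus ?thesis by (simp add: y_def algebra_simps)
    qed
    moreover have "m i dvd M" unfolding M_def using i insert.hyps(1) by (intro dvd_prodI) auto
    moreover have "y mod M - a i = (y - a i) - M * (y div M)" by (simp add: minus_div_mult_eq_mod[symmetric])
    ultimately show ?thesis by (metis dvd_diff dvd_mult2)
  qed
  thus ?case using M0 unfolding M_def[symmetric] by (intro exI[of _ "y mod M"]) auto
qed

lemma chinese_remainder_monic_poly:
  fixes m :: "'a \<Rightarrow> int" and G :: "'a \<Rightarrow> int poly"
  assumes "finite I" "\<And>i. i \<in> I \<Longrightarrow> m i > 0" "\<And>i j. i \<in> I \<Longrightarrow> j \<in> I \<Longrightarrow> i \<noteq> j \<Longrightarrow> coprime (m i) (m j)"
    and G: "\<And>i. i \<in> I \<Longrightarrow> lead_coeff (G i) = 1" "\<And>i. i \<in> I \<Longrightarrow> degree (G i) = d"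
  obtains f where "lead_coeff f = 1" "degree f = d" "\<And>k. \<bar>coeff f k\<bar> \<le> prod m I" "\<And>i k. i \<in> I \<Longrightarrow> m i dvd coeff (f - G i) k"
proof -
  have "\<forall>k. \<exists>x. 0 \<le> x \<and> x < prod m I \<and> (\<forall>i\<in>I. m i dvd x - coeff (G i) k)"
  proof
    fix k
    show "\<exists>x. 0 \<le> x \<and> x < prod m I \<and> (\<forall>i\<in>I. m i dvd x - coeff (G i) k)"
      by (rule chinese_remainder_int[where a = "\<lambda>i. coeff (G i) k"]) (use assms(1-3) in auto)
  qed
  then obtain c where c: "\<And>k. 0 \<le> c k" "\<And>k. c k < prod m I" "\<And>k i. i \<in> I \<Longrightarrow> m i dvd c k - coeff (G i) k" by metis
  define r where "r = (\<Sum>k<d. monom (c k) k)"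
  define f where "f = monom 1 d + r"
  have cr: "coeff r k = (if k < d then c k else 0)" for k by (simp add: r_def coeff_sum)
  have cf: "coeff f k = (if k < d then c k else if k = d then 1 else 0)" for k by (simp add: f_def cr)
  have deg: "degree f = d"
  proof (rule antisym)
    show "degree f \<le> d" by (rule degree_le) (simp add: cf)
    show "d \<le> degree f" by (rule le_degree) (simp add: cf)
  qed
  show ?thesis
  proof (rule that)
    show "lead_coeff f = 1" "degree f = d" using deg cf by simp_all
    have "1 \<le> prod m I" using c(1)[of 0] c(2)[of 0] by linarith
    thus "\<bar>coeff f k\<bar> \<le> prod m I" for k using c(1,2)[of k] by (auto simp: cf)
    show "m i dvd coeff (f - G i) k" if i: "i \<in> I" for i k
      using c(3)[OF i, of k] G(1,2)[OF i] by (auto simp: cf coeff_eq_0)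
  qed
qed

lemma eisenstein_at_two:
  fixes f :: "int poly"
  assumes f: "lead_coeff f = 1" "degree f > 0" and ev: "\<And>i. i < degree f \<Longrightarrow> even (coeff f i)" and c0: "\<not> 4 dvd coeff f 0"
    and r: "evZ f \<alpha> = 0"
  shows "Factorial_Ring.irreducible (map_poly rat_of_int f)"
proof -
  have "algebraic_int \<alpha>" using f(1) r algebraic_int_iff_evZ by blast
  then obtain h where h: "lead_coeff h = 1" "Factorial_Ring.irreducible (map_poly rat_of_int h)" "evZ h \<alpha> = 0"
    using int_minimal_polynomial_exists by blast
  obtain k where k: "f = h * k" using int_minimal_polynomial_dvd[OF h r] .
  have nz: "h \<noteq> 0" "k \<noteq> 0" using f k by auto
  have lk: "lead_coeff k = 1" using f(1) h(1) unfolding k by (simp add: lead_coeff_mult)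
  have deg: "degree f = degree h + degree k" unfolding k using nz by (rule degree_mult_eq)
  have dh: "degree h > 0" using irreducible_degree_pos[OF h(2)] by simp
  define i where "i = (LEAST i. odd (coeff h i))"
  define j where "j = (LEAST j. odd (coeff k j))"
  have i: "odd (coeff h i)" "\<And>l. l < i \<Longrightarrow> even (coeff h l)" "i \<le> degree h"
  proof -
    have o: "odd (coeff h (degree h))" using h(1) by simp
    show "odd (coeff h i)" unfolding i_def by (rule LeastI[of _ "degree h"]) (rule o)
    show "\<And>l. l < i \<Longrightarrow> even (coeff h l)" unfolding i_def using not_less_Least by blast
    show "i \<le> degree h" unfolding i_def by (rule Least_le) (rule o)
  qed
  have j: "odd (coeff k j)" "\<And>l. l < j \<Longrightarrow> even (coeff k l)" "j \<le> degree k"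
  proof -
    have o: "odd (coeff k (degree k))" using lk by simp
    show "odd (coeff k j)" unfolding j_def by (rule LeastI[of _ "degree k"]) (rule o)
    show "\<And>l. l < j \<Longrightarrow> even (coeff k l)" unfolding j_def using not_less_Least by blast
    show "j \<le> degree k" unfolding j_def by (rule Least_le) (rule o)
  qed
  have "odd (coeff f (i + j))"
  proof -
    have "coeff f (i + j) = (\<Sum>l\<le>i+j. coeff h l * coeff k (i + j - l))" unfolding k by (rule coeff_mult)
    also have "\<dots> = coeff h i * coeff k j + (\<Sum>l\<in>{..i+j} - {i}. coeff h l * coeff k (i + j - l))"
      by (subst sum.remove[of _ i]) auto
    finally have eq: "coeff f (i + j) = coeff h i * coeff k j + (\<Sum>l\<in>{..i+j} - {i}. coeff h l * coeff k (i + j - l))" .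
    have "even (\<Sum>l\<in>{..i+j} - {i}. coeff h l * coeff k (i + j - l))"
    proof (rule dvd_sum)
      fix l assume l: "l \<in> {..i+j} - {i}"
      show "even (coeff h l * coeff k (i + j - l))"
      proof (cases "l < i")
        case True
        thus ?thesis using i(2) by simp
      next
        case False
        hence "i + j - l < j" using l by auto
        thus ?thesis using j(2) by simp
      qed
    qed
    thus ?thesis unfolding eq using i(1) j(1) by simp
  qed
  hence "i + j \<ge> degree f" using ev by (meson not_le)
  hence ij: "i = degree h" "j = degree k" using i(3) j(3) deg by auto
  have "degree k = 0"
  proof (rule ccontr)
    assume "degree k \<noteq> 0"
    hence "even (coeff h 0)" "even (coeff k 0)" using i(2)[of 0] j(2)[of 0] ij dh by auto
    hence "2 * 2 dvd coeff h 0 * coeff k 0" by (rule mult_dvd_mono)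
    thus False using c0 unfolding k coeff_mult_0 by simp
  qed
  hence "k = 1" using lk by (metis degree_eq_zeroE lead_coeff_pCons(2) one_pCons coeff_pCons_0 degree_pCons_0)
  thus ?thesis using h(2) k by simp
qed

definition two_exp :: "nat \<Rightarrow> nat" where "two_exp p = (SOME m. 2 ^ m \<le> p \<and> p < 2 ^ Suc m)"

lemma two_exp: "p > 0 \<Longrightarrow> 2 ^ two_exp p \<le> p \<and> p < 2 ^ Suc (two_exp p)"
proof -
  assume "p > 0"
  hence "\<exists>m. 2 ^ m \<le> p \<and> p < 2 ^ Suc m"
  proof (induction p rule: nat_less_induct)
    case (1 p)
    show ?case
    proof (cases "p = 1")
      case True
      thus ?thesis by (intro exI[of _ 0]) auto
    next
      case False
      hence "p div 2 < p" "p div 2 > 0" using 1(2) by auto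
      then obtain m where "2 ^ m \<le> p div 2" "p div 2 < 2 ^ Suc m" using 1(1) by blast
      hence "2 ^ Suc m \<le> p \<and> p < 2 ^ Suc (Suc m)" by auto
      thus ?thesis by blast
    qed
  qed
  thus ?thesis unfolding two_exp_def by (rule someI_ex)
qed

definition cost :: "nat \<Rightarrow> real" where "cost p = ln p / (2 ^ two_exp p - 1)"

lemma cost_small: "e > 0 \<Longrightarrow> \<exists>N. \<forall>p>N. cost p \<le> e"
proof -
  assume e: "e > 0"
  obtain N :: nat where N: "(8 / e)\<^sup>2 \<le> real N" using real_arch_simple by blast
  have "cost p \<le> e" if p: "p > max N 4" for p
  proof -
    define x where "x = sqrt p"
    have x: "x > 2" "x\<^sup>2 = real p"
      using p real_sqrt_less_mono[of 4 "real p"] by (auto simp: x_def)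
    have "8 / e \<le> x" unfolding x_def using N p by (intro real_le_rsqrt) auto
    hence ex: "8 \<le> e * x" using e by (simp add: field_simps)
    have "real p < 2 ^ Suc (two_exp p)" using two_exp[of p] p by (metis of_nat_less_numeral_power_cancel_iff gr_implies_not0 neq0_conv)
    hence D: "real p / 4 \<le> 2 ^ two_exp p - 1" using p by simp
    have "ln (real p) = 2 * ln x" using x by (simp add: x_def ln_sqrt)
    also have "\<dots> \<le> 2 * x" using ln_bound[of x] x by simp
    finally have "cost p \<le> 2 * x / (real p / 4)"
      unfolding cost_def using D p x by (intro frac_le) auto
    also have "\<dots> = 8 / x" using x by (simp add: x(2)[symmetric] power2_eq_square field_simps)
    also have "\<dots> \<le> e" using ex x by (simp add: field_simps)
    finally show ?thesis .
  qed
  thus ?thesis by blast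
qed

theorem small_totally_padic_integers:
  assumes P: "finite P" "\<And>p. p \<in> P \<Longrightarrow> Factorial_Ring.prime p \<and> p > 2"
  obtains h \<alpha> where "Factorial_Ring.irreducible h" "evQ h \<alpha> = 0" "degree h > n0" "algebraic_int \<alpha>"
    "\<And>p. p \<in> P \<Longrightarrow> \<alpha> \<in> padic_ints p" "weil_height \<alpha> \<le> 4 + (\<Sum>p\<in>P. cost p)"
proof -
  have te: "two_exp p > 0" if "p \<in> P" for p
    using two_exp[of p] P(2)[OF that] by (cases "two_exp p") auto
  define e where "e = Suc n0 * (\<Prod>p\<in>P. two_exp p)"
  define d :: nat where "d = 2 ^ e"
  have pe: "(\<Prod>p\<in>P. two_exp p) > 0" using te by (intro prod_pos) auto
  have e0: "e > n0" unfolding e_def using pe by (metis Suc_le_eq mult.right_neutral mult_le_mono2 One_nat_def)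
  have d: "d > n0" "d > 1" using e0 less_exp[of e] unfolding d_def by (linarith, metis e0 one_less_numeral_iff one_less_power semiring_norm(76) gr_implies_not0 neq0_conv)
  define D where "D = (\<lambda>p. 2 ^ two_exp p :: nat)"
  define K where "K = (\<lambda>p. e div two_exp p)"
  have eK: "two_exp p * K p = e" if "p \<in> P" for p
    unfolding K_def e_def using P(1) that by (intro dvd_mult_div_cancel dvd_mult dvd_prodI)
  have K0: "K p > 0" if "p \<in> P" for p using eK[OF that] e0 by (cases "K p") auto
  have DK: "D p ^ K p = d" if "p \<in> P" for p
    unfolding D_def d_def eK[OF that, symmetric] by (simp add: power_mult)
  have D: "1 < D p" "D p \<le> p" if "p \<in> P" for p
    using two_exp[of p] P(2)[OF that] te[OF that] by (auto simp: D_def)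
  define E where "E = (\<lambda>p. tower_exp (D p) (K p))"
  define m where "m = (\<lambda>p. if p = 2 then 4 else int p ^ E p)"
  define G where "G = (\<lambda>p. if p = 2 then monom 1 d + [:2:] else tower_poly p (D p) (K p))"
  have n2: "2 \<notin> P" using P(2) by blast
  have prP: "Factorial_Ring.prime p" "p \<noteq> 2" "p > 2" if "p \<in> P" for p using P(2)[OF that] by auto
  have cop: "coprime (m i) (m j)" if "i \<in> insert 2 P" "j \<in> insert 2 P" "i \<noteq> j" for i j
  proof -
    have pr: "Factorial_Ring.prime i" "Factorial_Ring.prime j" using that(1,2) prP two_is_prime_nat by auto
    have "coprime i j" using primes_coprime[OF pr that(3)] .
    hence "coprime (int i) (int j)" by simp
    moreover have "\<exists>k. m l = int l ^ k" for l by (cases "l = 2") (auto simp: m_def intro: exI[of _ 2])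
    ultimately show ?thesis by (metis coprime_power_left_iff coprime_power_right_iff)
  qed
  have Gm: "lead_coeff (G i) = 1" "degree (G i) = d" if "i \<in> insert 2 P" for i
  proof -
    have "lead_coeff (G i) = 1 \<and> degree (G i) = d"
    proof (cases "i = 2")
      case True
      thus ?thesis using lead_coeff_monom_add[of "[:2::int:]" d] d by (simp add: G_def)
    next
      case False
      hence "i \<in> P" using that by simp
      thus ?thesis using tower_poly_monic[of "D i" i "K i"] D[of i] DK[of i] False by (auto simp: G_def)
    qed
    thus "lead_coeff (G i) = 1" "degree (G i) = d" by auto
  qed
  have mpos: "m i > 0" if "i \<in> insert 2 P" for i
    using that prime_gt_0_nat[OF prP(1)] by (auto simp: m_def)
  obtain f where f: "lead_coeff f = 1" "degree f = d" "\<And>k. \<bar>coeff f k\<bar> \<le> prod m (insert 2 P)"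
    "\<And>i k. i \<in> insert 2 P \<Longrightarrow> m i dvd coeff (f - G i) k"
    using chinese_remainder_monic_poly[of "insert 2 P" m G d] P(1) mpos cop Gm by blast
  have d0: "degree f > 0" using f(2) d by simp
  have "\<exists>\<alpha>. evZ f \<alpha> = 0"
    using fundamental_theorem_of_algebra[of "map_poly complex_of_int f"] d0 by (simp add: evZ_def constant_degree)
  then obtain \<alpha> where \<alpha>: "evZ f \<alpha> = 0" by blast
  have f4: "4 dvd coeff f k - coeff (monom 1 d + [:2:]) k" for k using f(4)[of 2 k] by (simp add: m_def G_def)
  have irr: "Factorial_Ring.irreducible (map_poly rat_of_int f)"
  proof (rule eisenstein_at_two[OF f(1) d0 _ _ \<alpha>])
    fix i assume i: "i < degree f"
    have "(2::int) dvd 4" by simp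
    hence "even (coeff f i - coeff (monom 1 d + [:2:]) i)" using f4[of i] by (rule dvd_trans)
    moreover have "even (coeff (monom 1 d + [:2::int:]) i)" using i f(2) by (simp add: coeff_pCons split: nat.split)
    ultimately show "even (coeff f i)" by simp
  next
    have "coeff (monom 1 d + [:2::int:]) 0 = 2" using d by simp
    thus "\<not> 4 dvd coeff f 0" using f4[of 0] by presburger
  qed
  have int: "algebraic_int \<alpha>" using f(1) \<alpha> algebraic_int_iff_evZ by blast
  have padic: "\<alpha> \<in> padic_ints p" if p: "p \<in> P" for p
  proof (rule tower_padic[OF prP(1)[OF p] _ D(2)[OF p] K0[OF p] int \<alpha>])
    show "0 < D p" using D[OF p] by simp
    show "int p ^ tower_exp (D p) (K p) dvd coeff (f - tower_poly p (D p) (K p)) i" for i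
      using f(4)[of p i] p prP(2)[OF p] by (simp add: m_def G_def E_def)
  qed
  define N where "N = (\<Prod>i\<in>insert 2 P. nat (m i))"
  have Nm: "int N = prod m (insert 2 P)" unfolding N_def of_nat_prod using mpos by (intro prod.cong refl) (metis less_imp_le nat_0_le)
  have Nr: "real N = 4 * (\<Prod>p\<in>P. real p ^ E p)"
  proof -
    have "real N = real_of_int (prod m (insert 2 P))" using Nm by (metis of_int_of_nat_eq)
    also have "prod m (insert 2 P) = 4 * prod m P" using P(1) n2 by (simp add: m_def)
    also have "prod m P = (\<Prod>p\<in>P. int p ^ E p)" using prP(2) by (intro prod.cong) (auto simp: m_def)
    finally show ?thesis by simp
  qed
  have "weil_height \<alpha> \<le> ln ((degree f + 1) * N) / degree f"
    using weil_height_le[OF f(1) irr \<alpha>, of N] f(3) Nm by simp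
  also have "ln ((degree f + 1) * N) = ln (real (d + 1)) + (ln 4 + (\<Sum>p\<in>P. E p * ln p))"
  proof -
    have pos: "(\<Prod>p\<in>P. real p ^ E p) > 0" using prP(3) by (intro prod_pos) force
    have "ln (\<Prod>p\<in>P. real p ^ E p) = (\<Sum>p\<in>P. ln (real p ^ E p))" using prP(3) P(1) by (intro ln_prod) force+
    also have "\<dots> = (\<Sum>p\<in>P. E p * ln p)" by (intro sum.cong) (auto simp: ln_realpow dest: prP(3))
    finally have lnp: "ln (\<Prod>p\<in>P. real p ^ E p) = (\<Sum>p\<in>P. E p * ln p)" .
    have "real ((degree f + 1) * N) = real (d + 1) * (4 * (\<Prod>p\<in>P. real p ^ E p))" by (simp add: f(2) Nr algebra_simps)
    also have "ln \<dots> = ln (real (d + 1)) + (ln 4 + ln (\<Prod>p\<in>P. real p ^ E p))"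
      using pos by (simp add: ln_mult)
    finally show ?thesis using lnp by simp
  qed
  also have "(ln (real (d + 1)) + (ln 4 + (\<Sum>p\<in>P. E p * ln p))) / degree f \<le> 4 + (\<Sum>p\<in>P. cost p)"
  proof -
    have "(\<Sum>p\<in>P. E p * ln p) \<le> (\<Sum>p\<in>P. cost p * d)"
    proof (intro sum_mono)
      fix p assume p: "p \<in> P"
      have "(D p - 1) * E p + 1 = d" using tower_exp_eq[of "D p" "K p"] D[OF p] DK[OF p] by (simp add: E_def)
      hence "real ((D p - 1) * E p) \<le> real d" by linarith
      hence "(2 ^ two_exp p - 1) * real (E p) \<le> d" using D[OF p] by (simp add: D_def of_nat_diff)
      moreover have Dp: "(2::real) ^ two_exp p - 1 > 0" using te[OF p] by simp
      ultimately have "real (E p) \<le> d / (2 ^ two_exp p - 1)" by (simp add: field_simps)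
      hence "real (E p) * ln p \<le> d / (2 ^ two_exp p - 1) * ln p" using prP(3)[OF p] by (intro mult_right_mono) auto
      thus "E p * ln p \<le> cost p * d" by (simp add: cost_def mult.commute)
    qed
    also have "\<dots> = (\<Sum>p\<in>P. cost p) * d" by (simp add: sum_distrib_right)
    finally have 1: "(\<Sum>p\<in>P. E p * ln p) \<le> (\<Sum>p\<in>P. cost p) * d" .
    have 2: "ln (real (d + 1)) \<le> d" using ln_add_one_self_le_self[of "real d"] by (simp add: add.commute)
    have "ln (4::real) \<le> 3" using ln_le_minus_one[of "4::real"] by simp
    hence "ln (4::real) \<le> 3 * d" using d by simp
    hence "ln (real (d + 1)) + (ln 4 + (\<Sum>p\<in>P. E p * ln p)) \<le> (4 + (\<Sum>p\<in>P. cost p)) * d"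
      using 1 2 by (simp add: algebra_simps)
    thus ?thesis using d f(2) by (simp add: divide_le_eq)
  qed
  finally have ht: "weil_height \<alpha> \<le> 4 + (\<Sum>p\<in>P. cost p)" .
  show ?thesis
    by (rule that[OF irr _ _ int padic ht]) (use \<alpha> f(2) d in auto)
qed

definition admissible :: "nat \<Rightarrow> nat set \<Rightarrow> complex set \<Rightarrow> bool" where
  "admissible n P V \<longleftrightarrow> finite P \<and> card P = n \<and> (\<forall>p\<in>P. Factorial_Ring.prime p \<and> p > 2) \<and> (\<Sum>p\<in>P. cost p) \<le> 2 - 1 / 2 ^ n \<and>
     finite V \<and> card V = n \<and> (\<forall>x\<in>V. algebraic_int x \<and> x \<noteq> 0 \<and> weil_height x < 7 \<and> (\<forall>p\<in>P. x \<in> padic_ints p))"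

lemma degree_bound_finite:
  assumes "finite V" "\<And>x. x \<in> V \<Longrightarrow> algebraic x"
  obtains n where "\<And>x h. x \<in> V \<Longrightarrow> Factorial_Ring.irreducible h \<Longrightarrow> evQ h x = 0 \<Longrightarrow> degree h \<le> n"
proof -
  have "\<exists>f. f \<noteq> 0 \<and> evQ f x = 0" if "x \<in> V" for x using assms(2)[OF that] algebraic_iff_evQ by blast
  then obtain f where f: "\<And>x. x \<in> V \<Longrightarrow> f x \<noteq> 0 \<and> evQ (f x) x = 0" by metis
  have "degree h \<le> Max (insert 0 ((\<lambda>x. degree (f x)) ` V))" if h: "x \<in> V" "Factorial_Ring.irreducible h" "evQ h x = 0" for x h
  proof -
    have "h dvd f x" using irreducible_root_dvd[OF h(2,3)] f[OF h(1)] by blast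
    hence "degree h \<le> degree (f x)" using f[OF h(1)] by (intro dvd_imp_degree_le) auto
    also have "\<dots> \<le> Max (insert 0 ((\<lambda>x. degree (f x)) ` V))" using h(1) assms(1) by (intro Max_ge) auto
    finally show ?thesis .
  qed
  thus ?thesis by (rule that)
qed

lemma admissible_step:
  assumes A: "admissible n P V"
  obtains p \<alpha> where "admissible (Suc n) (insert p P) (insert \<alpha> V)"
proof -
  have P: "finite P" "card P = n" "\<And>p. p \<in> P \<Longrightarrow> Factorial_Ring.prime p \<and> p > 2" "(\<Sum>p\<in>P. cost p) \<le> 2 - 1 / 2 ^ n"
    and V: "finite V" "card V = n" "\<And>x. x \<in> V \<Longrightarrow> algebraic_int x \<and> x \<noteq> 0 \<and> weil_height x < 7 \<and> (\<forall>p\<in>P. x \<in> padic_ints p)"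
    using A by (auto simp: admissible_def)
  obtain N where N: "\<And>p. p > N \<Longrightarrow> cost p \<le> 1 / 2 ^ Suc n" using cost_small[of "1 / 2 ^ Suc n"] by auto
  obtain p where p: "Factorial_Ring.prime p" "p > Max (insert 2 (insert N P))" "V \<subseteq> padic_ints p"
    using split_prime_exists[OF V(1)] V(3) by metis
  have big: "p > 2" "p > N" "\<And>q. q \<in> P \<Longrightarrow> q < p" using p(2) P(1) by auto
  have pP: "p \<notin> P" using big(3) by blast
  define P' where "P' = insert p P"
  have P': "finite P'" "\<And>q. q \<in> P' \<Longrightarrow> Factorial_Ring.prime q \<and> q > 2" using P p big by (auto simp: P'_def)
  have "(\<Sum>q\<in>P'. cost q) = cost p + (\<Sum>q\<in>P. cost q)" unfolding P'_def using P(1) pP by simp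
  also have "\<dots> \<le> 1 / 2 ^ Suc n + (2 - 1 / 2 ^ n)" using N[OF big(2)] P(4) by (rule add_mono)
  also have "\<dots> = 2 - 1 / 2 ^ Suc n" by (simp add: field_simps)
  finally have c: "(\<Sum>q\<in>P'. cost q) \<le> 2 - 1 / 2 ^ Suc n" .
  have "algebraic x" if "x \<in> insert 0 V" for x using that V(3) by auto
  then obtain n0 where n0: "\<And>x h. x \<in> insert 0 V \<Longrightarrow> Factorial_Ring.irreducible h \<Longrightarrow> evQ h x = 0 \<Longrightarrow> degree h \<le> n0"
    using degree_bound_finite[of "insert 0 V"] V(1) by (metis finite_insert)
  obtain h \<alpha> where a: "Factorial_Ring.irreducible h" "evQ h \<alpha> = 0" "degree h > n0" "algebraic_int \<alpha>"
    "\<And>q. q \<in> P' \<Longrightarrow> \<alpha> \<in> padic_ints q" "weil_height \<alpha> \<le> 4 + (\<Sum>q\<in>P'. cost q)"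
    using small_totally_padic_integers[OF P', of n0] by blast
  have new: "\<alpha> \<notin> insert 0 V" using n0[OF _ a(1,2)] a(3) by (meson not_le)
  have "(1::real) / 2 ^ Suc n > 0" by simp
  hence "weil_height \<alpha> < 7" using a(6) c by linarith
  hence "admissible (Suc n) P' (insert \<alpha> V)"
    unfolding admissible_def using P'(1,2) P(1,2) pP c V new a(4,5) p(3) by (auto simp: P'_def)
  thus ?thesis using that unfolding P'_def by blast
qed

lemma admissible_chain:
  obtains P V where "\<And>n. admissible n (P n) (V n)" "\<And>n. P n \<subseteq> P (Suc n)" "\<And>n. V n \<subseteq> V (Suc n)"
proof -
  have "\<exists>S. \<forall>n. admissible n (fst (S n)) (snd (S n)) \<and> (fst (S n) \<subseteq> fst (S (Suc n)) \<and> snd (S n) \<subseteq> snd (S (Suc n)))"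
  proof (rule dependent_nat_choice)
    have "admissible 0 {} {}" by (simp add: admissible_def)
    thus "\<exists>s. admissible 0 (fst s) (snd s)" by (intro exI[of _ "({}, {})"]) simp
    fix s n assume s: "admissible n (fst s) (snd s)"
    obtain p \<alpha> where "admissible (Suc n) (insert p (fst s)) (insert \<alpha> (snd s))" using admissible_step[OF s] .
    thus "\<exists>t. admissible (Suc n) (fst t) (snd t) \<and> fst s \<subseteq> fst t \<and> snd s \<subseteq> snd t"
      by (intro exI[of _ "(insert p (fst s), insert \<alpha> (snd s))"]) auto
  qed
  then obtain S where "\<forall>n. admissible n (fst (S n)) (snd (S n)) \<and> (fst (S n) \<subseteq> fst (S (Suc n)) \<and> snd (S n) \<subseteq> snd (S (Suc n)))" by blast
  thus ?thesis using that[of "\<lambda>n. fst (S n)" "\<lambda>n. snd (S n)"] by blast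
qed

lemma infinite_Union_of_cards:
  assumes "\<And>n. finite (Q n) \<and> card (Q n) = n" shows "infinite (\<Union>n. Q n)"
proof
  assume fin: "finite (\<Union>n. Q n)"
  define k where "k = Suc (card (\<Union>n. Q n))"
  have "card (Q k) \<le> card (\<Union>n. Q n)" using fin by (intro card_mono) auto
  thus False using assms[of k] by (simp add: k_def)
qed

theorem proposition1p3:
  shows "\<exists>K :: complex set. galois_over_Q K \<and>
    infinite {p :: nat. Factorial_Ring.prime p \<and> totally_split p K} \<and>
    \<not> northcott K"
proof -
  obtain P V where PV: "\<And>n. admissible n (P n) (V n)" "\<And>n. P n \<subseteq> P (Suc n)" "\<And>n. V n \<subseteq> V (Suc n)"
    using admissible_chain by blast
  have mono: "P i \<subseteq> P j" "V i \<subseteq> V j" if "i \<le> j" for i j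
    using lift_Suc_mono_le[of P, OF PV(2) that] lift_Suc_mono_le[of V, OF PV(3) that] by auto
  define S where "S = (\<Union>n. P n)"
  have S: "Factorial_Ring.prime p" if "p \<in> S" for p using that PV(1) by (auto simp: S_def admissible_def)
  have V: "x \<in> padic_ints p" if x: "x \<in> V i" "p \<in> P j" for x p i j
  proof -
    have "x \<in> V (max i j)" "p \<in> P (max i j)" using mono[of i "max i j"] mono[of j "max i j"] x by auto
    thus ?thesis using PV(1)[of "max i j"] by (auto simp: admissible_def)
  qed
  define K where "K = padic_field S"
  have VK: "(\<Union>n. V n) \<subseteq> {x \<in> K - {0}. weil_height x < 7}"
  proof
    fix x assume "x \<in> (\<Union>n. V n)"
    then obtain i where i: "x \<in> V i" by blast
    hence xi: "algebraic_int x" "x \<noteq> 0" "weil_height x < 7" using PV(1)[of i] by (auto simp: admissible_def)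
    have "\<exists>M>0. of_nat M * x \<in> padic_ints p" if "p \<in> S" for p
      using that V[OF i] by (intro exI[of _ 1]) (auto simp: S_def)
    thus "x \<in> {x \<in> K - {0}. weil_height x < 7}"
      using xi algebraic_int_imp_algebraic by (auto simp: K_def padic_field_def)
  qed
  have "infinite (\<Union>n. V n)" using PV(1) by (intro infinite_Union_of_cards) (auto simp: admissible_def)
  hence "infinite {x \<in> K - {0}. weil_height x < 7}" using VK finite_subset by blast
  hence "\<not> northcott K" unfolding northcott_def by (auto intro!: exI[of _ 7])
  moreover have "infinite S" unfolding S_def using PV(1) by (intro infinite_Union_of_cards) (auto simp: admissible_def)
  moreover have "S \<subseteq> {p. Factorial_Ring.prime p \<and> totally_split p K}"
    unfolding K_def using S totally_split_padic_field by blast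
  ultimately show ?thesis using padic_field_galois[of S] S finite_subset unfolding K_def[symmetric] by blast
qed

end
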